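(* Let $X$ be a real hereditarily indecomposable (HI) Banach space. Then either $X$ has type $\mathbb{R}$, or $X$ is even, or $X$ is odd, and these three cases are mutually exclusive.
   Context: Banach spaces are infinite-dimensional. A subspace of a Banach space means an infinite-dimensional closed subspace; operators are bounded and linear; hyperplanes are closed subspaces of codimension $1$ (they are all mutually isomorphic). A Banach space is hereditarily indecomposable (HI) if it contains no topological direct sum of two subspaces, i.e. there are no infinite-dimensional closed subspaces $Y,Z$ with $Y\cap Z=\{0\}$ and $Y+Z$ closed. $\mathcal{L}(X)$ is the algebra of operators on $X$. An operator on $X$ is strictly singular if it induces no isomorphism between two subspaces of $X$; the set $\mathcal{S}(X)$ of these is a closed two-sided ideal of $\mathcal{L}(X)$. Type: by a theorem of Ferenczi, for a real HI space $X$, the quotient algebra $\mathcal{L}(X)/\mathcal{S}(X)$ is isomorphic, as a unital Banach algebra, to $\mathbb{R}$, to $\mathbb{C}$, or to the quaternion algebra $\mathbb{H}$; $X$ is said to have type $\mathbb{R}$, $\mathbb{C}$ or $\mathbb{H}$ accordingly. A complex structure on a real Banach space $Y$ is an operator $I\in\mathcal{L}(Y)$ with $I^2=-\mathrm{Id}_Y$ (equivalently, $Y$ is isomorphic, as a real Banach space, to some complex Banach space). A real Banach space $X$ is even if it admits a complex structure and its hyperplanes do not; it is odd if it does not admit a complex structure and its hyperplanes do. *)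

theory Defs
  imports "HOL-Analysis.Analysis"
begin

text \<open>The Banach space \<open>X\<close> is a type of class \<^class>\<open>banach\<close> (real scalars), and
  \<open>\<L>(X)\<close> is the type of bounded linear maps with composition \<open>o\<^sub>L\<close> as product.
  Subspaces of \<open>X\<close> are sets of vectors.\<close>

text \<open>The constant \<open>dim\<close> is \<open>0\<close> on infinite-dimensional subspaces, so it cannot be used here.\<close>

definition infinite_dimensional :: "'a::real_vector set \<Rightarrow> bool" where
  "infinite_dimensional S \<longleftrightarrow> \<not> (\<exists>B. finite B \<and> span B = S)"

definition banach_subspace :: "'a::banach set \<Rightarrow> bool" where
  "banach_subspace Y \<longleftrightarrow> subspace Y \<and> closed Y \<and> infinite_dimensional Y"

definition hereditarily_indecomposable :: "'a::banach itself \<Rightarrow> bool" where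
  "hereditarily_indecomposable _ \<longleftrightarrow>
     infinite_dimensional (UNIV :: 'a set) \<and>
     \<not> (\<exists>Y Z :: 'a set. banach_subspace Y \<and> banach_subspace Z \<and>
          Y \<inter> Z = {0} \<and> closed {y + z | y z. y \<in> Y \<and> z \<in> Z})"

definition hyperplane :: "'a::banach set \<Rightarrow> bool" where
  "hyperplane H \<longleftrightarrow> subspace H \<and> closed H \<and> (\<exists>v. v \<notin> H \<and> span (insert v H) = UNIV)"

definition strictly_singular :: "('a::banach \<Rightarrow>\<^sub>L 'a) \<Rightarrow> bool" where
  "strictly_singular T \<longleftrightarrow>
     \<not> (\<exists>Y Z. banach_subspace Y \<and> banach_subspace Z \<and>
          (\<exists>g. homeomorphism Y Z (blinfun_apply T) g))"

definition ss_rel :: "(('a::banach \<Rightarrow>\<^sub>L 'a) \<times> ('a \<Rightarrow>\<^sub>L 'a)) set" where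
  "ss_rel = {(S, T). strictly_singular (S - T)}"

definition ss_class :: "('a::banach \<Rightarrow>\<^sub>L 'a) \<Rightarrow> ('a \<Rightarrow>\<^sub>L 'a) set" where
  "ss_class T = ss_rel `` {T}"

definition quotient_norm :: "('a::banach \<Rightarrow>\<^sub>L 'a) set \<Rightarrow> real" where
  "quotient_norm A = (INF T\<in>A. norm T)"

text \<open>Isomorphism of unital Banach algebras between \<open>\<L>(X)/\<S>(X)\<close> and \<open>'b\<close>: an algebra
  isomorphism that is bounded with bounded inverse, not necessarily isometric. The operations
  of the quotient are those induced on classes by the operations on representatives.\<close>

definition quotient_algebra_iso ::
  "(('a::banach \<Rightarrow>\<^sub>L 'a) set \<Rightarrow> 'b::{real_normed_algebra_1, banach}) \<Rightarrow> bool" where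
  "quotient_algebra_iso \<phi> \<longleftrightarrow>
     bij_betw \<phi> (UNIV // ss_rel) UNIV \<and>
     (\<forall>S T. \<phi> (ss_class (S + T)) = \<phi> (ss_class S) + \<phi> (ss_class T)) \<and>
     (\<forall>c T. \<phi> (ss_class (c *\<^sub>R T)) = c *\<^sub>R \<phi> (ss_class T)) \<and>
     (\<forall>S T. \<phi> (ss_class (S o\<^sub>L T)) = \<phi> (ss_class S) * \<phi> (ss_class T)) \<and>
     \<phi> (ss_class id_blinfun) = 1 \<and>
     (\<exists>K. \<forall>A \<in> UNIV // ss_rel. norm (\<phi> A) \<le> K * quotient_norm A) \<and>
     (\<exists>K. \<forall>A \<in> UNIV // ss_rel. quotient_norm A \<le> K * norm (\<phi> A))"

definition has_type :: "'a::banach itself \<Rightarrow> 'b::{real_normed_algebra_1, banach} itself \<Rightarrow> bool" where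
  "has_type _ _ \<longleftrightarrow> (\<exists>\<phi> :: ('a \<Rightarrow>\<^sub>L 'a) set \<Rightarrow> 'b. quotient_algebra_iso \<phi>)"

text \<open>A subspace \<open>Y\<close> is not a type, so a bounded operator on \<open>Y\<close> is a function on the ambient
  space whose values outside \<open>Y\<close> are irrelevant.\<close>

definition operator_on :: "'a::banach set \<Rightarrow> ('a \<Rightarrow> 'a) \<Rightarrow> bool" where
  "operator_on Y f \<longleftrightarrow>
     f \<in> Y \<rightarrow> Y \<and>
     (\<forall>x\<in>Y. \<forall>y\<in>Y. f (x + y) = f x + f y) \<and>
     (\<forall>c. \<forall>x\<in>Y. f (c *\<^sub>R x) = c *\<^sub>R f x) \<and>
     (\<exists>K. \<forall>x\<in>Y. norm (f x) \<le> K * norm x)"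

definition admits_complex_structure :: "'a::banach set \<Rightarrow> bool" where
  "admits_complex_structure Y \<longleftrightarrow> (\<exists>I. operator_on Y I \<and> (\<forall>y\<in>Y. I (I y) = - y))"

lemma admits_complex_structure_UNIV:
  "admits_complex_structure (UNIV :: 'a::banach set) \<longleftrightarrow>
     (\<exists>I :: 'a \<Rightarrow>\<^sub>L 'a. I o\<^sub>L I = - id_blinfun)"
proof
  assume "admits_complex_structure (UNIV :: 'a set)"
  then obtain I :: "'a \<Rightarrow> 'a" and K where add: "\<And>x y. I (x + y) = I x + I y"
    and scale: "\<And>c x. I (c *\<^sub>R x) = c *\<^sub>R I x" and K: "\<And>x. norm (I x) \<le> K * norm x"
    and sq: "\<And>y. I (I y) = - y"
    unfolding admits_complex_structure_def operator_on_def by auto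
  have "bounded_linear I"
    by (rule bounded_linear_intro[where K = K]) (use add scale K in \<open>auto simp: mult.commute\<close>)
  then have "Blinfun I o\<^sub>L Blinfun I = - id_blinfun"
    by (intro blinfun_eqI) (simp add: bounded_linear_Blinfun_apply sq blinfun.minus_left)
  then show "\<exists>I :: 'a \<Rightarrow>\<^sub>L 'a. I o\<^sub>L I = - id_blinfun" by blast
next
  assume "\<exists>I :: 'a \<Rightarrow>\<^sub>L 'a. I o\<^sub>L I = - id_blinfun"
  then obtain I :: "'a \<Rightarrow>\<^sub>L 'a" where I: "I o\<^sub>L I = - id_blinfun" by blast
  have "I (I y) = - y" for y
    using arg_cong[OF I, of "\<lambda>T. blinfun_apply T y"] by (simp add: blinfun.minus_left)
  moreover have "operator_on UNIV (blinfun_apply I)"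
    unfolding operator_on_def
    by (auto simp: blinfun.add_right blinfun.scaleR_right intro!: exI[of _ "norm I"] norm_blinfun)
  ultimately show "admits_complex_structure (UNIV :: 'a set)"
    unfolding admits_complex_structure_def by blast
qed

definition even_space :: "'a::banach itself \<Rightarrow> bool" where
  "even_space _ \<longleftrightarrow>
     admits_complex_structure (UNIV :: 'a set) \<and>
     (\<forall>H :: 'a set. hyperplane H \<longrightarrow> \<not> admits_complex_structure H)"

definition odd_space :: "'a::banach itself \<Rightarrow> bool" where
  "odd_space _ \<longleftrightarrow>
     \<not> admits_complex_structure (UNIV :: 'a set) \<and>
     (\<forall>H :: 'a set. hyperplane H \<longrightarrow> admits_complex_structure H)"

end

theory Submission imports Defs begin

text \<open>On a hereditarily indecomposable space an operator is either strictly singular or bounded below on a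
  subspace of finite codimension, because an operator that is bounded below on one subspace
  cannot be small on another. If some \<open>T\<close> is not a strictly singular perturbation of a scalar, then all operators on the
  broken line from \<open>1\<close> through \<open>T\<close> to \<open>-1\<close> are bounded below in finite codimension. Stability of the index along paths
  makes them Fredholm of index zero, and the square root of \<open>1\<close> can be continued along this path of
  commuting operators, modulo the closure of the finite-rank operators. This gives \<open>I\<close> with \<open>I\<^sup>2 + 1\<close>
  compact, and replaces the classification of real normed division algebras.

  Splitting off the generalized eigenspaces of the real eigenvalues of \<open>I\<close>, a finite-dimensional space by
  compactness, makes \<open>-J\<^sup>2\<close> connected to \<open>1\<close> by invertible operators for the compression \<open>J\<close> of \<open>I\<close>, so the
  same continuation argument gives an exact complex structure on a subspace of finite codimension. By
  parity it transfers to the space or to a hyperplane. Both cannot happen: if \<open>I\<close> is a complex structure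
  on the space and \<open>J\<close> one on a hyperplane, then one of \<open>I \<plusminus> J\<close> is complex linear from the hyperplane to
  the space and would have odd real index.\<close>

text \<open>Over real scalars a spectrum may be empty, so a square root is not read off from a
  functional calculus but carried along a path, a small factor at a time. It can be carried only if
  it commutes with each new factor; hence every root is required to commute with all that commutes
  with the initial operator. The detour through \<open>T\<close> is forced because the segment from
  1 to -1 meets 0. The index never occurs as a number. Semi-Fredholm means bounded below on the
  common kernel of finitely many functionals, index zero means invertible after a finite-rank
  perturbation, and both can be handled one dimension at a time. Real eigenvalues are the obstacle
  to an exact structure: if \<open>J (J x) = c x\<close> with \<open>c \<ge> 0\<close>, the segment
  from 1 to \<open>- J^2\<close> can meet a singular operator, whereas without real eigenvectors
  \<open>J^2 - c\<close> factors into two injective maps. Once they are removed, \<open>J\<close>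
  divided by a root of \<open>- J^2\<close> is a complex structure. Types C and H never appear:
  outside type R some \<open>T\<close> has no strictly singular \<open>T - c\<close>, and that
  \<open>T\<close> starts the construction.\<close>

section \<open>Norming functionals\<close>

text \<open>Homogeneity is asked only as an upper estimate for \<open>c > 0\<close>; scaling back by
  the inverse gives equality. This keeps short the checks for functionals defined as infima.\<close>

definition sublinear :: "('a::real_normed_vector \<Rightarrow> real) \<Rightarrow> bool" where
  "sublinear p \<longleftrightarrow> p 0 = 0 \<and> (\<forall>x y. p (x + y) \<le> p x + p y) \<and> (\<forall>c>0. \<forall>x. p (c *\<^sub>R x) \<le> c * p x)"

lemma sublinear_scaleR:
  assumes "sublinear p" "c \<ge> 0"
  shows "p (c *\<^sub>R x) = c * p x"
proof (cases "c = 0")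
  case True
  then show ?thesis using assms by (simp add: sublinear_def)
next
  case False
  then have c: "c > 0" using assms by simp
  have "p (inverse c *\<^sub>R (c *\<^sub>R x)) \<le> inverse c * p (c *\<^sub>R x)"
    using assms c unfolding sublinear_def by (meson positive_imp_inverse_positive)
  then have "c * p x \<le> p (c *\<^sub>R x)" using c by (simp add: field_simps)
  moreover have "p (c *\<^sub>R x) \<le> c * p x" using assms c by (simp add: sublinear_def)
  ultimately show ?thesis by simp
qed

lemma sublinear_lower:
  assumes "sublinear p"
  shows "- p (- x) \<le> p x"
proof -
  have "p (x + - x) \<le> p x + p (- x)" using assms unfolding sublinear_def by blast
  moreover have "p (x + - x) = 0" using assms by (simp add: sublinear_def)
  ultimately show ?thesis by linarith
qed

text \<open>The witness is the infimum of \<open>p (x + t y) - t p y\<close> over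
  \<open>t \<ge> 0\<close>; the values \<open>t = 0\<close> and \<open>t = 1\<close> give the two
  bounds. It serves twice: to lower the norm in the direction \<open>- x0\<close>, and to show that
  a minimal sublinear functional is additive.\<close>

lemma sublinear_shrink:
  fixes p :: "'a::real_normed_vector \<Rightarrow> real"
  assumes p: "sublinear p"
  obtains q where "sublinear q" "\<And>x. q x \<le> p x" "\<And>x. q x \<le> p (x + y) - p y"
proof
  have sub: "\<And>x z. p (x + z) \<le> p x + p z" using p by (simp add: sublinear_def)
  define g where "g x t = p (x + t *\<^sub>R y) - t * p y" for x t
  define q where "q x = (INF t\<in>{0..}. g x t)" for x
  have lower: "- p (- x) \<le> g x t" if "t \<ge> 0" for x t
    using sub[of "- x" "x + t *\<^sub>R y"] sublinear_scaleR[OF p that, of y] by (simp add: g_def)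
  have bdd: "bdd_below (g x ` {0..})" for x
    by (rule bdd_belowI2[of _ "- p (- x)"]) (simp add: lower)
  have q_le: "q x \<le> g x t" if "t \<ge> 0" for x t
    unfolding q_def by (rule cINF_lower[OF bdd]) (use that in simp)
  have q_ge: "m \<le> q x" if "\<And>t. t \<ge> 0 \<Longrightarrow> m \<le> g x t" for m x
    unfolding q_def by (rule cINF_greatest) (use that in auto)
  show "q x \<le> p x" for x using q_le[of 0 x] by (simp add: g_def)
  show "q x \<le> p (x + y) - p y" for x using q_le[of 1 x] by (simp add: g_def)
  have "q 0 = 0"
  proof (rule antisym)
    show "q 0 \<le> 0" using q_le[of 0 0] p by (simp add: g_def sublinear_def)
    show "0 \<le> q 0" by (rule q_ge) (simp add: g_def sublinear_scaleR[OF p])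
  qed
  moreover have "q (x + z) \<le> q x + q z" for x z
  proof -
    have "q (x + z) - g x s \<le> g z t" if "s \<ge> 0" "t \<ge> 0" for s t
    proof -
      have "q (x + z) \<le> g (x + z) (s + t)" using that by (intro q_le) simp
      also have "\<dots> \<le> g x s + g z t"
        using sub[of "x + s *\<^sub>R y" "z + t *\<^sub>R y"] by (simp add: g_def algebra_simps)
      finally show ?thesis by simp
    qed
    then have "q (x + z) - g x s \<le> q z" if "s \<ge> 0" for s using that by (intro q_ge)
    then have "q (x + z) - q z \<le> g x s" if "s \<ge> 0" for s using that by (simp add: algebra_simps)
    then have "q (x + z) - q z \<le> q x" by (rule q_ge)
    then show ?thesis by simp
  qed
  moreover have "q (c *\<^sub>R x) \<le> c * q x" if "c > 0" for c x
  proof -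
    have "q (c *\<^sub>R x) / c \<le> q x"
    proof (rule q_ge)
      fix t :: real assume "t \<ge> 0"
      then have "q (c *\<^sub>R x) \<le> g (c *\<^sub>R x) (c * t)" using that by (intro q_le) simp
      also have "\<dots> = c * g x t"
        using sublinear_scaleR[OF p, of c "x + t *\<^sub>R y"] that by (simp add: g_def algebra_simps)
      finally show "q (c *\<^sub>R x) / c \<le> g x t" using that by (simp add: field_simps)
    qed
    then show ?thesis using that by (simp add: field_simps)
  qed
  ultimately show "sublinear q" by (simp add: sublinear_def)
qed

lemma minimal_sublinear_exists:
  fixes p0 :: "'a::real_normed_vector \<Rightarrow> real"
  assumes p0: "sublinear p0"
  obtains p where "sublinear p" "p \<le> p0" "\<And>q. sublinear q \<Longrightarrow> q \<le> p \<Longrightarrow> q = p"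
proof -
  define A where "A = {p :: 'a \<Rightarrow> real. sublinear p \<and> p \<le> p0}"
  have "\<exists>m\<in>A. \<forall>a\<in>A. a \<le> m \<longrightarrow> a = m"
  proof (rule predicate_Zorn)
    show "partial_order_on A (relation_of (\<lambda>x y. y \<le> x) A)"
      by (rule partial_order_on_relation_ofI) auto
    fix C assume "C \<in> Chains (relation_of (\<lambda>x y. y \<le> x) A)"
    then have C: "\<And>p. p \<in> C \<Longrightarrow> sublinear p \<and> p \<le> p0"
      and chain: "\<And>p q. p \<in> C \<Longrightarrow> q \<in> C \<Longrightarrow> p \<le> q \<or> q \<le> p"
      unfolding Chains_def relation_of_def A_def by auto
    show "\<exists>u\<in>A. \<forall>a\<in>C. u \<le> a"
    proof (cases "C = {}")
      case True
      then show ?thesis using p0 by (auto simp: A_def)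
    next
      case False
      define u where "u x = (INF p\<in>C. p x)" for x
      have lower: "- p0 (- x) \<le> p x" if "p \<in> C" for p x
        using sublinear_lower[of p x] C[OF that] le_funD[of p p0 "- x"] by force
      have bdd: "bdd_below ((\<lambda>p. p x) ` C)" for x
        by (rule bdd_belowI2[of _ "- p0 (- x)"]) (rule lower)
      have u_le: "u x \<le> p x" if "p \<in> C" for p x
        unfolding u_def by (rule cINF_lower[OF bdd that])
      have u_ge: "m \<le> u x" if "\<And>p. p \<in> C \<Longrightarrow> m \<le> p x" for m x
        unfolding u_def by (rule cINF_greatest[OF False that])
      obtain p1 where p1: "p1 \<in> C" using False by blast
      have "u 0 = 0"
      proof (rule antisym)
        show "u 0 \<le> 0" using u_le[OF p1, of 0] C[OF p1] by (simp add: sublinear_def)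
        show "0 \<le> u 0" by (rule u_ge) (metis C sublinear_def order_refl)
      qed
      moreover have "u (x + z) \<le> u x + u z" for x z
      proof -
        have "u (x + z) - p x \<le> q z" if pq: "p \<in> C" "q \<in> C" for p q
        proof -
          \<comment> \<open>Two members of the chain are replaced by the smaller one, so that
            subadditivity of a single functional applies.\<close>
          obtain r where r: "r \<in> C" "r \<le> p" "r \<le> q" using chain[OF pq] pq by auto
          have "u (x + z) \<le> r (x + z)" by (rule u_le[OF r(1)])
          also have "\<dots> \<le> r x + r z" using C[OF r(1)] by (simp add: sublinear_def)
          also have "\<dots> \<le> p x + q z" using r by (intro add_mono) (auto dest: le_funD)
          finally show ?thesis by simp
        qed
        then have "u (x + z) - p x \<le> u z" if "p \<in> C" for p using that by (intro u_ge)
        then have "u (x + z) - u z \<le> p x" if "p \<in> C" for p using that by (simp add: algebra_simps)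
        then have "u (x + z) - u z \<le> u x" by (rule u_ge)
        then show ?thesis by simp
      qed
      moreover have "u (c *\<^sub>R x) \<le> c * u x" if "c > 0" for c x
      proof -
        have "u (c *\<^sub>R x) / c \<le> u x"
        proof (rule u_ge)
          fix p assume p: "p \<in> C"
          then have "u (c *\<^sub>R x) \<le> p (c *\<^sub>R x)" by (rule u_le)
          also have "\<dots> \<le> c * p x" using C[OF p] that by (simp add: sublinear_def)
          finally show "u (c *\<^sub>R x) / c \<le> p x" using that by (simp add: field_simps)
        qed
        then show ?thesis using that by (simp add: field_simps)
      qed
      ultimately have "sublinear u" by (simp add: sublinear_def)
      moreover have "u \<le> p0" using u_le[OF p1] C[OF p1] by (auto simp: le_fun_def intro: order_trans)
      ultimately show ?thesis using u_le by (auto simp: A_def le_fun_def)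
    qed
  qed
  then obtain m where "m \<in> A" "\<And>a. a \<in> A \<Longrightarrow> a \<le> m \<Longrightarrow> a = m" by blast
  then show thesis using that[of m] by (auto simp: A_def intro: order_trans)
qed

text \<open>A minimal sublinear functional below the norm is linear, which makes Zorn's lemma do the
  work of an extension argument. Starting from the norm shrunk along \<open>x0\<close> forces the
  value at \<open>x0\<close>.\<close>

theorem norming_functional:
  fixes x0 :: "'a::real_normed_vector"
  obtains f :: "'a \<Rightarrow>\<^sub>L real" where "norm f \<le> 1" "f x0 = norm x0"
proof -
  have "sublinear (norm :: 'a \<Rightarrow> real)"
    by (simp add: sublinear_def norm_triangle_ineq)
  then obtain p0 :: "'a \<Rightarrow> real" where p0: "sublinear p0" "\<And>x. p0 x \<le> norm x"
    "\<And>x. p0 x \<le> norm (x + x0) - norm x0"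
    using sublinear_shrink by blast
  obtain p where p: "sublinear p" "p \<le> p0" and min: "\<And>q. sublinear q \<Longrightarrow> q \<le> p \<Longrightarrow> q = p"
    using minimal_sublinear_exists[OF p0(1)] by blast
  \<comment> \<open>Shrinking \<open>p\<close> along \<open>y\<close> cannot change it by
    minimality, so the second bound of the shrunken functional becomes superadditivity of
    \<open>p\<close>.\<close>
  have super: "p x + p y \<le> p (x + y)" for x y
  proof -
    obtain q where q: "sublinear q" "\<And>x. q x \<le> p x" "\<And>x. q x \<le> p (x + y) - p y"
      using sublinear_shrink[OF p(1)] by blast
    have "q = p" using min[OF q(1)] q(2) by (simp add: le_fun_def)
    then show ?thesis using q(3)[of x] by simp
  qed
  have add: "p (x + y) = p x + p y" for x y
    using super[of x y] p(1) by (auto simp: sublinear_def intro: antisym)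
  have minus: "p (- x) = - p x" for x
    using add[of x "- x"] p(1) by (simp add: sublinear_def)
  have scale: "p (c *\<^sub>R x) = c * p x" for c x
  proof (cases "c \<ge> 0")
    case True
    then show ?thesis using sublinear_scaleR[OF p(1)] by simp
  next
    case False
    then have "p ((- c) *\<^sub>R x) = - c * p x" using sublinear_scaleR[OF p(1), of "- c"] by simp
    then show ?thesis using minus[of "c *\<^sub>R x"] by simp
  qed
  have le: "p x \<le> norm x" for x using p0(2)[of x] le_funD[OF p(2), of x] by linarith
  have abs: "\<bar>p x\<bar> \<le> norm x" for x using le[of x] le[of "- x"] by (simp add: minus abs_le_iff)
  have lin: "bounded_linear p"
    by (rule bounded_linear_intro[where K = 1]) (use add scale abs in auto)
  \<comment> \<open>The bound \<open>norm (x + x0) - norm x0\<close> at \<open>x = - x0\<close>;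
    linearity then gives the lower estimate at \<open>x0\<close>.\<close>
  have "p (- x0) \<le> - norm x0" using p0(3)[of "- x0"] le_funD[OF p(2), of "- x0"] by simp
  then have "p x0 = norm x0" using le[of x0] minus[of x0] by simp
  moreover have "norm (Blinfun p) \<le> 1"
    by (rule norm_blinfun_bound) (use lin abs in \<open>auto simp: bounded_linear_Blinfun_apply\<close>)
  ultimately show thesis using that[of "Blinfun p"] lin by (simp add: bounded_linear_Blinfun_apply)
qed

section \<open>Upper semi-Fredholm operators\<close>

lemma subspace_closure:
  fixes S :: "'a::real_normed_vector set"
  assumes S: "subspace S"
  shows "subspace (closure S)"
  unfolding subspace_def
proof (intro conjI ballI allI)
  show "0 \<in> closure S" using subspace_0[OF S] closure_subset by blast
next
  fix x y assume "x \<in> closure S" "y \<in> closure S"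
  then obtain a b where "\<And>n. a n \<in> S" "a \<longlonglongrightarrow> x" "\<And>n. b n \<in> S" "b \<longlonglongrightarrow> y"
    unfolding closure_sequential by blast
  then show "x + y \<in> closure S"
    unfolding closure_sequential using subspace_add[OF S]
    by (intro exI[of _ "\<lambda>n. a n + b n"]) (auto intro: tendsto_add)
next
  fix c :: real and x assume "x \<in> closure S"
  then obtain a where "\<And>n. a n \<in> S" "a \<longlonglongrightarrow> x"
    unfolding closure_sequential by blast
  then show "c *\<^sub>R x \<in> closure S"
    unfolding closure_sequential using subspace_scale[OF S]
    by (intro exI[of _ "\<lambda>n. c *\<^sub>R a n"]) (auto intro: tendsto_scaleR)
qed

text \<open>For finite sets these are the closed subspaces of finite codimension. Keeping the
  functionals as data allows induction by adding or dropping one of them.\<close>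

definition annihilator :: "('a::real_normed_vector \<Rightarrow>\<^sub>L real) set \<Rightarrow> 'a set" where
  "annihilator \<Phi> = {x. \<forall>f\<in>\<Phi>. blinfun_apply f x = 0}"

lemma annihilator_empty [simp]: "annihilator {} = UNIV"
  by (simp add: annihilator_def)

lemma annihilator_insert: "annihilator (insert f \<Phi>) = {x \<in> annihilator \<Phi>. blinfun_apply f x = 0}"
  by (auto simp: annihilator_def)

lemma annihilator_Un: "annihilator (\<Phi> \<union> \<Psi>) = annihilator \<Phi> \<inter> annihilator \<Psi>"
  by (auto simp: annihilator_def)

lemma subspace_annihilator [simp]: "subspace (annihilator \<Phi>)"
  by (auto simp: subspace_def annihilator_def blinfun.bilinear_simps)

lemma closed_annihilator [simp]: "closed (annihilator \<Phi>)"
proof -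
  have "annihilator \<Phi> = (\<Inter>f\<in>\<Phi>. blinfun_apply f -` {0})"
    by (auto simp: annihilator_def)
  moreover have "closed (blinfun_apply f -` {0})" for f :: "'a \<Rightarrow>\<^sub>L real"
    by (rule continuous_closed_vimage) (auto intro: continuous_intros)
  ultimately show ?thesis by auto
qed

lemma infinite_dimensional_annihilator:
  assumes "infinite_dimensional (UNIV :: 'a::real_normed_vector set)" "finite \<Phi>"
  shows "infinite_dimensional (annihilator \<Phi> :: 'a set)"
  using assms(2)
proof (induction \<Phi> rule: finite_induct)
  case empty
  then show ?case using assms(1) by simp
next
  case (insert f \<Phi>)
  show ?case
  proof (cases "\<forall>x\<in>annihilator \<Phi>. blinfun_apply f x = 0")
    case True
    then have "annihilator (insert f \<Phi>) = annihilator \<Phi>" by (auto simp: annihilator_insert)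
    then show ?thesis using insert.IH by simp
  next
    case False
    then obtain g where g: "g \<in> annihilator \<Phi>" "blinfun_apply f g \<noteq> 0" by blast
    show ?thesis unfolding infinite_dimensional_def
    proof safe
      fix B assume B: "finite B" "span B = annihilator (insert f \<Phi>)"
      have "span (insert g B) = annihilator \<Phi>"
      proof (rule antisym)
        have "B \<subseteq> annihilator \<Phi>" using B(2) span_superset[of B] by (auto simp: annihilator_insert)
        then show "span (insert g B) \<subseteq> annihilator \<Phi>" using g by (intro span_minimal) auto
        show "annihilator \<Phi> \<subseteq> span (insert g B)"
        proof
          fix x assume x: "x \<in> annihilator \<Phi>"
          let ?k = "blinfun_apply f x / blinfun_apply f g"
          have "x - ?k *\<^sub>R g \<in> span B" using x g
            by (simp add: B(2) annihilator_insert subspace_diff subspace_scale blinfun.bilinear_simps)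
          then show "x \<in> span (insert g B)" by (auto simp: span_breakdown_eq)
        qed
      qed
      then show False using insert.IH B(1) unfolding infinite_dimensional_def by blast
    qed
  qed
qed

lemma infinite_dimensional_not_subset_span:
  assumes "infinite_dimensional Y" "subspace Y" "finite B"
  shows "\<not> Y \<subseteq> span B"
proof
  assume sub: "Y \<subseteq> span B"
  obtain C where C: "C \<subseteq> Y" "independent C" "Y \<subseteq> span C"
    using maximal_independent_subset by blast
  then have "finite C" using independent_span_bound[OF assms(3), of C] sub by blast
  moreover have "span C = Y" using C assms(2) by (simp add: antisym span_minimal)
  ultimately show False using assms(1) unfolding infinite_dimensional_def by blast
qed

lemma infinite_dimensionalI:
  assumes "infinite C" "independent C" "C \<subseteq> Y"
  shows "infinite_dimensional Y"
  unfolding infinite_dimensional_def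
  using assms independent_span_bound by blast

definition bounded_below_on :: "('a::real_normed_vector \<Rightarrow>\<^sub>L 'b::real_normed_vector) \<Rightarrow> 'a set \<Rightarrow> bool" where
  "bounded_below_on T Y \<longleftrightarrow> (\<exists>c>0. \<forall>y\<in>Y. c * norm y \<le> norm (blinfun_apply T y))"

text \<open>Between Banach spaces this amounts to closed range and finite-dimensional kernel. The
  form chosen is stable under finite-rank perturbation at once, and its negation supplies small
  images of unit vectors in every subspace of finite codimension.\<close>

definition upper_semi_fredholm :: "('a::real_normed_vector \<Rightarrow>\<^sub>L 'b::real_normed_vector) \<Rightarrow> bool" where
  "upper_semi_fredholm T \<longleftrightarrow> (\<exists>\<Phi>. finite \<Phi> \<and> bounded_below_on T (annihilator \<Phi>))"

section \<open>Subspaces on which an operator is small\<close>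

lemma not_upper_semi_fredholm_small_vector:
  fixes T :: "'a::real_normed_vector \<Rightarrow>\<^sub>L 'b::real_normed_vector"
  assumes "\<not> upper_semi_fredholm T" "finite \<Phi>" "\<epsilon> > 0"
  obtains x where "x \<in> annihilator \<Phi>" "norm x = 1" "norm (blinfun_apply T x) < \<epsilon>"
proof -
  have "\<not> bounded_below_on T (annihilator \<Phi>)"
    using assms unfolding upper_semi_fredholm_def by blast
  then obtain y where y: "y \<in> annihilator \<Phi>" "norm (blinfun_apply T y) < \<epsilon> * norm y"
    using assms(3) unfolding bounded_below_on_def by (meson not_le)
  then have pos: "norm y > 0"
    using norm_ge_zero[of "blinfun_apply T y"] by (cases "y = 0") auto
  show thesis
  proof (rule that)
    show "y /\<^sub>R norm y \<in> annihilator \<Phi>" by (rule subspace_scale[OF subspace_annihilator y(1)])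
    show "norm (y /\<^sub>R norm y) = 1" using pos by simp
    have "norm (blinfun_apply T (y /\<^sub>R norm y)) = norm (blinfun_apply T y) / norm y"
      by (simp add: blinfun.scaleR_right divide_inverse mult.commute)
    then show "norm (blinfun_apply T (y /\<^sub>R norm y)) < \<epsilon>"
      using y(2) pos by (simp add: pos_divide_less_eq)
  qed
qed

text \<open>Applying \<open>f i\<close> to the sum without its terms before \<open>i\<close> leaves
  exactly \<open>a i\<close>. So each coefficient is at most the norm of the sum plus all earlier
  coefficients, and the bound doubles at each index. Such exponential control replaces a basic
  sequence.\<close>

lemma triangular_system_bounds:
  fixes x :: "nat \<Rightarrow> 'a::real_normed_vector" and f :: "nat \<Rightarrow> 'a \<Rightarrow>\<^sub>L real"
  assumes nf: "\<And>n. norm (f n) \<le> 1" and nx: "\<And>n. norm (x n) = 1"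
    and diag: "\<And>n. blinfun_apply (f n) (x n) = 1"
    and upper: "\<And>i j. i < j \<Longrightarrow> blinfun_apply (f i) (x j) = 0"
    and "i < n"
  shows "\<bar>a i\<bar> \<le> 2 ^ i * norm (\<Sum>j<n. a j *\<^sub>R x j)"
  using \<open>i < n\<close>
proof (induction i rule: less_induct)
  case (less i)
  let ?z = "\<Sum>j<n. a j *\<^sub>R x j"
  have split: "?z = (\<Sum>j<i. a j *\<^sub>R x j) + (\<Sum>j=i..<n. a j *\<^sub>R x j)"
    using less.prems sum.atLeastLessThan_concat[of 0 i n "\<lambda>j. a j *\<^sub>R x j"]
    by (simp add: atLeast0LessThan)
  have "blinfun_apply (f i) (\<Sum>j=i..<n. a j *\<^sub>R x j) = (\<Sum>j=i..<n. if j = i then a i else 0)"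
    unfolding blinfun.sum_right
    by (rule sum.cong) (auto simp: blinfun.bilinear_simps diag upper)
  also have "\<dots> = a i" using less.prems by simp
  finally have ai: "a i = blinfun_apply (f i) (?z - (\<Sum>j<i. a j *\<^sub>R x j))"
    by (simp add: split)
  have geom: "(\<Sum>j<i. (2::real) ^ j) = 2 ^ i - 1"
    by (simp add: geometric_sum)
  have "\<bar>a i\<bar> \<le> norm (f i) * norm (?z - (\<Sum>j<i. a j *\<^sub>R x j))"
    using norm_blinfun[of "f i"] ai by (metis real_norm_def)
  also have "\<dots> \<le> 1 * norm (?z - (\<Sum>j<i. a j *\<^sub>R x j))"
    by (rule mult_right_mono) (use nf in auto)
  also have "\<dots> \<le> norm ?z + norm (\<Sum>j<i. a j *\<^sub>R x j)"
    using norm_triangle_ineq4 by simp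
  also have "norm (\<Sum>j<i. a j *\<^sub>R x j) \<le> (\<Sum>j<i. norm (a j *\<^sub>R x j))"
    by (rule norm_sum)
  also have "(\<Sum>j<i. norm (a j *\<^sub>R x j)) \<le> (\<Sum>j<i. 2 ^ j * norm ?z)"
    by (rule sum_mono) (use less in \<open>simp add: nx\<close>)
  also have "\<dots> = (2 ^ i - 1) * norm ?z" by (simp add: geom flip: sum_distrib_right)
  finally show ?case by (simp add: algebra_simps)
qed

lemma span_range_nat:
  fixes x :: "nat \<Rightarrow> 'a::real_vector"
  assumes "z \<in> span (range x)"
  obtains n a where "z = (\<Sum>j<n. a j *\<^sub>R x j)"
proof -
  have "\<exists>n a. z = (\<Sum>j<n. a j *\<^sub>R x j)" using assms
  proof (induction rule: span_induct_alt)
    case base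
    show ?case by (rule exI[of _ 0]) simp
  next
    case (step c u y)
    then obtain i n a where u: "u = x i" and y: "y = (\<Sum>j<n. a j *\<^sub>R x j)" by blast
    define m where "m = max n (Suc i)"
    define b where "b j = (if j < n then a j else 0) + (if j = i then c else 0)" for j
    have "(\<Sum>j<m. b j *\<^sub>R x j) = (\<Sum>j<m. (if j < n then a j *\<^sub>R x j else 0)) + (\<Sum>j<m. if j = i then c *\<^sub>R x i else 0)"
      unfolding sum.distrib[symmetric] b_def by (rule sum.cong) (auto simp: algebra_simps)
    also have "(\<Sum>j<m. (if j < n then a j *\<^sub>R x j else 0)) = y"
      unfolding y by (rule sum.mono_neutral_cong_right) (auto simp: m_def)
    also have "(\<Sum>j<m. if j = i then c *\<^sub>R x i else 0) = c *\<^sub>R u"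
      using sum.delta[of "{..<m}" i "\<lambda>_. c *\<^sub>R x i"] by (simp add: u m_def less_max_iff_disj)
    finally show ?case by (metis add.commute)
  qed
  then show thesis using that by blast
qed

text \<open>Unit vectors are chosen successively in the kernels of the functionals norming the
  earlier ones. Coefficients may grow like \<open>2 ^ n\<close>, so images of size
  \<open>\<epsilon> / 4 ^ Suc n\<close> suffice for \<open>T\<close> to be small on the whole closed
  span.\<close>

proposition not_upper_semi_fredholm_small_subspace:
  fixes T :: "'a::banach \<Rightarrow>\<^sub>L 'b::real_normed_vector"
  assumes T: "\<not> upper_semi_fredholm T" and fin: "finite \<Phi>" and \<epsilon>: "\<epsilon> > 0"
  obtains Z where "banach_subspace Z" "Z \<subseteq> annihilator \<Phi>"
    "\<And>z. z \<in> Z \<Longrightarrow> norm (blinfun_apply T z) \<le> \<epsilon> * norm z"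
proof -
  \<comment> \<open>A state holds the functionals collected so far, the new norming functional and
    the new vector; \<open>Q\<close> passes the new functional on to the next state.\<close>
  define P where "P n s \<longleftrightarrow> (case s of (\<Psi>, f, x) \<Rightarrow> finite \<Psi> \<and> \<Phi> \<subseteq> \<Psi> \<and> x \<in> annihilator \<Psi> \<and>
      norm x = 1 \<and> norm (blinfun_apply T x) < \<epsilon> / 4 ^ Suc n \<and> norm f \<le> 1 \<and> blinfun_apply f x = 1)"
    for n and s :: "('a \<Rightarrow>\<^sub>L real) set \<times> ('a \<Rightarrow>\<^sub>L real) \<times> 'a"
  define Q where "Q n s s' \<longleftrightarrow> fst s' = insert (fst (snd s)) (fst s)"
    for n :: nat and s s' :: "('a \<Rightarrow>\<^sub>L real) set \<times> ('a \<Rightarrow>\<^sub>L real) \<times> 'a"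
  have ex: "\<exists>f x. P n (\<Psi>, f, x)" if \<Psi>: "finite \<Psi>" "\<Phi> \<subseteq> \<Psi>" for n \<Psi>
  proof -
    obtain x where "x \<in> annihilator \<Psi>" "norm x = 1" "norm (blinfun_apply T x) < \<epsilon> / 4 ^ Suc n"
      using not_upper_semi_fredholm_small_vector[OF T \<Psi>(1), of "\<epsilon> / 4 ^ Suc n"] \<epsilon> by auto
    moreover obtain f :: "'a \<Rightarrow>\<^sub>L real" where "norm f \<le> 1" "blinfun_apply f x = norm x"
      using norming_functional .
    ultimately show ?thesis using \<Psi> unfolding P_def by auto
  qed
  have "\<exists>s. \<forall>n. P n (s n) \<and> Q n (s n) (s (Suc n))"
  proof (rule dependent_nat_choice)
    show "\<exists>s. P 0 s" using ex[OF fin order_refl] by blast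
    fix s n assume "P n s"
    then have "finite (insert (fst (snd s)) (fst s))" "\<Phi> \<subseteq> insert (fst (snd s)) (fst s)"
      by (auto simp: P_def)
    from ex[OF this] show "\<exists>s'. P (Suc n) s' \<and> Q n s s'" unfolding Q_def by force
  qed
  then obtain s where s: "\<And>n. P n (s n)" "\<And>n. Q n (s n) (s (Suc n))" by blast
  define \<Psi> where "\<Psi> n = fst (s n)" for n
  define f where "f n = fst (snd (s n))" for n
  define x where "x n = snd (snd (s n))" for n
  have \<Psi>_Suc: "\<Psi> (Suc n) = insert (f n) (\<Psi> n)" for n
    using s(2) by (simp add: Q_def \<Psi>_def f_def)
  have props: "finite (\<Psi> n) \<and> \<Phi> \<subseteq> \<Psi> n \<and> x n \<in> annihilator (\<Psi> n) \<and> norm (x n) = 1 \<and>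
      norm (blinfun_apply T (x n)) < \<epsilon> / 4 ^ Suc n \<and> norm (f n) \<le> 1 \<and> blinfun_apply (f n) (x n) = 1" for n
    using s(1)[of n] by (simp add: P_def \<Psi>_def f_def x_def split: prod.splits)
  have mono: "i \<le> j \<Longrightarrow> \<Psi> i \<subseteq> \<Psi> j" for i j
    by (rule lift_Suc_mono_le[of \<Psi>]) (auto simp: \<Psi>_Suc)
  have upper: "blinfun_apply (f i) (x j) = 0" if "i < j" for i j
  proof -
    have "f i \<in> \<Psi> j" using mono[of "Suc i" j] that by (auto simp: \<Psi>_Suc)
    then show ?thesis using props[of j] by (auto simp: annihilator_def)
  qed
  note bound = triangular_system_bounds[of f x, OF _ _ _ upper]
  have small: "norm (blinfun_apply T z) \<le> \<epsilon> * norm z" if "z \<in> span (range x)" for z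
  proof -
    obtain n a where z: "z = (\<Sum>j<n. a j *\<^sub>R x j)" by (rule span_range_nat[OF \<open>z \<in> span (range x)\<close>])
    have a: "\<bar>a i\<bar> \<le> 2 ^ i * norm z" if "i < n" for i
      unfolding z by (rule bound) (use props that in auto)
    have "norm (blinfun_apply T z) \<le> (\<Sum>j<n. norm (a j *\<^sub>R blinfun_apply T (x j)))"
      unfolding z blinfun.sum_right blinfun.scaleR_right by (rule norm_sum)
    also have "\<dots> \<le> (\<Sum>j<n. (2 ^ j * norm z) * (\<epsilon> / 4 ^ Suc j))"
      unfolding norm_scaleR
      by (intro sum_mono mult_mono) (use a props in \<open>auto intro: less_imp_le\<close>)
    \<comment> \<open>The growth \<open>2 ^ j\<close> against the decay \<open>4 ^ Suc j\<close>
      leaves a geometric series of sum at most 2, hence half of the bound that is claimed.\<close>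
    also have "\<dots> = \<epsilon> * norm z / 4 * (\<Sum>j<n. (1/2) ^ j)"
      unfolding sum_distrib_left
    proof (rule sum.cong)
      fix j
      have "(4::real) ^ j = 2 ^ j * 2 ^ j" by (simp flip: power_mult_distrib)
      then show "2 ^ j * norm z * (\<epsilon> / 4 ^ Suc j) = \<epsilon> * norm z / 4 * (1/2) ^ j"
        by (simp add: field_simps power_divide)
    qed simp
    also have "\<dots> \<le> \<epsilon> * norm z / 4 * 2"
    proof (rule mult_left_mono)
      show "(\<Sum>j<n. (1/2::real) ^ j) \<le> 2" using geometric_sum[of "1/2::real" n] by simp
    qed (use \<epsilon> in simp)
    finally show ?thesis
      using mult_nonneg_nonneg[OF less_imp_le[OF \<epsilon>] norm_ge_zero[of z]] by linarith
  qed
  define Z where "Z = closure (span (range x))"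
  have "closed {z. norm (blinfun_apply T z) \<le> \<epsilon> * norm z}"
    by (intro closed_Collect_le continuous_intros)
  then have Z_small: "Z \<subseteq> {z. norm (blinfun_apply T z) \<le> \<epsilon> * norm z}"
    unfolding Z_def using small by (intro closure_minimal) auto
  have "range x \<subseteq> annihilator \<Phi>" using props by (auto simp: annihilator_def)
  then have Z_ann: "Z \<subseteq> annihilator \<Phi>"
    unfolding Z_def by (intro closure_minimal span_minimal) auto
  have "infinite_dimensional Z"
    unfolding infinite_dimensional_def
  proof (rule notI, elim exE conjE)
    fix B assume B: "finite B" "span B = Z"
    \<comment> \<open>The triangular system makes the vectors distinct and independent, so no finite
      set can span the closure.\<close>
    have inj: "inj x"
    proof (rule injI)
      fix i j assume "x i = x j"
      then show "i = j" using upper[of i j] upper[of j i] props[of i] props[of j]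
        by (metis nat_neq_iff zero_neq_one)
    qed
    have "independent (range x)"
    proof -
      have "a i = 0" if "(\<Sum>j<n. a j *\<^sub>R x j) = 0" "i < n" for n i a
        using bound[of i n a] that props by simp
      note zero = this
      show ?thesis
        unfolding dependent_finite independent_explicit_module
      proof (intro allI impI)
        fix t u v assume t: "finite t" "t \<subseteq> range x" and sum0: "(\<Sum>v\<in>t. u v *\<^sub>R v) = 0" and v: "v \<in> t"
        obtain i where i: "v = x i" using v t by blast
        have "finite (x -` t)" using t(1) inj by (simp add: finite_vimageI)
        then obtain n where n: "x -` t \<subseteq> {..<n}" by (meson finite_nat_iff_bounded)
        define a where "a j = (if x j \<in> t then u (x j) else 0)" for j
        have "(\<Sum>j<n. a j *\<^sub>R x j) = (\<Sum>j\<in>x -` t. u (x j) *\<^sub>R x j)"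
          by (rule sum.mono_neutral_cong_right) (use n in \<open>auto simp: a_def\<close>)
        also have "\<dots> = (\<Sum>v\<in>t. u v *\<^sub>R v)"
          using inj t(2) by (intro sum.reindex_cong[of x, symmetric]) (auto simp: inj_on_def)
        finally have "(\<Sum>j<n. a j *\<^sub>R x j) = 0" using sum0 by simp
        moreover have "i < n" using n v i by auto
        ultimately have "a i = 0" by (rule zero)
        then show "u v = 0" using v i by (simp add: a_def)
      qed
    qed
    moreover have "range x \<subseteq> span B"
      unfolding B(2) Z_def by (rule order_trans[OF span_superset closure_subset])
    ultimately have "finite (range x)" using independent_span_bound[OF B(1)] by blast
    then show False using inj finite_imageD by blast
  qed
  then have "banach_subspace Z"
    unfolding banach_subspace_def Z_def by (simp add: subspace_closure)
  then show thesis using that Z_ann Z_small by blast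
qed

section \<open>Strict singularity and the dichotomy on HI spaces\<close>

lemma bounded_below_on_imp_inj_on:
  assumes "bounded_below_on T Y" "subspace Y"
  shows "inj_on (blinfun_apply T) Y"
proof (rule inj_onI)
  fix x y assume xy: "x \<in> Y" "y \<in> Y" "blinfun_apply T x = blinfun_apply T y"
  obtain c where c: "c > 0" "\<And>z. z \<in> Y \<Longrightarrow> c * norm z \<le> norm (blinfun_apply T z)"
    using assms(1) unfolding bounded_below_on_def by blast
  have "c * norm (x - y) \<le> norm (blinfun_apply T (x - y))"
    by (rule c(2)[OF subspace_diff[OF assms(2) xy(1,2)]])
  then have "c * norm (x - y) \<le> 0" using xy(3) by (simp add: blinfun.diff_right)
  then show "x = y" using c(1) by (simp add: mult_le_0_iff)
qed

lemma closed_image_bounded_below: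
  fixes T :: "'a::banach \<Rightarrow>\<^sub>L 'b::banach"
  assumes "bounded_below_on T Y" "subspace Y" "closed Y"
  shows "closed (blinfun_apply T ` Y)"
proof -
  obtain c where c: "c > 0" "\<forall>y\<in>Y. norm (blinfun_apply T y) \<ge> c * norm y"
    using assms(1) unfolding bounded_below_on_def by blast
  have "complete (blinfun_apply T ` Y)"
    by (rule complete_isometric_image[OF c(1) assms(2) blinfun.bounded_linear_right c(2)])
      (simp add: complete_eq_closed assms(3))
  then show ?thesis by (simp add: complete_eq_closed)
qed

lemma banach_subspace_image_bounded_below:
  fixes T :: "'a::banach \<Rightarrow>\<^sub>L 'b::banach"
  assumes T: "bounded_below_on T Y" and Y: "banach_subspace Y"
  shows "banach_subspace (blinfun_apply T ` Y)"
proof -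
  have sub: "subspace Y" "closed Y" and inf: "infinite_dimensional Y"
    using Y by (auto simp: banach_subspace_def)
  have lin: "linear (blinfun_apply T)"
    using blinfun.bounded_linear_right bounded_linear.linear by blast
  obtain C where C: "C \<subseteq> Y" "independent C" "Y \<subseteq> span C"
    using maximal_independent_subset by blast
  have spanC: "span C = Y" using C sub(1) by (simp add: antisym span_minimal)
  then have infC: "infinite C" using inf unfolding infinite_dimensional_def by blast
  have inj: "inj_on (blinfun_apply T) Y" by (rule bounded_below_on_imp_inj_on[OF T sub(1)])
  then have "infinite (blinfun_apply T ` C)"
    using infC C(1) finite_imageD inj_on_subset by blast
  moreover have "independent (blinfun_apply T ` C)"
    using linear_independent_injective_image[OF lin C(2)] inj spanC by simp
  ultimately have "infinite_dimensional (blinfun_apply T ` Y)"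
    by (rule infinite_dimensionalI) (use C(1) in blast)
  then show ?thesis
    unfolding banach_subspace_def
    using linear_subspace_image[OF lin sub(1)] closed_image_bounded_below[OF T sub] by blast
qed

text \<open>Continuity of the inverse at 0 gives a lower bound on small vectors, and linearity
  spreads it by scaling. Conversely a lower bound makes the image complete and the inverse
  Lipschitz.\<close>

lemma strictly_singular_iff:
  "strictly_singular T \<longleftrightarrow> \<not> (\<exists>Y. banach_subspace Y \<and> bounded_below_on T Y)"
proof -
  have "bounded_below_on T Y" if Y: "banach_subspace Y" and hom: "homeomorphism Y Z (blinfun_apply T) g" for Y Z g
  proof -
    have sub: "subspace Y" using Y by (simp add: banach_subspace_def)
    then have 0: "0 \<in> Y" by (rule subspace_0)
    have gT: "\<And>y. y \<in> Y \<Longrightarrow> g (blinfun_apply T y) = y" and im: "blinfun_apply T ` Y = Z"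
      and cont: "continuous_on Z g"
      using hom by (auto simp: homeomorphism_def)
    have "blinfun_apply T 0 = 0" by simp
    then have 0: "0 \<in> Z" "g 0 = 0" using 0 im gT by (metis imageI)+
    obtain \<delta> where \<delta>: "\<delta> > 0" "\<And>z. z \<in> Z \<Longrightarrow> norm z < \<delta> \<Longrightarrow> norm (g z) < 1"
      using cont 0 unfolding continuous_on_iff by (metis dist_0_norm dist_commute zero_less_one)
    have "\<delta> / 2 * norm y \<le> norm (blinfun_apply T y)" if y: "y \<in> Y" for y
    proof (rule ccontr)
      assume *: "\<not> \<delta> / 2 * norm y \<le> norm (blinfun_apply T y)"
      then have pos: "norm y > 0" using \<delta>(1) by (cases "y = 0") auto
      define u where "u = y /\<^sub>R norm y"
      have uY: "u \<in> Y" unfolding u_def by (rule subspace_scale[OF sub y])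
      have "norm (blinfun_apply T u) = norm (blinfun_apply T y) / norm y"
        by (simp add: u_def blinfun.scaleR_right divide_inverse mult.commute)
      also have "\<dots> < \<delta>"
      proof -
        have "norm (blinfun_apply T y) < \<delta> * norm y"
          using * mult_pos_pos[OF \<delta>(1) pos] by linarith
        then show ?thesis by (simp add: pos_divide_less_eq[OF pos])
      qed
      finally have "norm (g (blinfun_apply T u)) < 1" using \<delta>(2) im uY by blast
      then show False using gT[OF uY] pos by (simp add: u_def)
    qed
    then show ?thesis unfolding bounded_below_on_def using \<delta>(1) half_gt_zero by blast
  qed
  moreover have "\<exists>Z g. banach_subspace Z \<and> homeomorphism Y Z (blinfun_apply T) g"
    if Y: "banach_subspace Y" and T: "bounded_below_on T Y" for Y
  proof (intro exI conjI)
    have sub: "subspace Y" using Y by (simp add: banach_subspace_def)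
    have inj: "inj_on (blinfun_apply T) Y" by (rule bounded_below_on_imp_inj_on[OF T sub])
    obtain c where c: "c > 0" "\<And>z. z \<in> Y \<Longrightarrow> c * norm z \<le> norm (blinfun_apply T z)"
      using T unfolding bounded_below_on_def by blast
    show "banach_subspace (blinfun_apply T ` Y)"
      by (rule banach_subspace_image_bounded_below[OF T Y])
    let ?g = "inv_into Y (blinfun_apply T)"
    have "continuous_on (blinfun_apply T ` Y) ?g"
      unfolding continuous_on_iff
    proof (intro ballI allI impI)
      fix z e :: real and x assume x: "x \<in> blinfun_apply T ` Y" and e: "e > 0"
      show "\<exists>d>0. \<forall>x'\<in>blinfun_apply T ` Y. dist x' x < d \<longrightarrow> dist (?g x') (?g x) < e"
      proof (intro exI[of _ "c * e"] conjI ballI impI)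
        fix x' assume x': "x' \<in> blinfun_apply T ` Y" and d: "dist x' x < c * e"
        obtain a b where ab: "a \<in> Y" "b \<in> Y" "x = blinfun_apply T a" "x' = blinfun_apply T b"
          using x x' by blast
        have "c * norm (b - a) \<le> norm (blinfun_apply T (b - a))"
          by (rule c(2)[OF subspace_diff[OF sub ab(2,1)]])
        then have "c * norm (b - a) < c * e" using d ab by (simp add: blinfun.diff_right dist_norm)
        then show "dist (?g x') (?g x) < e"
          using c(1) ab inj by (simp add: inv_into_f_f dist_norm)
      qed (use c e in simp)
    qed
    then show "homeomorphism Y (blinfun_apply T ` Y) (blinfun_apply T) ?g"
      unfolding homeomorphism_def using inj
      by (auto simp: inv_into_f_f intro!: continuous_intros)
  qed
  ultimately show ?thesis unfolding strictly_singular_def by blast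
qed

lemma upper_semi_fredholm_not_strictly_singular:
  fixes T :: "'a::banach \<Rightarrow>\<^sub>L 'a"
  assumes "infinite_dimensional (UNIV :: 'a set)" "upper_semi_fredholm T"
  shows "\<not> strictly_singular T"
proof -
  obtain \<Phi> where \<Phi>: "finite \<Phi>" "bounded_below_on T (annihilator \<Phi>)"
    using assms(2) unfolding upper_semi_fredholm_def by blast
  have "banach_subspace (annihilator \<Phi> :: 'a set)"
    using infinite_dimensional_annihilator[OF assms(1) \<Phi>(1)] by (simp add: banach_subspace_def)
  then show ?thesis using \<Phi>(2) strictly_singular_iff by blast
qed

lemma HI_infinite_dimensional:
  "hereditarily_indecomposable TYPE('a::banach) \<Longrightarrow> infinite_dimensional (UNIV :: 'a set)"
  by (simp add: hereditarily_indecomposable_def)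

text \<open>Otherwise \<open>T\<close> is bounded below by \<open>c\<close> on \<open>Y\<close> and
  above by \<open>c / 2\<close> on some \<open>Z\<close>. Then \<open>norm y\<close> is controlled
  by \<open>norm (y + z)\<close>, so \<open>Y\<close> and \<open>Z\<close> form a topological direct
  sum, which indecomposability forbids.\<close>

proposition HI_upper_semi_fredholm:
  fixes T :: "'a::banach \<Rightarrow>\<^sub>L 'b::banach"
  assumes HI: "hereditarily_indecomposable TYPE('a)"
    and Y: "banach_subspace Y" and T: "bounded_below_on T Y"
  shows "upper_semi_fredholm T"
proof (rule ccontr)
  assume "\<not> upper_semi_fredholm T"
  note small = not_upper_semi_fredholm_small_subspace[OF this, of "{}"]
  obtain c where c: "c > 0" "\<And>y. y \<in> Y \<Longrightarrow> c * norm y \<le> norm (blinfun_apply T y)"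
    using T unfolding bounded_below_on_def by blast
  obtain Z where Z: "banach_subspace Z" "\<And>z. z \<in> Z \<Longrightarrow> norm (blinfun_apply T z) \<le> c / 2 * norm z"
    using small[of "c / 2"] c(1) by auto
  have subY: "subspace Y" "closed Y" and subZ: "subspace Z" "closed Z"
    using Y Z(1) by (auto simp: banach_subspace_def)
  \<comment> \<open>Solves \<open>c norm y \<le> norm T norm (y + z) + c / 2 (norm (y + z) + norm
    y)\<close> for \<open>norm y\<close>.\<close>
  define M where "M = 2 * (norm T + c / 2) / c"
  have M: "M > 0" using c(1) by (auto simp: M_def intro!: divide_pos_pos add_nonneg_pos)
  have sum_bound: "norm y \<le> M * norm (y + z)" if "y \<in> Y" "z \<in> Z" for y z
  proof -
    have "c * norm y \<le> norm (blinfun_apply T y)" by (rule c(2)[OF that(1)])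
    also have "blinfun_apply T y = blinfun_apply T (y + z) - blinfun_apply T z"
      by (simp add: blinfun.add_right)
    also have "norm \<dots> \<le> norm (blinfun_apply T (y + z)) + norm (blinfun_apply T z)"
      by (rule norm_triangle_ineq4)
    also have "\<dots> \<le> norm T * norm (y + z) + c / 2 * norm z"
      using norm_blinfun[of T "y + z"] Z(2)[OF that(2)] by linarith
    also have "norm z \<le> norm (y + z) + norm y"
      using norm_triangle_ineq4[of "y + z" y] by simp
    then have "c / 2 * norm z \<le> c / 2 * (norm (y + z) + norm y)"
      using c(1) by (intro mult_left_mono) auto
    then have "norm T * norm (y + z) + c / 2 * norm z \<le> norm T * norm (y + z) + c / 2 * (norm (y + z) + norm y)"
      by linarith
    finally have "c / 2 * norm y \<le> (norm T + c / 2) * norm (y + z)"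
      by (simp add: algebra_simps)
    then show ?thesis using c(1) by (simp add: M_def field_simps)
  qed
  have "Y \<inter> Z = {0}"
  proof -
    have "x = 0" if "x \<in> Y" "x \<in> Z" for x
      using sum_bound[of x "- x"] that subspace_neg[OF subZ(1)] by simp
    then show ?thesis using subspace_0[OF subY(1)] subspace_0[OF subZ(1)] by blast
  qed
  moreover have "closed {y + z | y z. y \<in> Y \<and> z \<in> Z}"
    unfolding closed_sequential_limits
  proof (intro allI impI)
    fix u l assume *: "(\<forall>n. u n \<in> {y + z | y z. y \<in> Y \<and> z \<in> Z}) \<and> u \<longlonglongrightarrow> l"
    then have "\<forall>n. \<exists>y z. u n = y + z \<and> y \<in> Y \<and> z \<in> Z" by blast
    then obtain y z where yz: "\<And>n. u n = y n + z n" "\<And>n. y n \<in> Y" "\<And>n. z n \<in> Z" by metis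
    have "Cauchy u" using * LIMSEQ_imp_Cauchy by blast
    have "Cauchy y"
    proof (rule metric_CauchyI)
      fix e :: real assume "e > 0"
      then obtain N where N: "\<And>m n. m \<ge> N \<Longrightarrow> n \<ge> N \<Longrightarrow> dist (u m) (u n) < e / M"
        using metric_CauchyD[OF \<open>Cauchy u\<close>, of "e / M"] M by auto
      have "dist (y m) (y n) < e" if "m \<ge> N" "n \<ge> N" for m n
      proof -
        have "norm (y m - y n) \<le> M * norm ((y m - y n) + (z m - z n))"
          by (intro sum_bound subspace_diff subY subZ yz)
        also have "(y m - y n) + (z m - z n) = u m - u n" by (simp add: yz)
        also have "M * norm (u m - u n) < e"
          using N[OF that] M by (simp add: dist_norm field_simps)
        finally show ?thesis by (simp add: dist_norm)
      qed
      then show "\<exists>N. \<forall>m\<ge>N. \<forall>n\<ge>N. dist (y m) (y n) < e" by blast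
    qed
    then obtain a where a: "y \<longlonglongrightarrow> a" using Cauchy_convergent_iff convergent_def by blast
    have "(\<lambda>n. u n - y n) \<longlonglongrightarrow> l - a" using * a by (intro tendsto_diff) auto
    then have "z \<longlonglongrightarrow> l - a" by (simp add: yz)
    then have "a \<in> Y" "l - a \<in> Z"
      using a subY(2) subZ(2) yz closed_sequentially by metis+
    then show "l \<in> {y + z | y z. y \<in> Y \<and> z \<in> Z}"
      by (intro CollectI exI[of _ a] exI[of _ "l - a"]) simp
  qed
  ultimately show False
    using HI Y Z(1) unfolding hereditarily_indecomposable_def by blast
qed

text \<open>From here on the arguments speak of semi-Fredholm operators only; strict singularity
  returns with the quotient algebra.\<close>

corollary HI_strictly_singular_iff:
  fixes T :: "'a::banach \<Rightarrow>\<^sub>L 'a"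
  assumes "hereditarily_indecomposable TYPE('a)"
  shows "strictly_singular T \<longleftrightarrow> \<not> upper_semi_fredholm T"
  using HI_upper_semi_fredholm[OF assms] strictly_singular_iff
    upper_semi_fredholm_not_strictly_singular[OF HI_infinite_dimensional[OF assms]] by blast

section \<open>Finite-rank perturbations\<close>

definition rank_one :: "('a::real_normed_vector \<Rightarrow>\<^sub>L real) \<Rightarrow> 'b::real_normed_vector \<Rightarrow> 'a \<Rightarrow>\<^sub>L 'b" where
  "rank_one f w = blinfun_scaleR_left w o\<^sub>L f"

lemma rank_one_apply [simp]: "blinfun_apply (rank_one f w) x = blinfun_apply f x *\<^sub>R w"
  by (simp add: rank_one_def)

text \<open>Generated by rank-one terms, so that stability properties follow by induction; the
  finite-dimensional range and the kernel of finite codimension are recovered afterwards.\<close>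

inductive finite_rank :: "('a::real_normed_vector \<Rightarrow>\<^sub>L 'b::real_normed_vector) \<Rightarrow> bool" where
  zero: "finite_rank 0"
| add_rank_one: "finite_rank K \<Longrightarrow> finite_rank (K + rank_one f w)"

lemma finite_rank_rank_one: "finite_rank (rank_one f w)"
  using finite_rank.add_rank_one[OF finite_rank.zero] by simp

lemma finite_rank_add:
  assumes K: "finite_rank K" and L: "finite_rank L"
  shows "finite_rank (K + L)"
  using L
proof (induction rule: finite_rank.induct)
  case (add_rank_one L f w)
  then show ?case using finite_rank.add_rank_one[of "K + L" f w] by (simp add: add.assoc)
qed (simp add: K)

lemma finite_rank_scaleR: "finite_rank K \<Longrightarrow> finite_rank (c *\<^sub>R K)"
proof (induction rule: finite_rank.induct)
  case (add_rank_one K f w)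
  have "c *\<^sub>R (K + rank_one f w) = c *\<^sub>R K + rank_one f (c *\<^sub>R w)"
    by (rule blinfun_eqI) (simp add: blinfun.bilinear_simps scaleR_add_right)
  then show ?case using finite_rank.add_rank_one[OF add_rank_one.IH] by simp
qed (simp add: finite_rank.zero)

lemma finite_rank_uminus: "finite_rank K \<Longrightarrow> finite_rank (- K)"
  using finite_rank_scaleR[of K "-1"] by simp

lemma finite_rank_diff: "finite_rank K \<Longrightarrow> finite_rank L \<Longrightarrow> finite_rank (K - L)"
  using finite_rank_add[OF _ finite_rank_uminus] by fastforce

lemma finite_rank_compose_left: "finite_rank K \<Longrightarrow> finite_rank (A o\<^sub>L K)"
proof (induction rule: finite_rank.induct)
  case (add_rank_one K f w)
  have "A o\<^sub>L (K + rank_one f w) = (A o\<^sub>L K) + rank_one f (blinfun_apply A w)"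
    by (rule blinfun_eqI) (simp add: blinfun.bilinear_simps)
  then show ?case using finite_rank.add_rank_one[OF add_rank_one.IH] by simp
qed (simp add: finite_rank.zero)

lemma finite_rank_compose_right: "finite_rank K \<Longrightarrow> finite_rank (K o\<^sub>L A)"
proof (induction rule: finite_rank.induct)
  case (add_rank_one K f w)
  have "(K + rank_one f w) o\<^sub>L A = (K o\<^sub>L A) + rank_one (f o\<^sub>L A) w"
    by (rule blinfun_eqI) (simp add: blinfun.bilinear_simps)
  then show ?case using finite_rank.add_rank_one[OF add_rank_one.IH] by simp
qed (simp add: finite_rank.zero)

lemma finite_rank_vanishes:
  "finite_rank K \<Longrightarrow> \<exists>\<Phi>. finite \<Phi> \<and> (\<forall>x\<in>annihilator \<Phi>. blinfun_apply K x = 0)"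
proof (induction rule: finite_rank.induct)
  case (add_rank_one K f w)
  then obtain \<Phi> where "finite \<Phi>" "\<forall>x\<in>annihilator \<Phi>. blinfun_apply K x = 0" by blast
  then show ?case
    by (intro exI[of _ "insert f \<Phi>"]) (auto simp: annihilator_insert blinfun.bilinear_simps)
qed auto

lemma finite_rank_range:
  "finite_rank K \<Longrightarrow> \<exists>B. finite B \<and> range (blinfun_apply K) \<subseteq> span B"
proof (induction rule: finite_rank.induct)
  case zero
  show ?case by (intro exI[of _ "{}"]) auto
next
  case (add_rank_one K f w)
  then obtain B where B: "finite B" "range (blinfun_apply K) \<subseteq> span B" by blast
  have "blinfun_apply K x + blinfun_apply f x *\<^sub>R w \<in> span (insert w B)" for x
    using B(2) span_mono[of B "insert w B"] by (intro span_add span_scale[OF span_base]) auto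
  then show ?case
    by (intro exI[of _ "insert w B"]) (use B(1) in \<open>auto simp: blinfun.bilinear_simps\<close>)
qed

lemma upper_semi_fredholm_compose_cancel:
  assumes "upper_semi_fredholm (A o\<^sub>L T)"
  shows "upper_semi_fredholm T"
proof -
  obtain \<Phi> c where \<Phi>: "finite \<Phi>" "c > 0" "\<And>x. x \<in> annihilator \<Phi> \<Longrightarrow> c * norm x \<le> norm (blinfun_apply (A o\<^sub>L T) x)"
    using assms unfolding upper_semi_fredholm_def bounded_below_on_def by blast
  have "c / (norm A + 1) * norm x \<le> norm (blinfun_apply T x)" if "x \<in> annihilator \<Phi>" for x
  proof -
    have "c * norm x \<le> norm A * norm (blinfun_apply T x)"
      using \<Phi>(3)[OF that] norm_blinfun[of A "blinfun_apply T x"] by simp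
    also have "\<dots> \<le> (norm A + 1) * norm (blinfun_apply T x)" by (intro mult_right_mono) auto
    finally show ?thesis
      using norm_ge_zero[of A] by (simp add: pos_divide_le_eq add_nonneg_pos mult.commute)
  qed
  moreover have "c / (norm A + 1) > 0" using \<Phi>(2) by (intro divide_pos_pos add_nonneg_pos) auto
  ultimately show ?thesis
    using \<Phi>(1) unfolding upper_semi_fredholm_def bounded_below_on_def by blast
qed

lemma upper_semi_fredholm_scaleR:
  assumes "upper_semi_fredholm T" "c \<noteq> 0"
  shows "upper_semi_fredholm (c *\<^sub>R T)"
proof -
  have "((1 / c) *\<^sub>R id_blinfun) o\<^sub>L (c *\<^sub>R T) = T"
    by (rule blinfun_eqI) (use assms(2) in \<open>simp add: blinfun.bilinear_simps\<close>)
  then show ?thesis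
    using upper_semi_fredholm_compose_cancel[of "(1 / c) *\<^sub>R id_blinfun" "c *\<^sub>R T"] assms(1) by simp
qed

lemma upper_semi_fredholm_scaleR_iff:
  "c \<noteq> 0 \<Longrightarrow> upper_semi_fredholm (c *\<^sub>R T) \<longleftrightarrow> upper_semi_fredholm T"
  using upper_semi_fredholm_scaleR[of T c] upper_semi_fredholm_scaleR[of "c *\<^sub>R T" "1 / c"] by auto

lemma upper_semi_fredholm_id: "upper_semi_fredholm id_blinfun"
  unfolding upper_semi_fredholm_def bounded_below_on_def
  by (intro exI[of _ "{}"] conjI exI[of _ 1]) auto

lemma upper_semi_fredholm_finite_rank:
  assumes "upper_semi_fredholm T" "finite_rank K"
  shows "upper_semi_fredholm (T + K)"
proof -
  obtain \<Phi> c where \<Phi>: "finite \<Phi>" "c > 0" "\<And>x. x \<in> annihilator \<Phi> \<Longrightarrow> c * norm x \<le> norm (blinfun_apply T x)"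
    using assms(1) unfolding upper_semi_fredholm_def bounded_below_on_def by blast
  obtain \<Psi> where \<Psi>: "finite \<Psi>" "\<And>x. x \<in> annihilator \<Psi> \<Longrightarrow> blinfun_apply K x = 0"
    using finite_rank_vanishes[OF assms(2)] by blast
  show ?thesis
    unfolding upper_semi_fredholm_def bounded_below_on_def
    using \<Phi> \<Psi> by (intro exI[of _ "\<Phi> \<union> \<Psi>"] conjI exI[of _ c]) (auto simp: annihilator_Un blinfun.add_left)
qed

lemma not_upper_semi_fredholm_zero:
  assumes "infinite_dimensional (UNIV :: 'a::real_normed_vector set)"
  shows "\<not> upper_semi_fredholm (0 :: 'a \<Rightarrow>\<^sub>L 'b::real_normed_vector)"
proof
  assume "upper_semi_fredholm (0 :: 'a \<Rightarrow>\<^sub>L 'b)"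
  then obtain \<Phi> :: "('a \<Rightarrow>\<^sub>L real) set" and c :: real where \<Phi>: "finite \<Phi>" "c > 0"
    "\<And>x. x \<in> annihilator \<Phi> \<Longrightarrow> c * norm x \<le> 0"
    unfolding upper_semi_fredholm_def bounded_below_on_def by auto
  have "annihilator \<Phi> \<subseteq> span {}"
    using \<Phi>(2,3) by (fastforce simp: mult_le_0_iff)
  then show False
    using infinite_dimensional_not_subset_span[OF infinite_dimensional_annihilator[OF assms \<Phi>(1)]]
      subspace_annihilator finite.emptyI by blast
qed

text \<open>If \<open>T\<close> fails, it is small on a subspace where \<open>S + T\<close> is
  bounded below. There \<open>S\<close> is bounded below, and the dichotomy extends this to finite
  codimension. Read backwards: operators that are not semi-Fredholm are closed under sums.\<close>

lemma HI_upper_semi_fredholm_add: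
  fixes S T :: "'a::banach \<Rightarrow>\<^sub>L 'b::banach"
  assumes HI: "hereditarily_indecomposable TYPE('a)"
    and ST: "upper_semi_fredholm (S + T)"
  shows "upper_semi_fredholm S \<or> upper_semi_fredholm T"
proof (rule disjCI)
  assume T: "\<not> upper_semi_fredholm T"
  obtain \<Phi> c where \<Phi>: "finite \<Phi>" "c > 0" "\<And>x. x \<in> annihilator \<Phi> \<Longrightarrow> c * norm x \<le> norm (blinfun_apply (S + T) x)"
    using ST unfolding upper_semi_fredholm_def bounded_below_on_def by blast
  obtain Z where Z: "banach_subspace Z" "Z \<subseteq> annihilator \<Phi>"
    "\<And>z. z \<in> Z \<Longrightarrow> norm (blinfun_apply T z) \<le> c / 2 * norm z"
    using not_upper_semi_fredholm_small_subspace[OF T \<Phi>(1), of "c / 2"] \<Phi>(2) by auto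
  have "c / 2 * norm z \<le> norm (blinfun_apply S z)" if "z \<in> Z" for z
  proof -
    have "c * norm z \<le> norm (blinfun_apply S z + blinfun_apply T z)"
      using \<Phi>(3)[of z] Z(2) that by (auto simp: blinfun.add_left)
    also have "\<dots> \<le> norm (blinfun_apply S z) + norm (blinfun_apply T z)" by (rule norm_triangle_ineq)
    finally show ?thesis using Z(3)[OF that] by linarith
  qed
  then have "bounded_below_on S Z" unfolding bounded_below_on_def using \<Phi>(2) half_gt_zero by blast
  then show "upper_semi_fredholm S" by (rule HI_upper_semi_fredholm[OF HI Z(1)])
qed

text \<open>A bound for \<open>T o\<^sub>L A\<close> says something about \<open>T\<close> only on
  the image of \<open>A\<close>. That image contains an infinite-dimensional closed subspace, which
  is enough on an HI space.\<close>

lemma HI_upper_semi_fredholm_compose_left: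
  fixes A :: "'a::banach \<Rightarrow>\<^sub>L 'b::banach" and T :: "'b \<Rightarrow>\<^sub>L 'c::banach"
  assumes HI: "hereditarily_indecomposable TYPE('b)" and inf: "infinite_dimensional (UNIV :: 'a set)"
    and TA: "upper_semi_fredholm (T o\<^sub>L A)"
  shows "upper_semi_fredholm T"
proof -
  obtain \<Phi> where \<Phi>: "finite \<Phi>" "bounded_below_on (T o\<^sub>L A) (annihilator \<Phi>)"
    using TA unfolding upper_semi_fredholm_def by blast
  then obtain c where c: "c > 0" "\<And>x. x \<in> annihilator \<Phi> \<Longrightarrow> c * norm x \<le> norm (blinfun_apply T (blinfun_apply A x))"
    unfolding bounded_below_on_def by auto
  obtain \<Psi> d where \<Psi>: "finite \<Psi>" "d > 0" "\<And>x. x \<in> annihilator \<Psi> \<Longrightarrow> d * norm x \<le> norm (blinfun_apply A x)"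
    using upper_semi_fredholm_compose_cancel[OF TA] unfolding upper_semi_fredholm_def bounded_below_on_def by blast
  let ?Y = "annihilator (\<Phi> \<union> \<Psi>)"
  have Y: "banach_subspace ?Y"
    unfolding banach_subspace_def
    using infinite_dimensional_annihilator[OF inf, of "\<Phi> \<union> \<Psi>"] \<Phi>(1) \<Psi>(1) by simp
  have A: "bounded_below_on A ?Y"
    unfolding bounded_below_on_def using \<Psi> by (auto simp: annihilator_Un)
  have "c / (norm A + 1) * norm y \<le> norm (blinfun_apply T y)" if y: "y \<in> blinfun_apply A ` ?Y" for y
  proof -
    obtain x where x: "x \<in> annihilator \<Phi>" "y = blinfun_apply A x"
      using y by (auto simp: annihilator_Un)
    have "norm y \<le> (norm A + 1) * norm x"
      unfolding x(2) using norm_blinfun[of A x] by (simp add: distrib_right add_increasing2)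
    then have "norm y / (norm A + 1) \<le> norm x"
      by (simp add: pos_divide_le_eq add_nonneg_pos mult.commute)
    then have "c * (norm y / (norm A + 1)) \<le> c * norm x" using c(1) by (intro mult_left_mono) auto
    then show ?thesis using c(2)[OF x(1)] x(2) by simp
  qed
  moreover have "c / (norm A + 1) > 0" using c(1) by (intro divide_pos_pos add_nonneg_pos) auto
  ultimately have "bounded_below_on T (blinfun_apply A ` ?Y)"
    unfolding bounded_below_on_def by blast
  then show ?thesis
    by (rule HI_upper_semi_fredholm[OF HI banach_subspace_image_bounded_below[OF A Y]])
qed

section \<open>Fredholm operators of index zero\<close>

definition invertible_blinfun :: "('a::real_normed_vector \<Rightarrow>\<^sub>L 'a) \<Rightarrow> bool" where
  "invertible_blinfun T \<longleftrightarrow> (\<exists>G. G o\<^sub>L T = id_blinfun \<and> T o\<^sub>L G = id_blinfun)"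

lemma blinfun_compose_id [simp]: "A o\<^sub>L id_blinfun = A" "id_blinfun o\<^sub>L A = A"
  by (auto intro: blinfun_eqI)

lemma blinfun_compose_eq_id_apply: "A o\<^sub>L B = id_blinfun \<Longrightarrow> blinfun_apply A (blinfun_apply B x) = x"
  by (metis blinfun_apply_blinfun_compose blinfun_apply_id_blinfun)

lemma bounded_below_right_inverse:
  fixes T :: "'a::real_normed_vector \<Rightarrow>\<^sub>L 'b::real_normed_vector"
  assumes Y: "subspace Y" and c: "c > 0" "\<And>y. y \<in> Y \<Longrightarrow> c * norm y \<le> norm (blinfun_apply T y)"
    and im: "blinfun_apply T ` Y = UNIV"
  obtains R where "T o\<^sub>L R = id_blinfun" "\<And>y. y \<in> Y \<Longrightarrow> blinfun_apply R (blinfun_apply T y) = y"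
    "norm R \<le> 1 / c"
proof -
  have "bounded_below_on T Y" unfolding bounded_below_on_def using c by blast
  then have inj: "inj_on (blinfun_apply T) Y" using Y by (rule bounded_below_on_imp_inj_on)
  define r where "r = inv_into Y (blinfun_apply T)"
  have rY: "r x \<in> Y" and Tr: "blinfun_apply T (r x) = x" for x
    unfolding r_def using im inv_into_into[of x "blinfun_apply T" Y] f_inv_into_f[of x "blinfun_apply T" Y] by auto
  have r_eq: "r x = y" if "y \<in> Y" "blinfun_apply T y = x" for x y
    using that inj by (auto simp: r_def inv_into_f_f)
  have bound: "norm (r x) \<le> norm x * (1 / c)" for x
    using c(2)[OF rY, of x] c(1) by (simp add: Tr field_simps)
  have lin: "bounded_linear r"
  proof (rule bounded_linear_intro[OF _ _ bound])
    show "r (x + y) = r x + r y" for x y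
      by (rule r_eq) (auto simp: blinfun.add_right Tr intro: subspace_add[OF Y] rY)
    show "r (a *\<^sub>R x) = a *\<^sub>R r x" for a x
      by (rule r_eq) (auto simp: blinfun.scaleR_right Tr intro: subspace_scale[OF Y] rY)
  qed
  note ap = bounded_linear_Blinfun_apply[OF lin]
  show thesis
  proof (rule that)
    show "T o\<^sub>L Blinfun r = id_blinfun" by (rule blinfun_eqI) (simp add: ap Tr)
    show "blinfun_apply (Blinfun r) (blinfun_apply T y) = y" if "y \<in> Y" for y
      using that by (simp add: ap r_eq)
    show "norm (Blinfun r) \<le> 1 / c"
      using c(1) bound by (intro norm_blinfun_bound) (auto simp: ap mult.commute)
  qed
qed

lemma bounded_below_surj_inverse:
  fixes T :: "'a::real_normed_vector \<Rightarrow>\<^sub>L 'a"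
  assumes c: "c > 0" "\<And>x. c * norm x \<le> norm (blinfun_apply T x)" and surj: "surj (blinfun_apply T)"
  obtains G where "T o\<^sub>L G = id_blinfun" "G o\<^sub>L T = id_blinfun" "norm G \<le> 1 / c"
proof -
  obtain R where R: "T o\<^sub>L R = id_blinfun" "\<And>y. blinfun_apply R (blinfun_apply T y) = y" "norm R \<le> 1 / c"
    using bounded_below_right_inverse[of UNIV c T] c surj by auto
  then have "R o\<^sub>L T = id_blinfun" by (auto intro: blinfun_eqI)
  then show thesis using R that by blast
qed

lemma invertible_blinfun_compose:
  assumes "invertible_blinfun A" "invertible_blinfun B"
  shows "invertible_blinfun (A o\<^sub>L B)"
proof -
  obtain G H where "G o\<^sub>L A = id_blinfun" "A o\<^sub>L G = id_blinfun" "H o\<^sub>L B = id_blinfun" "B o\<^sub>L H = id_blinfun"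
    using assms unfolding invertible_blinfun_def by blast
  then show ?thesis
    unfolding invertible_blinfun_def
    by (intro exI[of _ "H o\<^sub>L G"] conjI blinfun_eqI) (simp_all add: blinfun_compose_eq_id_apply)
qed

lemma invertible_blinfun_bij: "invertible_blinfun T \<Longrightarrow> inj (blinfun_apply T) \<and> surj (blinfun_apply T)"
  unfolding invertible_blinfun_def
  by (metis blinfun_compose_eq_id_apply injI surjI)

text \<open>Solving \<open>x + B x = y\<close> is a fixed point problem for the contraction
  \<open>x \<mapsto> y - B x\<close>. The norm bound on the inverse is what the continuation of
  square roots uses.\<close>

lemma id_plus_inverse:
  fixes B :: "'a::banach \<Rightarrow>\<^sub>L 'a"
  assumes B: "norm B < 1"
  obtains G where "(id_blinfun + B) o\<^sub>L G = id_blinfun" "G o\<^sub>L (id_blinfun + B) = id_blinfun"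
    "norm G \<le> 1 / (1 - norm B)"
proof -
  have "(1 - norm B) * norm x \<le> norm (blinfun_apply (id_blinfun + B) x)" for x
    using norm_blinfun[of B x] norm_diff_ineq[of x "blinfun_apply B x"]
    by (simp add: blinfun.add_left algebra_simps)
  moreover have "surj (blinfun_apply (id_blinfun + B))"
    unfolding surj_def
  proof
    fix y
    have "dist (y - blinfun_apply B x) (y - blinfun_apply B x') \<le> norm B * dist x x'" for x x'
      using norm_blinfun[of B "x' - x"] by (simp add: dist_norm blinfun.diff_right norm_minus_commute)
    then have "\<exists>!x. y - blinfun_apply B x = x"
      using B by (intro banach_fix_type[of "norm B"]) auto
    then obtain x where "y - blinfun_apply B x = x" by blast
    then show "\<exists>x. y = blinfun_apply (id_blinfun + B) x"
      by (intro exI[of _ x]) (simp add: blinfun.add_left algebra_simps)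
  qed
  ultimately show thesis
    using bounded_below_surj_inverse[of "1 - norm B" "id_blinfun + B"] B that by (metis diff_gt_0_iff_gt)
qed

lemma invertible_id_plus:
  fixes B :: "'a::banach \<Rightarrow>\<^sub>L 'a"
  shows "norm B < 1 \<Longrightarrow> invertible_blinfun (id_blinfun + B)"
  unfolding invertible_blinfun_def by (metis id_plus_inverse)

lemma invertible_perturbation:
  fixes T E G :: "'a::banach \<Rightarrow>\<^sub>L 'a"
  assumes G: "G o\<^sub>L T = id_blinfun" "T o\<^sub>L G = id_blinfun" and E: "norm G * norm E < 1"
  shows "invertible_blinfun (T + E)"
proof -
  have "T + E = T o\<^sub>L (id_blinfun + (G o\<^sub>L E))"
    by (rule blinfun_eqI) (simp add: blinfun.bilinear_simps blinfun_compose_eq_id_apply[OF G(2)])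
  moreover have "invertible_blinfun (id_blinfun + (G o\<^sub>L E))"
    by (rule invertible_id_plus) (rule le_less_trans[OF norm_blinfun_compose E])
  moreover have "invertible_blinfun T" unfolding invertible_blinfun_def using G by blast
  ultimately show ?thesis by (simp add: invertible_blinfun_compose)
qed

section \<open>The Fredholm alternative for finite-rank perturbations\<close>

lemma linear_inj_on_imp_surj_on:
  fixes L :: "'a::real_vector \<Rightarrow> 'a"
  assumes lin: "linear L" and B: "finite B" and inv: "L ` span B \<subseteq> span B" and inj: "inj_on L (span B)"
  shows "L ` span B = span B"
proof (rule antisym[OF inv], rule subsetI)
  obtain C where C: "C \<subseteq> B" "independent C" "B \<subseteq> span C"
    using maximal_independent_subset by blast
  have spanC: "span C = span B"
    using C by (metis span_minimal span_mono subspace_span subset_antisym)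
  have finC: "finite C" using C(1) B finite_subset by blast
  have indep: "independent (L ` C)"
    by (rule linear_independent_injective_image[OF lin C(2)]) (simp add: spanC inj)
  have sub: "L ` C \<subseteq> span C" using inv span_superset[of C] unfolding spanC by blast
  have injC: "inj_on L C" using inj span_superset[of C] unfolding spanC by (rule inj_on_subset)
  fix v assume v: "v \<in> span B"
  show "v \<in> L ` span B"
  proof (rule ccontr)
    assume "v \<notin> L ` span B"
    then have nspan: "v \<notin> span (L ` C)" by (simp add: linear_span_image[OF lin] spanC)
    then have "v \<notin> L ` C" using span_superset[of "L ` C"] by blast
    then have "card (insert v (L ` C)) = Suc (card C)" using finC injC by (simp add: card_image)
    moreover have "independent (insert v (L ` C))" using indep nspan by (simp add: independent_insert)
    then have "card (insert v (L ` C)) \<le> card C"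
      using independent_span_bound[OF finC] sub v spanC by simp
    ultimately show False by simp
  qed
qed

lemma linear_surj_on_imp_inj_on:
  fixes L :: "'a::real_vector \<Rightarrow> 'a"
  assumes lin: "linear L" and B: "finite B" and surj: "L ` span B = span B"
  shows "inj_on L (span B)"
proof -
  obtain g where g: "range g \<subseteq> span B" "linear g" "\<And>v. v \<in> span B \<Longrightarrow> L (g v) = v"
    using linear_exists_right_inverse_on[OF lin subspace_span, of B] surj by auto
  have "inj_on g (span B)" by (rule inj_on_inverseI[of _ L]) (rule g(3))
  then have "g ` span B = span B"
    using g(1) by (intro linear_inj_on_imp_surj_on[OF g(2) B]) auto
  then show ?thesis using g(3) by (metis imageE inj_on_inverseI)
qed

text \<open>The operator is the identity modulo a finite-dimensional space containing the range of
  \<open>F\<close>, and leaves that space invariant. Both properties are decided there, where a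
  dimension count applies.\<close>

lemma id_plus_finite_rank_inj_iff_surj:
  assumes "finite_rank F"
  shows "inj (blinfun_apply (id_blinfun + F)) \<longleftrightarrow> surj (blinfun_apply (id_blinfun + F))"
proof -
  let ?L = "blinfun_apply (id_blinfun + F)"
  obtain B where B: "finite B" "range (blinfun_apply F) \<subseteq> span B"
    using finite_rank_range[OF assms] by blast
  have FB: "blinfun_apply F x \<in> span B" for x using B(2) by blast
  have L: "?L x = x + blinfun_apply F x" for x by (simp add: blinfun.add_left)
  have lin: "linear ?L" using blinfun.bounded_linear_right bounded_linear.linear by blast
  have inv: "?L ` span B \<subseteq> span B" using FB by (auto simp: L intro: span_add)
  show ?thesis
  proof
    assume "inj ?L"
    then have im: "?L ` span B = span B"
      by (intro linear_inj_on_imp_surj_on[OF lin B(1) inv]) (auto intro: inj_on_subset)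
    show "surj ?L"
    proof (rule surjI)
      fix x
      have "\<exists>r. ?L r = blinfun_apply F x" using im FB by (metis imageE)
      then have "?L (SOME r. ?L r = blinfun_apply F x) = blinfun_apply F x" by (rule someI_ex)
      then show "?L (x - (SOME r. ?L r = blinfun_apply F x)) = x"
        unfolding blinfun.diff_right by (simp add: L)
    qed
  next
    assume surj: "surj ?L"
    have "span B \<subseteq> ?L ` span B"
    proof
      fix r assume r: "r \<in> span B"
      obtain u where u: "r = ?L u" using surj by (metis surjD)
      then have "u = r - blinfun_apply F u" by (simp add: L)
      then have "u \<in> span B" using r FB by (metis span_diff)
      then show "r \<in> ?L ` span B" using u by blast
    qed
    then have inj: "inj_on ?L (span B)"
      using inv by (intro linear_surj_on_imp_inj_on[OF lin B(1)]) auto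
    show "inj ?L"
    proof (rule injI)
      fix x y assume "?L x = ?L y"
      then have z: "?L (x - y) = 0" by (simp only: blinfun.diff_right) simp
      then have "x - y = - blinfun_apply F (x - y)" by (simp add: L eq_neg_iff_add_eq_0)
      then have "x - y \<in> span B" using FB span_neg by metis
      then have "x - y = 0" using inj z by (metis blinfun.zero_right inj_onD span_zero)
      then show "x = y" by simp
    qed
  qed
qed

text \<open>Equivalent on Banach spaces to having closed range and kernel and cokernel of the same
  finite dimension: a finite-rank map matches the two. No integer index is needed.\<close>

definition fredholm_index_0 :: "('a::real_normed_vector \<Rightarrow>\<^sub>L 'a) \<Rightarrow> bool" where
  "fredholm_index_0 T \<longleftrightarrow> (\<exists>K. finite_rank K \<and> invertible_blinfun (T + K))"

lemma invertible_fredholm_index_0: "invertible_blinfun T \<Longrightarrow> fredholm_index_0 T"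
  unfolding fredholm_index_0_def by (intro exI[of _ 0]) (auto intro: finite_rank.zero)

lemma fredholm_index_0_add_finite_rank:
  assumes "fredholm_index_0 T" "finite_rank K"
  shows "fredholm_index_0 (T + K)"
proof -
  obtain L where "finite_rank L" "invertible_blinfun (T + L)"
    using assms(1) unfolding fredholm_index_0_def by blast
  then show ?thesis
    unfolding fredholm_index_0_def
    by (intro exI[of _ "L - K"]) (auto intro: finite_rank_diff assms(2))
qed

text \<open>With \<open>G\<close> inverse to \<open>T + K\<close>, the factorization
  \<open>T = (T + K)(1 - G K)\<close> reduces the claim to a finite-rank perturbation of the
  identity.\<close>

lemma fredholm_index_0_inj_iff_surj:
  assumes "fredholm_index_0 T"
  shows "inj (blinfun_apply T) \<longleftrightarrow> surj (blinfun_apply T)"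
proof -
  obtain K G where K: "finite_rank K" and G: "G o\<^sub>L (T + K) = id_blinfun" "(T + K) o\<^sub>L G = id_blinfun"
    using assms unfolding fredholm_index_0_def invertible_blinfun_def by blast
  let ?F = "id_blinfun + (G o\<^sub>L (- K))"
  have bij: "bij (blinfun_apply (T + K))"
    using invertible_blinfun_bij[of "T + K"] G unfolding invertible_blinfun_def bij_def by blast
  have T: "blinfun_apply T = blinfun_apply (T + K) \<circ> blinfun_apply ?F"
  proof (rule ext)
    fix x
    have "blinfun_apply (T + K) (blinfun_apply ?F x)
        = blinfun_apply (T + K) x + blinfun_apply (T + K) (blinfun_apply G (blinfun_apply (- K) x))"
      by (simp add: blinfun.add_left[of id_blinfun] blinfun.add_right)
    also have "\<dots> = blinfun_apply T x"
      unfolding blinfun_compose_eq_id_apply[OF G(2)] by (simp add: blinfun.add_left blinfun.minus_left)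
    finally show "blinfun_apply T x = (blinfun_apply (T + K) \<circ> blinfun_apply ?F) x" by simp
  qed
  have "inj (blinfun_apply T) \<longleftrightarrow> inj (blinfun_apply ?F)"
    unfolding T using bij by (metis bij_is_inj inj_compose inj_on_imageI2)
  moreover have "surj (blinfun_apply T) \<longleftrightarrow> surj (blinfun_apply ?F)"
    unfolding T using bij by (metis bij_betw_def image_comp inj_image_eq_iff)
  ultimately show ?thesis
    using id_plus_finite_rank_inj_iff_surj[OF finite_rank_compose_left[OF finite_rank_uminus[OF K], of G]] by simp
qed

text \<open>The image of the smaller subspace is closed, so \<open>T g\<close> has positive distance
  \<open>d\<close> from it. This distance controls the coefficient of \<open>g\<close> in
  \<open>x\<close>, and the old bound controls the rest.\<close>

lemma bounded_below_extend:
  fixes T :: "'a::banach \<Rightarrow>\<^sub>L 'b::banach"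
  assumes T: "bounded_below_on T (annihilator (insert f \<Phi>))"
    and g: "g \<in> annihilator \<Phi>" "blinfun_apply f g = 1"
    and Tg: "blinfun_apply T g \<notin> blinfun_apply T ` annihilator (insert f \<Phi>)"
  shows "bounded_below_on T (annihilator \<Phi>)"
proof -
  let ?Y = "annihilator (insert f \<Phi>)"
  obtain c where c: "c > 0" "\<And>y. y \<in> ?Y \<Longrightarrow> c * norm y \<le> norm (blinfun_apply T y)"
    using T unfolding bounded_below_on_def by blast
  have "closed (blinfun_apply T ` ?Y)" by (intro closed_image_bounded_below[OF T]) auto
  then obtain d where "d > 0" "ball (blinfun_apply T g) d \<subseteq> - blinfun_apply T ` ?Y"
    using Tg by (meson ComplI closed_Compl open_Compl open_contains_ball)
  then have d: "d > 0" "\<And>y. y \<in> ?Y \<Longrightarrow> d \<le> dist (blinfun_apply T g) (blinfun_apply T y)"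
    by (auto simp: subset_iff not_less[symmetric])
  \<comment> \<open>Combines \<open>\<bar>a\<bar> \<le> t / d\<close> with
    \<open>c norm y \<le> t + \<bar>a\<bar> norm (T g)\<close> in
    \<open>norm x \<le> norm y + \<bar>a\<bar> norm g\<close>, where
    \<open>t = norm (T x)\<close>.\<close>
  define M where "M = (1 + norm (blinfun_apply T g) / d) / c + norm g / d"
  have M: "M > 0" using c(1) d(1) by (auto simp: M_def intro!: add_pos_nonneg divide_pos_pos)
  have "1 / M * norm x \<le> norm (blinfun_apply T x)" if x: "x \<in> annihilator \<Phi>" for x
  proof -
    define a where "a = blinfun_apply f x"
    define y where "y = x - a *\<^sub>R g"
    define t where "t = norm (blinfun_apply T x)"
    have y: "y \<in> ?Y"
      unfolding annihilator_insert y_def a_def using x g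
      by (simp add: blinfun.diff_right blinfun.scaleR_right subspace_diff subspace_scale)
    have Tx: "blinfun_apply T x = blinfun_apply T y + a *\<^sub>R blinfun_apply T g"
      by (simp add: y_def blinfun.diff_right blinfun.scaleR_right)
    have a: "\<bar>a\<bar> \<le> t / d"
    proof (cases "a = 0")
      case False
      have "(- 1 / a) *\<^sub>R y \<in> ?Y" by (rule subspace_scale[OF subspace_annihilator y])
      from d(2)[OF this] have "\<bar>a\<bar> * d \<le> \<bar>a\<bar> * norm (blinfun_apply T g + (1 / a) *\<^sub>R blinfun_apply T y)"
        by (intro mult_left_mono) (auto simp: dist_norm blinfun.scaleR_right blinfun.minus_right)
      also have "\<dots> = norm (a *\<^sub>R (blinfun_apply T g + (1 / a) *\<^sub>R blinfun_apply T y))" by simp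
      also have "a *\<^sub>R (blinfun_apply T g + (1 / a) *\<^sub>R blinfun_apply T y) = blinfun_apply T x"
        using False by (simp add: Tx scaleR_add_right)
      finally show ?thesis using d(1) by (simp add: t_def field_simps)
    qed (use d(1) in \<open>auto simp: t_def\<close>)
    have "c * norm y \<le> norm (blinfun_apply T x - a *\<^sub>R blinfun_apply T g)"
      using c(2)[OF y] by (simp add: Tx)
    also have "\<dots> \<le> t + \<bar>a\<bar> * norm (blinfun_apply T g)"
      using norm_triangle_ineq4[of "blinfun_apply T x" "a *\<^sub>R blinfun_apply T g"] by (simp add: t_def)
    also have "\<dots> \<le> t + t / d * norm (blinfun_apply T g)"
      using a by (intro add_left_mono mult_right_mono) auto
    finally have ny: "norm y \<le> t * (1 + norm (blinfun_apply T g) / d) / c"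
      using c(1) by (simp add: field_simps)
    have "norm x \<le> norm y + \<bar>a\<bar> * norm g"
      using norm_triangle_ineq[of y "a *\<^sub>R g"] by (simp add: y_def)
    also have "\<dots> \<le> t * (1 + norm (blinfun_apply T g) / d) / c + t / d * norm g"
      using a by (intro add_mono ny mult_right_mono) auto
    also have "\<dots> = M * t" by (simp add: M_def algebra_simps)
    finally show ?thesis using M by (simp add: t_def field_simps)
  qed
  then show ?thesis unfolding bounded_below_on_def using M by (intro exI[of _ "1 / M"]) auto
qed

lemma annihilator_insert_cases:
  obtains "annihilator (insert f \<Phi>) = annihilator \<Phi>"
  | g where "g \<in> annihilator \<Phi>" "blinfun_apply f g = 1"
proof (cases "\<forall>x\<in>annihilator \<Phi>. blinfun_apply f x = 0")
  case True
  then show thesis using that(1) by (auto simp: annihilator_insert)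
next
  case False
  then obtain x where "x \<in> annihilator \<Phi>" "blinfun_apply f x \<noteq> 0" by blast
  then show thesis
    by (intro that(2)[of "(1 / blinfun_apply f x) *\<^sub>R x"])
      (auto simp: blinfun.scaleR_right intro: subspace_scale[OF subspace_annihilator])
qed

lemma upper_semi_fredholm_inj_bounded_below:
  fixes T :: "'a::banach \<Rightarrow>\<^sub>L 'b::banach"
  assumes "upper_semi_fredholm T" "inj (blinfun_apply T)"
  shows "bounded_below_on T UNIV"
proof -
  obtain \<Phi> where "finite \<Phi>" "bounded_below_on T (annihilator \<Phi>)"
    using assms(1) unfolding upper_semi_fredholm_def by blast
  then show ?thesis
  proof (induction \<Phi> rule: finite_induct)
    case empty
    then show ?case by simp
  next
    case (insert f \<Phi>)
    show ?case
    proof (cases rule: annihilator_insert_cases[of f \<Phi>])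
      case 1
      then show ?thesis using insert by simp
    next
      case (2 g)
      have "blinfun_apply T g \<notin> blinfun_apply T ` annihilator (insert f \<Phi>)"
        using 2(2) assms(2) by (auto simp: annihilator_insert dest: injD)
      then show ?thesis using bounded_below_extend[OF insert.prems 2] insert.IH by blast
    qed
  qed
qed

text \<open>The finite-rank perturbation fills the range one dimension at a time; whichever of kernel and
  cokernel is exhausted first decides the alternative.\<close>

lemma upper_semi_fredholm_alternative:
  fixes T :: "'a::banach \<Rightarrow>\<^sub>L 'b::banach"
  assumes "upper_semi_fredholm T"
  obtains K where "finite_rank K" "bounded_below_on (T + K) UNIV"
  | K R where "finite_rank K" "(T + K) o\<^sub>L R = id_blinfun" "\<not> inj (blinfun_apply (T + K))"
proof -
  obtain \<Phi> where "finite \<Phi>" "bounded_below_on T (annihilator \<Phi>)"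
    using assms(1) unfolding upper_semi_fredholm_def by blast
  then have "\<exists>K. finite_rank K \<and> (bounded_below_on (T + K) UNIV \<or>
      (\<exists>R. (T + K) o\<^sub>L R = id_blinfun \<and> \<not> inj (blinfun_apply (T + K))))"
  proof (induction \<Phi> arbitrary: T rule: finite_induct)
    case empty
    then show ?case by (intro exI[of _ 0]) (simp add: finite_rank.zero)
  next
    case (insert f \<Phi>)
    let ?Y = "annihilator (insert f \<Phi>)"
    show ?case
    proof (cases rule: annihilator_insert_cases[of f \<Phi>])
      case 1
      then show ?thesis using insert by simp
    next
      case (2 g)
      show ?thesis
      proof (cases "blinfun_apply T ` ?Y = UNIV")
        case True
        obtain c where "c > 0" "\<And>y. y \<in> ?Y \<Longrightarrow> c * norm y \<le> norm (blinfun_apply T y)"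
          using insert.prems unfolding bounded_below_on_def by blast
        then obtain R where R: "T o\<^sub>L R = id_blinfun"
          using bounded_below_right_inverse[OF subspace_annihilator _ _ True] by blast
        obtain y where "y \<in> ?Y" "blinfun_apply T y = blinfun_apply T g"
          using True by (metis UNIV_I imageE)
        moreover have "g \<notin> ?Y" using 2(2) by (simp add: annihilator_insert)
        ultimately have "\<not> inj (blinfun_apply T)" by (metis injD)
        then show ?thesis using R by (intro exI[of _ 0]) (auto intro: finite_rank.zero)
      next
        case False
        then obtain w where w: "w \<notin> blinfun_apply T ` ?Y" by blast
        define L where "L = rank_one f (w - blinfun_apply T g)"
        have TL: "blinfun_apply (T + L) y = blinfun_apply T y" if "y \<in> ?Y" for y
          using that by (simp add: L_def blinfun.add_left annihilator_insert)
        have "bounded_below_on (T + L) ?Y"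
          using insert.prems unfolding bounded_below_on_def by (simp add: TL)
        moreover have "blinfun_apply (T + L) g = w"
          by (simp add: L_def blinfun.add_left 2)
        then have "blinfun_apply (T + L) g \<notin> blinfun_apply (T + L) ` ?Y"
          using w by (auto simp: TL)
        ultimately have "bounded_below_on (T + L) (annihilator \<Phi>)"
          using bounded_below_extend[OF _ 2] by blast
        from insert.IH[OF this] obtain K where K: "finite_rank K" "bounded_below_on (T + L + K) UNIV \<or>
            (\<exists>R. (T + L + K) o\<^sub>L R = id_blinfun \<and> \<not> inj (blinfun_apply (T + L + K)))"
          by blast
        have "finite_rank (L + K)"
          unfolding L_def by (intro finite_rank_add finite_rank_rank_one K)
        then show ?thesis using K(2) by (intro exI[of _ "L + K"]) (simp add: add.assoc)
      qed
    qed
  qed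
  then show thesis using that by blast
qed

lemma fredholm_index_0_open:
  fixes T :: "'a::banach \<Rightarrow>\<^sub>L 'a"
  assumes "fredholm_index_0 T"
  obtains e where "e > 0" "\<And>T'. dist T' T < e \<Longrightarrow> fredholm_index_0 T'"
proof -
  obtain K G where K: "finite_rank K" and G: "G o\<^sub>L (T + K) = id_blinfun" "(T + K) o\<^sub>L G = id_blinfun"
    using assms unfolding fredholm_index_0_def invertible_blinfun_def by blast
  show thesis
  proof (rule that)
    show pos: "1 / (norm G + 1) > 0" by (simp add: add_nonneg_pos)
    fix T' assume d: "dist T' T < 1 / (norm G + 1)"
    have "norm G * norm (T' - T) \<le> (norm G + 1) * norm (T' - T)" by (intro mult_right_mono) auto
    also have "\<dots> < 1" using d pos by (simp add: dist_norm field_simps)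
    finally have "invertible_blinfun ((T + K) + (T' - T))" by (rule invertible_perturbation[OF G])
    then show "fredholm_index_0 T'"
      unfolding fredholm_index_0_def by (intro exI[of _ K]) (auto simp: K algebra_simps)
  qed
qed

text \<open>The alternative for \<open>T\<close> persists nearby with a uniform constant. If
  \<open>T + K\<close> is bounded below, so is \<open>T' + K\<close>, which is then invertible with
  an inverse bounded independently of \<open>T'\<close>, close enough to reach \<open>T + K\<close>.
  If \<open>T + K\<close> has a right inverse and a kernel, index zero of \<open>T'\<close> is
  contradictory.\<close>

lemma fredholm_index_0_closed:
  fixes T :: "'a::banach \<Rightarrow>\<^sub>L 'a"
  assumes "upper_semi_fredholm T"
  obtains e where "e > 0" "\<And>T'. dist T' T < e \<Longrightarrow> fredholm_index_0 T' \<Longrightarrow> fredholm_index_0 T"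
  using assms
proof (cases rule: upper_semi_fredholm_alternative)
  case (1 K)
  obtain \<delta> where \<delta>: "\<delta> > 0" "\<And>x. \<delta> * norm x \<le> norm (blinfun_apply (T + K) x)"
    using 1(2) unfolding bounded_below_on_def by blast
  show thesis
  proof (rule that)
    show "\<delta> / 2 > 0" using \<delta>(1) by simp
    fix T' assume d: "dist T' T < \<delta> / 2" and T': "fredholm_index_0 T'"
    have low: "\<delta> / 2 * norm x \<le> norm (blinfun_apply (T' + K) x)" for x
    proof -
      have "\<delta> * norm x \<le> norm (blinfun_apply (T' + K) x - blinfun_apply (T' - T) x)"
        using \<delta>(2)[of x] by (simp add: blinfun.add_left blinfun.diff_left add.commute)
      also have "\<dots> \<le> norm (blinfun_apply (T' + K) x) + norm (blinfun_apply (T' - T) x)"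
        by (rule norm_triangle_ineq4)
      also have "norm (blinfun_apply (T' - T) x) \<le> norm (T' - T) * norm x" by (rule norm_blinfun)
      also have "\<dots> \<le> \<delta> / 2 * norm x" using d by (intro mult_right_mono) (auto simp: dist_norm)
      finally show ?thesis by simp
    qed
    then have "bounded_below_on (T' + K) UNIV"
      unfolding bounded_below_on_def using \<delta>(1) half_gt_zero by blast
    then have "inj (blinfun_apply (T' + K))" by (rule bounded_below_on_imp_inj_on) simp
    then have "surj (blinfun_apply (T' + K))"
      using fredholm_index_0_inj_iff_surj[OF fredholm_index_0_add_finite_rank[OF T' 1(1)]] by blast
    \<comment> \<open>The bound \<open>2 / \<delta>\<close> depends on \<open>T\<close> alone; this
      is why distance \<open>\<delta> / 2\<close> is enough to get back from \<open>T'\<close> to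
      \<open>T\<close>.\<close>
    then obtain G where G: "(T' + K) o\<^sub>L G = id_blinfun" "G o\<^sub>L (T' + K) = id_blinfun" "norm G \<le> 1 / (\<delta> / 2)"
      using bounded_below_surj_inverse[of "\<delta> / 2" "T' + K"] low \<delta>(1) half_gt_zero by blast
    have "norm G * norm (T - T') \<le> 1 / (\<delta> / 2) * norm (T - T')" by (rule mult_right_mono[OF G(3)]) simp
    also have "\<dots> < 1" using d \<delta>(1) by (simp add: dist_norm norm_minus_commute field_simps)
    finally have "invertible_blinfun ((T' + K) + (T - T'))" by (rule invertible_perturbation[OF G(2,1)])
    then show "fredholm_index_0 T"
      unfolding fredholm_index_0_def by (intro exI[of _ K]) (auto simp: 1 algebra_simps)
  qed
next
  case (2 K R)
  show thesis
  proof (rule that)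
    show pos: "1 / (norm R + 1) > 0" by (simp add: add_nonneg_pos)
    fix T' assume d: "dist T' T < 1 / (norm R + 1)" and T': "fredholm_index_0 T'"
    have "norm ((T' - T) o\<^sub>L R) \<le> norm (T' - T) * norm R" by (rule norm_blinfun_compose)
    also have "\<dots> \<le> norm (T' - T) * (norm R + 1)" by (intro mult_left_mono) auto
    also have "\<dots> < 1" using d pos by (simp add: dist_norm field_simps)
    finally have "invertible_blinfun (id_blinfun + ((T' - T) o\<^sub>L R))" by (rule invertible_id_plus)
    moreover have "id_blinfun + ((T' - T) o\<^sub>L R) = (T' + K) o\<^sub>L R"
    proof (rule blinfun_eqI)
      fix x
      show "blinfun_apply (id_blinfun + ((T' - T) o\<^sub>L R)) x = blinfun_apply ((T' + K) o\<^sub>L R) x"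
        using blinfun_compose_eq_id_apply[OF 2(2), of x]
        by (simp add: blinfun.add_left blinfun.diff_left algebra_simps)
    qed
    ultimately obtain G where G: "((T' + K) o\<^sub>L R) o\<^sub>L G = id_blinfun"
      unfolding invertible_blinfun_def by auto
    then have right: "blinfun_apply (T' + K) (blinfun_apply R (blinfun_apply G x)) = x" for x
      using blinfun_compose_eq_id_apply[OF G, of x] by simp
    then have "surj (blinfun_apply (T' + K))" unfolding surj_def by metis
    then have "inj (blinfun_apply (T' + K))"
      using fredholm_index_0_inj_iff_surj[OF fredholm_index_0_add_finite_rank[OF T' 2(1)]] by blast
    then have "blinfun_apply R (blinfun_apply G (blinfun_apply (T' + K) x)) = x" for x
      using right injD by metis
    \<comment> \<open>The right inverse \<open>R\<close> of \<open>T + K\<close> is now onto, so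
      \<open>T + K\<close> would be injective, contrary to this case.\<close>
    then have surj: "surj (blinfun_apply R)" unfolding surj_def by metis
    have "inj (blinfun_apply (T + K))"
    proof (rule injI)
      fix x y assume xy: "blinfun_apply (T + K) x = blinfun_apply (T + K) y"
      obtain u v where "x = blinfun_apply R u" "y = blinfun_apply R v" using surj by (metis surjD)
      then show "x = y" using xy blinfun_compose_eq_id_apply[OF 2(2)] by metis
    qed
    then show "fredholm_index_0 T" using 2(3) by blast
  qed
qed

text \<open>Among semi-Fredholm operators, index zero is both an open and a closed condition, and
  the interval is connected.\<close>

proposition fredholm_index_0_path:
  fixes A :: "real \<Rightarrow> 'a::banach \<Rightarrow>\<^sub>L 'a"
  assumes cont: "continuous_on {0..1} A"
    and semi: "\<And>s. s \<in> {0..1} \<Longrightarrow> upper_semi_fredholm (A s)"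
    and start: "fredholm_index_0 (A 0)" and t: "t \<in> {0..1}"
  shows "fredholm_index_0 (A t)"
proof (rule connected_induction_simple[where S = "{0..1::real}" and P = "\<lambda>s. fredholm_index_0 (A s)" and a = 0])
  fix s :: real assume s: "s \<in> {0..1}"
  have "\<exists>e>0. \<forall>T T'. dist T (A s) < e \<longrightarrow> dist T' (A s) < e \<longrightarrow> fredholm_index_0 T \<longrightarrow> fredholm_index_0 T'"
  proof (cases "fredholm_index_0 (A s)")
    case True
    then show ?thesis by (metis fredholm_index_0_open)
  next
    \<comment> \<open>By closedness no operator near \<open>A s\<close> has index zero, so the
      implication holds vacuously.\<close>
    case False
    then show ?thesis by (metis fredholm_index_0_closed semi[OF s])
  qed
  then obtain e where e: "e > 0"
    "\<And>T T'. dist T (A s) < e \<Longrightarrow> dist T' (A s) < e \<Longrightarrow> fredholm_index_0 T \<Longrightarrow> fredholm_index_0 T'"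
    by blast
  let ?N = "{0..1} \<inter> A -` ball (A s) e"
  show "\<exists>T. openin (top_of_set {0..1}) T \<and> s \<in> T \<and>
      (\<forall>x\<in>T. \<forall>y\<in>T. fredholm_index_0 (A x) \<longrightarrow> fredholm_index_0 (A y))"
  proof (intro exI conjI ballI impI)
    show "openin (top_of_set {0..1}) ?N"
      by (rule continuous_openin_preimage_gen[OF cont open_ball])
    show "s \<in> ?N" using s e(1) by simp
    show "fredholm_index_0 (A y)" if "x \<in> ?N" "y \<in> ?N" "fredholm_index_0 (A x)" for x y
      by (rule e(2)[of "A x" "A y"]) (use that in \<open>auto simp: dist_commute\<close>)
  qed
qed (use start t in auto)

section \<open>Square roots modulo a closed ideal\<close>

lemma blinfun_compose_assoc: "(A o\<^sub>L B) o\<^sub>L C = A o\<^sub>L (B o\<^sub>L C)"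
  by (rule blinfun_eqI) simp

lemmas blinfun_compose_bilinear =
  bounded_bilinear.add_left[OF bounded_bilinear_blinfun_compose]
  bounded_bilinear.add_right[OF bounded_bilinear_blinfun_compose]
  bounded_bilinear.diff_left[OF bounded_bilinear_blinfun_compose]
  bounded_bilinear.diff_right[OF bounded_bilinear_blinfun_compose]
  bounded_bilinear.minus_left[OF bounded_bilinear_blinfun_compose]
  bounded_bilinear.minus_right[OF bounded_bilinear_blinfun_compose]
  bounded_bilinear.scaleR_left[OF bounded_bilinear_blinfun_compose]
  bounded_bilinear.scaleR_right[OF bounded_bilinear_blinfun_compose]

text \<open>Abstract because the continuation of roots is run twice: modulo
  \<open>approximable\<close> for the almost complex structure, and modulo the zero ideal for an
  exact root.\<close>

locale closed_ideal =
  fixes N :: "('a::banach \<Rightarrow>\<^sub>L 'a) set"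
  assumes subspace_N: "subspace N" and closed_N: "closed N"
    and compose_left: "A \<in> N \<Longrightarrow> B o\<^sub>L A \<in> N" and compose_right: "A \<in> N \<Longrightarrow> A o\<^sub>L B \<in> N"
begin

definition eqv :: "('a \<Rightarrow>\<^sub>L 'a) \<Rightarrow> ('a \<Rightarrow>\<^sub>L 'a) \<Rightarrow> bool" (infix "\<simeq>" 50) where
  "A \<simeq> B \<longleftrightarrow> A - B \<in> N"

lemma eqv_refl [simp]: "A \<simeq> A"
  by (simp add: eqv_def subspace_0[OF subspace_N])

lemma eqv_sym: "A \<simeq> B \<Longrightarrow> B \<simeq> A"
  using subspace_neg[OF subspace_N, of "A - B"] by (simp add: eqv_def)

lemma eqv_trans [trans]: "A \<simeq> B \<Longrightarrow> B \<simeq> C \<Longrightarrow> A \<simeq> C"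
  using subspace_add[OF subspace_N, of "A - B" "B - C"] by (simp add: eqv_def)

lemma eqv_add: "A \<simeq> A' \<Longrightarrow> B \<simeq> B' \<Longrightarrow> A + B \<simeq> A' + B'"
  using subspace_add[OF subspace_N, of "A - A'" "B - B'"] by (simp add: eqv_def algebra_simps)

lemma eqv_diff: "A \<simeq> A' \<Longrightarrow> B \<simeq> B' \<Longrightarrow> A - B \<simeq> A' - B'"
  using subspace_diff[OF subspace_N, of "A - A'" "B - B'"] by (simp add: eqv_def algebra_simps)

lemma eqv_scaleR: "A \<simeq> A' \<Longrightarrow> c *\<^sub>R A \<simeq> c *\<^sub>R A'"
  using subspace_scale[OF subspace_N, of "A - A'" c] by (simp add: eqv_def algebra_simps)

lemma eqv_compose: "A \<simeq> A' \<Longrightarrow> B \<simeq> B' \<Longrightarrow> A o\<^sub>L B \<simeq> A' o\<^sub>L B'"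
proof -
  assume "A \<simeq> A'" "B \<simeq> B'"
  then have "((A - A') o\<^sub>L B) + (A' o\<^sub>L (B - B')) \<in> N"
    unfolding eqv_def by (intro subspace_add[OF subspace_N] compose_left compose_right)
  then show ?thesis by (simp add: eqv_def blinfun_compose_bilinear)
qed

lemmas eqv_compose_left = eqv_compose[OF eqv_refl]
lemmas eqv_compose_right = eqv_compose[OF _ eqv_refl]

definition commutes :: "('a \<Rightarrow>\<^sub>L 'a) \<Rightarrow> ('a \<Rightarrow>\<^sub>L 'a) \<Rightarrow> bool" where
  "commutes C A \<longleftrightarrow> C o\<^sub>L A \<simeq> A o\<^sub>L C"

lemma commutes_sym: "commutes C A \<Longrightarrow> commutes A C"
  unfolding commutes_def by (rule eqv_sym)

lemma commutes_self [simp]: "commutes A A" and commutes_id [simp]: "commutes C id_blinfun"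
  by (simp_all add: commutes_def)

lemma commutes_add: "commutes C A \<Longrightarrow> commutes C B \<Longrightarrow> commutes C (A + B)"
  unfolding commutes_def blinfun_compose_bilinear by (rule eqv_add)

lemma commutes_diff: "commutes C A \<Longrightarrow> commutes C B \<Longrightarrow> commutes C (A - B)"
  unfolding commutes_def blinfun_compose_bilinear by (rule eqv_diff)

lemma commutes_scaleR: "commutes C A \<Longrightarrow> commutes C (c *\<^sub>R A)"
  unfolding commutes_def blinfun_compose_bilinear by (rule eqv_scaleR)

lemma commutes_compose:
  assumes "commutes C A" "commutes C B"
  shows "commutes C (A o\<^sub>L B)"
proof -
  have "C o\<^sub>L (A o\<^sub>L B) = (C o\<^sub>L A) o\<^sub>L B" by (simp add: blinfun_compose_assoc)
  also have "\<dots> \<simeq> (A o\<^sub>L C) o\<^sub>L B" using assms(1) unfolding commutes_def by (rule eqv_compose_right)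
  also have "(A o\<^sub>L C) o\<^sub>L B = A o\<^sub>L (C o\<^sub>L B)" by (simp add: blinfun_compose_assoc)
  also have "\<dots> \<simeq> A o\<^sub>L (B o\<^sub>L C)" using assms(2) unfolding commutes_def by (rule eqv_compose_left)
  also have "A o\<^sub>L (B o\<^sub>L C) = (A o\<^sub>L B) o\<^sub>L C" by (simp add: blinfun_compose_assoc)
  finally show ?thesis by (simp add: commutes_def)
qed

lemma commutes_inverse:
  assumes "G o\<^sub>L A \<simeq> id_blinfun" "A o\<^sub>L G \<simeq> id_blinfun" "commutes C A"
  shows "commutes C G"
proof -
  have "id_blinfun o\<^sub>L (C o\<^sub>L G) \<simeq> (G o\<^sub>L A) o\<^sub>L (C o\<^sub>L G)"
    by (rule eqv_compose_right[OF eqv_sym[OF assms(1)]])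
  also have "(G o\<^sub>L A) o\<^sub>L (C o\<^sub>L G) = G o\<^sub>L ((A o\<^sub>L C) o\<^sub>L G)" by (simp add: blinfun_compose_assoc)
  also have "\<dots> \<simeq> G o\<^sub>L ((C o\<^sub>L A) o\<^sub>L G)"
    using commutes_sym[OF assms(3)] unfolding commutes_def by (intro eqv_compose_left eqv_compose_right)
  also have "G o\<^sub>L ((C o\<^sub>L A) o\<^sub>L G) = (G o\<^sub>L C) o\<^sub>L (A o\<^sub>L G)" by (simp add: blinfun_compose_assoc)
  also have "\<dots> \<simeq> (G o\<^sub>L C) o\<^sub>L id_blinfun" by (rule eqv_compose_left[OF assms(2)])
  finally show ?thesis by (simp add: commutes_def)
qed

lemma closed_commutant: "closed {A. commutes C A}"
proof -
  have "{A. commutes C A} = (\<lambda>A. (C o\<^sub>L A) - (A o\<^sub>L C)) -` N" by (auto simp: commutes_def eqv_def)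
  moreover have "closed \<dots>"
    by (rule continuous_closed_vimage[OF closed_N]) (intro continuous_intros)
  ultimately show ?thesis by simp
qed

text \<open>Writing the root as \<open>1 + Y\<close> turns the equation into
  \<open>Y = (B - Y^2) / 2\<close>, a contraction of the ball of radius 1/2. The fixed point is
  sought inside the closed set of operators commuting with everything that commutes with
  \<open>B\<close>. The root is exact; only commutation is modulo the ideal.\<close>

lemma sqrt_id_plus:
  assumes B: "norm B \<le> 1 / 2"
  obtains U where "U o\<^sub>L U = id_blinfun + B" "\<And>C. commutes C B \<Longrightarrow> commutes C U"
proof -
  define f where "f Y = (1 / 2) *\<^sub>R (B - (Y o\<^sub>L Y))" for Y :: "'a \<Rightarrow>\<^sub>L 'a"
  define S where "S = cball 0 (1 / 2) \<inter> (\<Inter>C\<in>{C. commutes C B}. {Y. commutes C Y})"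
  have "closed S" unfolding S_def using closed_commutant by (intro closed_Int closed_cball closed_INT) auto
  then have "complete S" by (simp add: complete_eq_closed)
  moreover have "0 \<in> S" by (auto simp: S_def commutes_def)
  then have "S \<noteq> {}" by blast
  moreover have "f ` S \<subseteq> S"
  proof (rule image_subsetI)
    fix Y assume Y: "Y \<in> S"
    have "norm (f Y) \<le> 1 / 2 * (norm B + norm (Y o\<^sub>L Y))"
      unfolding f_def using norm_triangle_ineq4[of B "Y o\<^sub>L Y"] by simp
    also have "norm (Y o\<^sub>L Y) \<le> norm Y * norm Y" by (rule norm_blinfun_compose)
    also have "\<dots> \<le> 1 / 2 * (1 / 2)" using Y by (intro mult_mono) (auto simp: S_def)
    finally have "norm (f Y) \<le> 1 / 2" using B by simp
    moreover have "commutes C (f Y)" if "commutes C B" for C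
      unfolding f_def using Y that by (intro commutes_scaleR commutes_diff commutes_compose) (auto simp: S_def)
    ultimately show "f Y \<in> S" by (auto simp: S_def)
  qed
  moreover have "dist (f X) (f Y) \<le> 1 / 2 * dist X Y" if "X \<in> S" "Y \<in> S" for X Y
  proof -
    have "f X - f Y = (1 / 2) *\<^sub>R ((Y o\<^sub>L (Y - X)) + ((Y - X) o\<^sub>L X))"
      by (simp add: f_def blinfun_compose_bilinear algebra_simps)
    then have "dist (f X) (f Y) \<le> 1 / 2 * (norm (Y o\<^sub>L (Y - X)) + norm ((Y - X) o\<^sub>L X))"
      using norm_triangle_ineq[of "Y o\<^sub>L (Y - X)" "(Y - X) o\<^sub>L X"] by (simp add: dist_norm)
    also have "norm (Y o\<^sub>L (Y - X)) \<le> norm Y * dist X Y"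
      using norm_blinfun_compose[of Y "Y - X"] by (simp add: dist_norm norm_minus_commute)
    also have "\<dots> \<le> 1 / 2 * dist X Y" using that(2) by (intro mult_right_mono) (auto simp: S_def)
    also have "norm ((Y - X) o\<^sub>L X) \<le> dist X Y * norm X"
      using norm_blinfun_compose[of "Y - X" X] by (simp add: dist_norm norm_minus_commute)
    also have "\<dots> \<le> dist X Y * (1 / 2)" using that(1) by (intro mult_left_mono) (auto simp: S_def)
    finally show ?thesis by simp
  qed
  ultimately have "\<exists>!Y. Y \<in> S \<and> f Y = Y"
    by (intro Banach_fix[of S "1 / 2" f]) auto
  then obtain Y where Y: "Y \<in> S" "f Y = Y" by blast
  have "2 *\<^sub>R f Y = B - (Y o\<^sub>L Y)" by (simp add: f_def)
  then have "B - (Y o\<^sub>L Y) = 2 *\<^sub>R Y" using Y(2) by simp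
  then have "(id_blinfun + Y) o\<^sub>L (id_blinfun + Y) = id_blinfun + B"
    by (simp add: blinfun_compose_bilinear algebra_simps scaleR_2)
  moreover have "commutes C (id_blinfun + Y)" if "commutes C B" for C
    using Y(1) that by (intro commutes_add) (auto simp: S_def)
  ultimately show thesis using that by blast
qed

text \<open>The second clause puts \<open>R\<close> into the bicommutant of \<open>T\<close> modulo
  the ideal. Any two operators there commute, so a root may be multiplied by the root of a
  correction factor.\<close>

definition has_sqrt :: "('a \<Rightarrow>\<^sub>L 'a) \<Rightarrow> ('a \<Rightarrow>\<^sub>L 'a) \<Rightarrow> bool" where
  "has_sqrt T A \<longleftrightarrow> (\<exists>R. R o\<^sub>L R \<simeq> A \<and> (\<forall>C. commutes C T \<longrightarrow> commutes C R))"

text \<open>Modulo the ideal \<open>A + E\<close> is \<open>A (1 + G E)\<close>, and the product of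
  the roots of both factors is a root because these commute.\<close>

lemma has_sqrt_step:
  assumes A: "has_sqrt T A" and G: "A o\<^sub>L G \<simeq> id_blinfun"
    and cG: "\<And>C. commutes C T \<Longrightarrow> commutes C G" and cE: "\<And>C. commutes C T \<Longrightarrow> commutes C E"
    and small: "norm (G o\<^sub>L E) \<le> 1 / 2"
  shows "has_sqrt T (A + E)"
proof -
  obtain R where R: "R o\<^sub>L R \<simeq> A" "\<And>C. commutes C T \<Longrightarrow> commutes C R"
    using A unfolding has_sqrt_def by blast
  obtain U where U: "U o\<^sub>L U = id_blinfun + (G o\<^sub>L E)" "\<And>C. commutes C (G o\<^sub>L E) \<Longrightarrow> commutes C U"
    using sqrt_id_plus[OF small] by blast
  have cU: "commutes C U" if "commutes C T" for C
    by (intro U(2) commutes_compose cG cE that)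
  \<comment> \<open>\<open>R\<close> commutes with \<open>T\<close> because \<open>T\<close>
    commutes with itself; hence \<open>U\<close> commutes with \<open>R\<close>.\<close>
  have UR: "commutes U R" by (intro commutes_sym[OF cU] commutes_sym[OF R(2)]) simp
  have "(R o\<^sub>L U) o\<^sub>L (R o\<^sub>L U) = R o\<^sub>L ((U o\<^sub>L R) o\<^sub>L U)" by (simp add: blinfun_compose_assoc)
  also have "\<dots> \<simeq> R o\<^sub>L ((R o\<^sub>L U) o\<^sub>L U)"
    using UR unfolding commutes_def by (intro eqv_compose_left eqv_compose_right)
  also have "R o\<^sub>L ((R o\<^sub>L U) o\<^sub>L U) = (R o\<^sub>L R) o\<^sub>L (id_blinfun + (G o\<^sub>L E))"
    by (simp add: blinfun_compose_assoc U(1))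
  also have "\<dots> \<simeq> A o\<^sub>L (id_blinfun + (G o\<^sub>L E))" by (rule eqv_compose_right[OF R(1)])
  also have "A o\<^sub>L (id_blinfun + (G o\<^sub>L E)) = A + ((A o\<^sub>L G) o\<^sub>L E)"
    by (simp add: blinfun_compose_bilinear blinfun_compose_assoc)
  also have "\<dots> \<simeq> A + (id_blinfun o\<^sub>L E)" by (intro eqv_add eqv_compose_right G eqv_refl)
  finally have "(R o\<^sub>L U) o\<^sub>L (R o\<^sub>L U) \<simeq> A + E" by simp
  then show ?thesis unfolding has_sqrt_def using commutes_compose R(2) cU by blast
qed

proposition has_sqrt_path:
  fixes A :: "real \<Rightarrow> 'a \<Rightarrow>\<^sub>L 'a"
  assumes cont: "continuous_on {0..1} A"
    and comm: "\<And>s C. s \<in> {0..1} \<Longrightarrow> commutes C T \<Longrightarrow> commutes C (A s)"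
    and inv: "\<And>s. s \<in> {0..1} \<Longrightarrow> \<exists>G. G o\<^sub>L A s \<simeq> id_blinfun \<and> A s o\<^sub>L G \<simeq> id_blinfun"
    and start: "has_sqrt T (A 0)"
  shows "has_sqrt T (A 1)"
proof (rule connected_induction_simple[where S = "{0..1::real}" and P = "\<lambda>s. has_sqrt T (A s)" and a = 0])
  fix s :: real assume s: "s \<in> {0..1}"
  obtain G where G: "G o\<^sub>L A s \<simeq> id_blinfun" "A s o\<^sub>L G \<simeq> id_blinfun" using inv[OF s] by blast
  have cG: "commutes C G" if "commutes C T" for C
    by (rule commutes_inverse[OF G comm[OF s that]])
  \<comment> \<open>Chosen so that \<open>norm H \<le> 1 / 8\<close> below, hence
    \<open>norm V \<le> 2\<close>, and the correction is at most
    \<open>2 norm G * 2 e \<le> 1 / 2\<close>, the radius allowed for a root.\<close>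
  define e where "e = 1 / (8 * (norm G + 1))"
  have e: "e > 0" by (simp add: e_def add_nonneg_pos)
  have eG: "e * norm G \<le> 1 / 8" 
  proof -
    have "e * norm G = (1 / 8) * (norm G / (norm G + 1))" by (simp add: e_def mult.commute)
    also have "\<dots> \<le> (1 / 8) * 1"
      by (rule mult_left_mono) (simp_all add: pos_divide_le_eq add_nonneg_pos)
    finally show ?thesis by simp
  qed
  let ?N = "{0..1} \<inter> A -` ball (A s) e"
  show "\<exists>T'. openin (top_of_set {0..1}) T' \<and> s \<in> T' \<and>
      (\<forall>x\<in>T'. \<forall>y\<in>T'. has_sqrt T (A x) \<longrightarrow> has_sqrt T (A y))"
  proof (intro exI conjI ballI impI)
    show "openin (top_of_set {0..1}) ?N"
      by (rule continuous_openin_preimage_gen[OF cont open_ball])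
    show "s \<in> ?N" using s e by simp
    fix x y assume x: "x \<in> ?N" and y: "y \<in> ?N" and sqrt: "has_sqrt T (A x)"
    \<comment> \<open>A root must pass between any two points near \<open>s\<close>, so the inverse
      \<open>G\<close> at \<open>s\<close> is corrected to the inverse \<open>G V\<close> at
      \<open>x\<close>, with \<open>V\<close> the exact inverse of \<open>1 + H\<close>.\<close>
    define H where "H = (A x - A s) o\<^sub>L G"
    have "norm H \<le> norm (A x - A s) * norm G" unfolding H_def by (rule norm_blinfun_compose)
    also have "\<dots> \<le> e * norm G" using x by (intro mult_right_mono) (auto simp: dist_norm norm_minus_commute)
    finally have H: "norm H \<le> 1 / 8" using eG by simp
    then obtain V where V: "(id_blinfun + H) o\<^sub>L V = id_blinfun" "V o\<^sub>L (id_blinfun + H) = id_blinfun"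
      "norm V \<le> 1 / (1 - norm H)"
      using id_plus_inverse[of H] by auto
    have "1 / (1 - norm H) \<le> 2" using H by (simp add: field_simps)
    then have nV: "norm V \<le> 2" using V(3) by simp
    have "A x o\<^sub>L (G o\<^sub>L V) = ((A s o\<^sub>L G) + H) o\<^sub>L V"
      by (simp add: H_def blinfun_compose_bilinear blinfun_compose_assoc)
    also have "\<dots> \<simeq> (id_blinfun + H) o\<^sub>L V" by (intro eqv_compose_right eqv_add G(2) eqv_refl)
    finally have AG: "A x o\<^sub>L (G o\<^sub>L V) \<simeq> id_blinfun" by (simp add: V(1))
    have cE: "commutes C (A y - A x)" if "commutes C T" for C
      using x y that by (intro commutes_diff comm) auto
    have cV: "commutes C V" if C: "commutes C T" for C
    proof (rule commutes_inverse)
      show "commutes C (id_blinfun + H)"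
        unfolding H_def using x s C by (intro commutes_add commutes_compose commutes_diff comm cG) auto
    qed (simp_all add: V)
    have "norm ((G o\<^sub>L V) o\<^sub>L (A y - A x)) \<le> norm (G o\<^sub>L V) * norm (A y - A x)"
      by (rule norm_blinfun_compose)
    also have "\<dots> \<le> (norm G * 2) * (2 * e)"
    proof (rule mult_mono)
      show "norm (G o\<^sub>L V) \<le> norm G * 2"
        by (rule order_trans[OF norm_blinfun_compose]) (use nV in \<open>simp add: mult_left_mono\<close>)
      show "norm (A y - A x) \<le> 2 * e"
        using x y dist_triangle_less_add[of "A y" "A s" e "A x" e]
        by (simp add: dist_norm[symmetric] dist_commute)
    qed auto
    also have "\<dots> \<le> 1 / 2" using eG by (simp add: mult_ac)
    finally have "norm ((G o\<^sub>L V) o\<^sub>L (A y - A x)) \<le> 1 / 2" .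
    from has_sqrt_step[OF sqrt AG commutes_compose[OF cG cV] cE this]
    show "has_sqrt T (A y)" by simp
  qed
qed (use start in auto)

end

section \<open>Almost complex structures\<close>

text \<open>The least closed ideal containing the finite-rank operators. It consists of compact
  operators but need not contain all of them.\<close>

definition approximable :: "('a::real_normed_vector \<Rightarrow>\<^sub>L 'a) set" where
  "approximable = closure {K. finite_rank K}"

lemma finite_rank_approximable: "finite_rank K \<Longrightarrow> K \<in> approximable"
  unfolding approximable_def by (rule subsetD[OF closure_subset]) simp

lemma approximable_decompose:
  assumes "K \<in> approximable" "\<epsilon> > 0"
  obtains F where "finite_rank F" "norm (K - F) < \<epsilon>"
proof -
  obtain F where "finite_rank F" "dist F K < \<epsilon>"
    using assms unfolding approximable_def closure_approachable by blast
  then show thesis by (intro that[of F]) (simp_all add: dist_norm norm_minus_commute)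
qed

interpretation approximable: closed_ideal "approximable :: ('a::banach \<Rightarrow>\<^sub>L 'a) set"
proof
  have "subspace {K :: 'a \<Rightarrow>\<^sub>L 'a. finite_rank K}"
    unfolding subspace_def by (auto intro: finite_rank.zero finite_rank_add finite_rank_scaleR)
  then show "subspace (approximable :: ('a \<Rightarrow>\<^sub>L 'a) set)"
    unfolding approximable_def by (rule subspace_closure)
  show "closed (approximable :: ('a \<Rightarrow>\<^sub>L 'a) set)" by (simp add: approximable_def)
  fix A B :: "'a \<Rightarrow>\<^sub>L 'a"
  assume "A \<in> approximable"
  then obtain K where K: "\<And>n. finite_rank (K n)" "K \<longlonglongrightarrow> A"
    unfolding approximable_def closure_sequential by auto
  have lim: "(\<lambda>n. B o\<^sub>L K n) \<longlonglongrightarrow> (B o\<^sub>L A)" "(\<lambda>n. K n o\<^sub>L B) \<longlonglongrightarrow> (A o\<^sub>L B)"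
    by (intro tendsto_intros K)+
  show "B o\<^sub>L A \<in> approximable"
    unfolding approximable_def closure_sequential
    by (rule exI[of _ "\<lambda>n. B o\<^sub>L K n"]) (simp add: finite_rank_compose_left K(1) lim)
  show "A o\<^sub>L B \<in> approximable"
    unfolding approximable_def closure_sequential
    by (rule exI[of _ "\<lambda>n. K n o\<^sub>L B"]) (simp add: finite_rank_compose_right K(1) lim)
qed

interpretation zero_ideal: closed_ideal "{0 :: 'a::banach \<Rightarrow>\<^sub>L 'a}"
  by standard auto

lemma zero_ideal_commutes: "zero_ideal.commutes C A \<longleftrightarrow> C o\<^sub>L A = A o\<^sub>L C"
  by (simp add: zero_ideal.commutes_def zero_ideal.eqv_def)

text \<open>The inverse of \<open>T + K\<close> inverts \<open>T\<close> up to finite rank, so index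
  zero supplies the inverses modulo the ideal that continuation of roots requires.\<close>

lemma fredholm_index_0_parametrix:
  fixes T :: "'a::banach \<Rightarrow>\<^sub>L 'a"
  assumes "fredholm_index_0 T"
  obtains G where "approximable.eqv (G o\<^sub>L T) id_blinfun" "approximable.eqv (T o\<^sub>L G) id_blinfun"
proof -
  obtain K G where K: "finite_rank K" and G: "G o\<^sub>L (T + K) = id_blinfun" "(T + K) o\<^sub>L G = id_blinfun"
    using assms unfolding fredholm_index_0_def invertible_blinfun_def by blast
  have "(G o\<^sub>L T) - id_blinfun = - (G o\<^sub>L K)" "(T o\<^sub>L G) - id_blinfun = - (K o\<^sub>L G)"
    unfolding G(1)[symmetric] by (simp_all add: blinfun_compose_bilinear)
      (metis G add_diff_cancel_left' blinfun_compose_bilinear(1,2) minus_diff_eq)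
  then show thesis
    using that[of G] K unfolding approximable.eqv_def
    by (metis finite_rank_approximable finite_rank_compose_left finite_rank_compose_right finite_rank_uminus)
qed

lemma fredholm_index_0_upper_semi_fredholm:
  assumes "fredholm_index_0 T"
  shows "upper_semi_fredholm T"
proof -
  obtain K G where K: "finite_rank K" and G: "G o\<^sub>L (T + K) = id_blinfun"
    using assms unfolding fredholm_index_0_def invertible_blinfun_def by blast
  have "upper_semi_fredholm (T + K)"
    by (rule upper_semi_fredholm_compose_cancel[of G]) (simp add: G upper_semi_fredholm_id)
  from upper_semi_fredholm_finite_rank[OF this finite_rank_uminus[OF K]] show ?thesis by simp
qed

lemma fredholm_index_0_inj_invertible:
  fixes T :: "'a::banach \<Rightarrow>\<^sub>L 'a"
  assumes T: "fredholm_index_0 T" and inj: "inj (blinfun_apply T)"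
  shows "invertible_blinfun T"
proof -
  obtain c where "c > 0" "\<And>x. c * norm x \<le> norm (blinfun_apply T x)"
    using upper_semi_fredholm_inj_bounded_below[OF fredholm_index_0_upper_semi_fredholm[OF T] inj]
    unfolding bounded_below_on_def by blast
  moreover have "surj (blinfun_apply T)" using fredholm_index_0_inj_iff_surj[OF T] inj by blast
  ultimately show ?thesis unfolding invertible_blinfun_def by (metis bounded_below_surj_inverse)
qed

lemma fredholm_index_0_id_plus_approximable:
  fixes K :: "'a::banach \<Rightarrow>\<^sub>L 'a"
  assumes "K \<in> approximable"
  shows "fredholm_index_0 (id_blinfun + K)"
proof -
  obtain F where F: "finite_rank F" "norm (K - F) < 1"
    using approximable_decompose[OF assms, of 1] by auto
  have "fredholm_index_0 ((id_blinfun + (K - F)) + F)"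
    by (intro fredholm_index_0_add_finite_rank invertible_fredholm_index_0 invertible_id_plus F)
  then show ?thesis by simp
qed

section \<open>Compactness of approximable operators\<close>

lemma finite_rank_ball_compact:
  fixes F :: "'a::real_normed_vector \<Rightarrow>\<^sub>L 'b::real_normed_vector"
  assumes "finite_rank F"
  obtains S where "compact S" "blinfun_apply F ` cball 0 1 \<subseteq> S"
proof -
  have "\<exists>S. compact S \<and> blinfun_apply F ` cball 0 1 \<subseteq> S" using assms
  proof (induction rule: finite_rank.induct)
    case zero
    show ?case by (intro exI[of _ "{0}"]) auto
  next
    case (add_rank_one F f w)
    then obtain S where S: "compact S" "blinfun_apply F ` cball 0 1 \<subseteq> S" by blast
    let ?R = "(\<lambda>a. a *\<^sub>R w) ` {- norm f .. norm f}"
    have "compact ?R" by (intro compact_continuous_image continuous_intros) auto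
    then have "compact {x + y | x y. x \<in> S \<and> y \<in> ?R}" by (rule compact_sums[OF S(1)])
    moreover have "blinfun_apply (F + rank_one f w) x \<in> {x + y | x y. x \<in> S \<and> y \<in> ?R}" if "x \<in> cball 0 1" for x
    proof -
      have "\<bar>blinfun_apply f x\<bar> \<le> norm f * norm x" using norm_blinfun[of f x] by simp
      also have "\<dots> \<le> norm f" using that by (simp add: mult_left_le)
      finally have "blinfun_apply f x *\<^sub>R w \<in> ?R" by (intro imageI) (simp add: abs_le_iff)
      moreover have "blinfun_apply F x \<in> S" using S(2) that by blast
      ultimately show ?thesis by (auto simp only: blinfun.add_left rank_one_apply)
    qed
    ultimately show ?case by blast
  qed
  then show thesis using that by blast
qed

text \<open>The image of the unit ball has a finite net, and a net point serves at most one member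
  of a separated family. The bound does not depend on the family, so it limits the length of the
  triangular flags below.\<close>

lemma approximable_separated_bound:
  fixes K :: "'a::banach \<Rightarrow>\<^sub>L 'a"
  assumes "K \<in> approximable"
  obtains M where "\<And>k v. (\<And>i. i < k \<Longrightarrow> norm (v i) \<le> 1) \<Longrightarrow>
    (\<And>i j. i < j \<Longrightarrow> j < k \<Longrightarrow> 1 / 2 \<le> norm (blinfun_apply K (v j) - blinfun_apply K (v i))) \<Longrightarrow> k \<le> (M :: nat)"
proof -
  obtain F where F: "finite_rank F" "norm (K - F) < 1 / 16"
    using approximable_decompose[OF assms, of "1 / 16"] by auto
  obtain S where S: "compact S" "blinfun_apply F ` cball 0 1 \<subseteq> S"
    using finite_rank_ball_compact[OF F(1)] .
  obtain Z where Z: "finite Z" "S \<subseteq> (\<Union>z\<in>Z. ball z (1 / 16))"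
  proof (rule compactE_image[OF S(1), of S "\<lambda>z. ball z (1 / 16)"])
    show "S \<subseteq> (\<Union>z\<in>S. ball z (1 / 16))" using centre_in_ball[of _ "1 / 16"] by auto
  qed auto
  have "k \<le> card Z"
    if v: "\<And>i. i < k \<Longrightarrow> norm (v i) \<le> 1"
      and sep: "\<And>i j. i < j \<Longrightarrow> j < k \<Longrightarrow> 1 / 2 \<le> norm (blinfun_apply K (v j) - blinfun_apply K (v i))"
    for k v
  proof -
    have "\<exists>z\<in>Z. dist z (blinfun_apply F (v i)) < 1 / 16" if "i < k" for i
    proof -
      have "blinfun_apply F (v i) \<in> S" using S(2) v[OF that] by auto
      then show ?thesis using Z(2) by (meson UN_E mem_ball subsetD)
    qed
    then obtain c where c: "\<And>i. i < k \<Longrightarrow> c i \<in> Z" "\<And>i. i < k \<Longrightarrow> dist (c i) (blinfun_apply F (v i)) < 1 / 16"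
      by metis
    \<comment> \<open>1/16 from replacing \<open>K\<close> by \<open>F\<close> and 1/16 from the
      net; two vectors sharing a net point would have images less than 1/4 apart.\<close>
    have close: "norm (blinfun_apply K (v i) - c i) < 1 / 8" if "i < k" for i
    proof -
      have "norm (blinfun_apply (K - F) (v i)) \<le> norm (K - F) * norm (v i)" by (rule norm_blinfun)
      also have "\<dots> \<le> norm (K - F) * 1" by (rule mult_left_mono[OF v[OF that]]) simp
      also have "\<dots> < 1 / 16" using F(2) by simp
      finally have "norm (blinfun_apply (K - F) (v i)) < 1 / 16" .
      moreover have eq: "blinfun_apply K (v i) - c i = blinfun_apply (K - F) (v i) + (blinfun_apply F (v i) - c i)"
        by (simp add: blinfun.diff_left)
      have "norm (blinfun_apply K (v i) - c i)
          \<le> norm (blinfun_apply (K - F) (v i)) + norm (blinfun_apply F (v i) - c i)"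
        unfolding eq by (rule norm_triangle_ineq)
      moreover have "norm (blinfun_apply F (v i) - c i) < 1 / 16"
        using c(2)[OF that] by (simp add: dist_norm norm_minus_commute)
      ultimately show ?thesis by linarith
    qed
    have ne: "c i \<noteq> c j" if "i < j" "j < k" for i j
    proof
      assume eq: "c i = c j"
      have "norm (blinfun_apply K (v j) - blinfun_apply K (v i))
          \<le> norm (blinfun_apply K (v j) - c j) + norm (blinfun_apply K (v i) - c i)"
        using norm_triangle_ineq4[of "blinfun_apply K (v j) - c j" "blinfun_apply K (v i) - c i"] eq by simp
      then show False using close[of i] close[of j] sep[OF that] that by simp
    qed
    have "inj_on c {..<k}"
      by (rule inj_onI) (metis ne lessThan_iff nat_neq_iff)
    then have "card {..<k} \<le> card Z"
      using c(1) Z(1) by (intro card_inj_on_le[of c]) auto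
    then show ?thesis by simp
  qed
  then show thesis using that by blast
qed

text \<open>All operators on the two segments have the form \<open>a + b T\<close> with
  \<open>a\<close>, \<open>b\<close> not both zero, that is, a nonzero multiple of the identity or
  of some \<open>T - c\<close>. The root 1 of \<open>A 0 = 1\<close> is thereby continued to a root
  of \<open>B 1 = - 1\<close>.\<close>

proposition almost_complex_structure:
  fixes T :: "'a::banach \<Rightarrow>\<^sub>L 'a"
  assumes T: "\<And>c. upper_semi_fredholm (T - c *\<^sub>R id_blinfun)"
  obtains I :: "'a \<Rightarrow>\<^sub>L 'a" where "(I o\<^sub>L I) + id_blinfun \<in> approximable"
proof -
  have semi: "upper_semi_fredholm (a *\<^sub>R id_blinfun + b *\<^sub>R T)" if "a \<noteq> 0 \<or> b \<noteq> 0" for a b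
  proof (cases "b = 0")
    case True
    then show ?thesis using that upper_semi_fredholm_scaleR[OF upper_semi_fredholm_id, of a] by simp
  next
    case False
    have "a *\<^sub>R id_blinfun + b *\<^sub>R T = b *\<^sub>R (T - (- a / b) *\<^sub>R id_blinfun)"
      using False by (simp add: scaleR_add_right)
    then show ?thesis using upper_semi_fredholm_scaleR[OF T False] by metis
  qed
  define A B :: "real \<Rightarrow> 'a \<Rightarrow>\<^sub>L 'a" where "A s = (1 - s) *\<^sub>R id_blinfun + s *\<^sub>R T"
    and "B s = (- s) *\<^sub>R id_blinfun + (1 - s) *\<^sub>R T" for s
  have cont: "continuous_on {0..1} A" "continuous_on {0..1} B"
    unfolding A_def B_def by (intro continuous_intros)+
  have A: "fredholm_index_0 (A s)" if "s \<in> {0..1}" for s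
  proof (rule fredholm_index_0_path[OF cont(1) _ _ that])
    show "upper_semi_fredholm (A s)" if "s \<in> {0..1}" for s
      unfolding A_def by (rule semi) auto
    show "fredholm_index_0 (A 0)"
      by (rule invertible_fredholm_index_0) (auto simp: A_def invertible_blinfun_def)
  qed
  have B: "fredholm_index_0 (B s)" if "s \<in> {0..1}" for s
  proof (rule fredholm_index_0_path[OF cont(2) _ _ that])
    show "upper_semi_fredholm (B s)" if "s \<in> {0..1}" for s
      unfolding B_def by (rule semi) auto
    show "fredholm_index_0 (B 0)" using A[of 1] by (simp add: A_def B_def)
  qed
  have "approximable.has_sqrt T (A 1)"
  proof (rule approximable.has_sqrt_path[OF cont(1)])
    show "approximable.commutes C (A s)" if "approximable.commutes C T" for s C
      unfolding A_def by (intro approximable.commutes_add approximable.commutes_scaleR that) simp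
    show "\<exists>G. approximable.eqv (G o\<^sub>L A s) id_blinfun \<and> approximable.eqv (A s o\<^sub>L G) id_blinfun"
      if "s \<in> {0..1}" for s using fredholm_index_0_parametrix[OF A[OF that]] by blast
    show "approximable.has_sqrt T (A 0)"
      unfolding approximable.has_sqrt_def by (intro exI[of _ id_blinfun]) (simp add: A_def)
  qed
  then have start: "approximable.has_sqrt T (B 0)" by (simp add: A_def B_def)
  have "approximable.has_sqrt T (B 1)"
  proof (rule approximable.has_sqrt_path[OF cont(2) _ _ start])
    show "approximable.commutes C (B s)" if "approximable.commutes C T" for s C
      unfolding B_def by (intro approximable.commutes_add approximable.commutes_scaleR that) simp
    show "\<exists>G. approximable.eqv (G o\<^sub>L B s) id_blinfun \<and> approximable.eqv (B s o\<^sub>L G) id_blinfun"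
      if "s \<in> {0..1}" for s using fredholm_index_0_parametrix[OF B[OF that]] by blast
  qed
  then obtain R where "approximable.eqv (R o\<^sub>L R) (B 1)" unfolding approximable.has_sqrt_def by blast
  then show thesis by (intro that[of R]) (simp add: approximable.eqv_def B_def)
qed

section \<open>Complex structures in finite codimension\<close>

definition biorthogonal :: "nat \<Rightarrow> (nat \<Rightarrow> 'a::real_normed_vector) \<Rightarrow> (nat \<Rightarrow> 'a \<Rightarrow>\<^sub>L real) \<Rightarrow> bool" where
  "biorthogonal k w f \<longleftrightarrow> (\<forall>i<k. \<forall>j<k. blinfun_apply (f i) (w j) = (if i = j then 1 else 0))"

definition biorthogonal_projection :: "nat \<Rightarrow> (nat \<Rightarrow> 'a::real_normed_vector) \<Rightarrow> (nat \<Rightarrow> 'a \<Rightarrow>\<^sub>L real) \<Rightarrow> 'a \<Rightarrow>\<^sub>L 'a" where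
  "biorthogonal_projection k w f = (\<Sum>i<k. rank_one (f i) (w i))"

lemma biorthogonal_projection_apply:
  "blinfun_apply (biorthogonal_projection k w f) x = (\<Sum>i<k. blinfun_apply (f i) x *\<^sub>R w i)"
  by (simp add: biorthogonal_projection_def blinfun.sum_left)

lemma finite_rank_biorthogonal_projection: "finite_rank (biorthogonal_projection k w f)"
  unfolding biorthogonal_projection_def
  by (induction k) (auto intro: finite_rank.zero finite_rank_add finite_rank_rank_one)

lemma biorthogonal_mono: "biorthogonal k w f \<Longrightarrow> j \<le> k \<Longrightarrow> biorthogonal j w f"
  by (simp add: biorthogonal_def)

lemma biorthogonal_projection_range:
  "blinfun_apply (biorthogonal_projection k w f) x \<in> span (w ` {..<k})"
  unfolding biorthogonal_projection_apply by (intro span_sum span_scale span_base) auto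

lemma biorthogonal_functional_projection:
  assumes "biorthogonal k w f" "i < k"
  shows "blinfun_apply (f i) (blinfun_apply (biorthogonal_projection k w f) x) = blinfun_apply (f i) x"
proof -
  have "(\<Sum>j<k. blinfun_apply (f j) x * blinfun_apply (f i) (w j)) = (\<Sum>j<k. if j = i then blinfun_apply (f i) x else 0)"
    by (rule sum.cong) (use assms in \<open>auto simp: biorthogonal_def\<close>)
  then show ?thesis
    using assms(2) by (simp add: biorthogonal_projection_apply blinfun.sum_right blinfun.scaleR_right)
qed

lemma biorthogonal_projection_span:
  assumes w: "biorthogonal k w f" and x: "x \<in> span (w ` {..<k})"
  shows "blinfun_apply (biorthogonal_projection k w f) x = x"
proof (rule linear_eq_on[OF _ _ x])
  show "linear (blinfun_apply (biorthogonal_projection k w f))"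
    using blinfun.bounded_linear_right bounded_linear.linear by blast
  show "linear (\<lambda>x :: 'a. x)" by (rule linear_ident)
  fix b assume "b \<in> w ` {..<k}"
  then obtain j where j: "j < k" "b = w j" by blast
  have "(\<Sum>i<k. blinfun_apply (f i) (w j) *\<^sub>R w i) = (\<Sum>i<k. if i = j then w j else 0)"
    by (rule sum.cong) (use w j in \<open>auto simp: biorthogonal_def\<close>)
  then show "blinfun_apply (biorthogonal_projection k w f) b = b"
    using j by (simp add: biorthogonal_projection_apply)
qed

text \<open>A functional norming \<open>v\<close>, composed with the complementary projection and
  rescaled, kills the old vectors and is 1 at \<open>v\<close>.\<close>

lemma biorthogonal_extend:
  assumes w: "biorthogonal k w f" and v: "v \<noteq> 0" "blinfun_apply (biorthogonal_projection k w f) v = 0"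
  obtains g where "biorthogonal (Suc k) (w(k := v)) (f(k := g))"
proof -
  define Q where "Q = biorthogonal_projection k w f"
  obtain h :: "'a \<Rightarrow>\<^sub>L real" where h: "blinfun_apply h v = norm v"
    using norming_functional by blast
  define g where "g = (1 / norm v) *\<^sub>R (h o\<^sub>L (id_blinfun - Q))"
  have "blinfun_apply g v = 1" using v h by (simp add: g_def Q_def blinfun.scaleR_left blinfun.diff_left)
  moreover have "blinfun_apply g (w j) = 0" if "j < k" for j
  proof -
    have "blinfun_apply Q (w j) = w j"
      unfolding Q_def by (rule biorthogonal_projection_span[OF w]) (use that in \<open>auto intro: span_base\<close>)
    then show ?thesis by (simp add: g_def blinfun.scaleR_left blinfun.diff_left)
  qed
  moreover have "blinfun_apply (f i) v = 0" if "i < k" for i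
    using biorthogonal_functional_projection[OF w that, of v] v(2) by simp
  ultimately have "biorthogonal (Suc k) (w(k := v)) (f(k := g))"
    using w by (auto simp: biorthogonal_def less_Suc_eq)
  then show thesis using that by blast
qed

text \<open>The matrix of \<open>I\<close> on the span is upper triangular with real diagonal
  entries \<open>t\<close>. Eigenvectors modulo the previous span are allowed so that a maximal flag
  also captures generalized eigenvectors.\<close>

definition triangular_flag :: "('a::real_normed_vector \<Rightarrow>\<^sub>L 'a) \<Rightarrow> nat \<Rightarrow> (nat \<Rightarrow> 'a) \<Rightarrow> bool" where
  "triangular_flag I k w \<longleftrightarrow>
     (\<forall>j<k. \<exists>t. blinfun_apply I (w j) - t *\<^sub>R w j \<in> span (w ` {..<j}))"

lemma triangular_flag_invariant:
  assumes I: "triangular_flag I k w" and j: "j \<le> k" and x: "x \<in> span (w ` {..<j})"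
  shows "blinfun_apply I x \<in> span (w ` {..<j})"
  using x
proof (induction rule: span_induct_alt)
  case base
  show ?case by (simp add: span_zero)
next
  case (step c u y)
  then obtain i where i: "i < j" "u = w i" by blast
  then have "i < k" using j by simp
  then obtain t where "blinfun_apply I u - t *\<^sub>R u \<in> span (w ` {..<i})"
    using I i(2) unfolding triangular_flag_def by blast
  moreover have "span (w ` {..<i}) \<subseteq> span (w ` {..<j})" using i by (intro span_mono) auto
  moreover have "u \<in> span (w ` {..<j})" using i by (auto intro: span_base)
  ultimately have "blinfun_apply I u \<in> span (w ` {..<j})"
    by (metis diff_add_cancel span_add span_scale subsetD)
  then show ?case using step.IH by (simp add: blinfun.add_right blinfun.scaleR_right span_add span_scale)
qed

text \<open>Riesz's argument: \<open>v j\<close> is a unit vector at distance at least 1/2 from the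
  previous span, and modulo that span \<open>K\<close> multiplies it by \<open>1 + t^2\<close>.
  Since \<open>t\<close> is real this factor is at least 1, so the images stay separated.\<close>

lemma triangular_flag_separated:
  assumes w: "biorthogonal k w f" and I: "triangular_flag I k w" and K: "K = (I o\<^sub>L I) + id_blinfun"
  obtains v where "\<And>j. j < k \<Longrightarrow> norm (v j) \<le> 1"
    "\<And>i j. i < j \<Longrightarrow> j < k \<Longrightarrow> 1 / 2 \<le> norm (blinfun_apply K (v j) - blinfun_apply K (v i))"
proof -
  define W where "W j = span (w ` {..<j})" for j
  have inv: "blinfun_apply I x \<in> W j" if "j \<le> k" "x \<in> W j" for x j
    using triangular_flag_invariant[OF I that(1)] that(2) by (simp add: W_def)
  have mono: "W i \<subseteq> W j" if "i \<le> j" for i j using that unfolding W_def by (intro span_mono) auto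
  have sub: "subspace (W j)" for j by (simp add: W_def)
  have "\<exists>v t. v \<in> W (Suc j) \<and> norm v = 1 \<and> (\<forall>u\<in>W j. 1 / 2 \<le> norm (v - u)) \<and>
      blinfun_apply I v - t *\<^sub>R v \<in> W j" if j: "j < k" for j
  proof -
    have zero: "blinfun_apply (f j) u = 0" if "u \<in> W j" for u
    proof -
      have "u = blinfun_apply (biorthogonal_projection j w f) u"
        using biorthogonal_projection_span[OF biorthogonal_mono[OF w]] that j by (simp add: W_def)
      also have "blinfun_apply (f j) \<dots> = 0"
        using w j by (simp add: biorthogonal_projection_apply blinfun.sum_right blinfun.scaleR_right biorthogonal_def)
      finally show ?thesis .
    qed
    have one: "blinfun_apply (f j) (w j) = 1" using w j by (simp add: biorthogonal_def)
    then have pos: "norm (f j) > 0" by auto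
    define d where "d = infdist (w j) (W j)"
    have ne: "W j \<noteq> {}" using subspace_0[OF sub] by blast
    have "1 / norm (f j) \<le> d"
      unfolding d_def infdist_notempty[OF ne]
    proof (rule cINF_greatest[OF ne])
      fix u assume "u \<in> W j"
      then have "1 = blinfun_apply (f j) (w j - u)" by (simp add: blinfun.diff_right one zero)
      also have "\<dots> \<le> norm (f j) * norm (w j - u)" using norm_blinfun[of "f j" "w j - u"] by simp
      finally show "1 / norm (f j) \<le> dist (w j) u" using pos by (simp add: dist_norm field_simps)
    qed
    then have d: "d > 0" using pos by (meson divide_pos_pos less_le_trans zero_less_one)
    \<comment> \<open>A best approximation up to the factor 2, which becomes the constant 1/2 after
      normalizing.\<close>
    have "\<exists>u\<in>W j. dist (w j) u < 2 * d"
    proof -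
      have "(INF u\<in>W j. dist (w j) u) < 2 * d" using d by (simp add: d_def infdist_notempty[OF ne])
      then show ?thesis by (subst (asm) cINF_less_iff) (auto simp: ne intro: bdd_belowI2[of _ 0])
    qed
    then obtain u where u: "u \<in> W j" "norm (w j - u) < 2 * d" by (auto simp: dist_norm)
    define r where "r = norm (w j - u)"
    have far: "d \<le> norm (w j - u')" if "u' \<in> W j" for u'
      using infdist_le[OF that, of "w j"] by (simp add: d_def dist_norm)
    have r: "r > 0" unfolding r_def using far[OF u(1)] d by linarith
    define v where "v = (1 / r) *\<^sub>R (w j - u)"
    obtain t where t: "blinfun_apply I (w j) - t *\<^sub>R w j \<in> W j"
      using I j by (auto simp: triangular_flag_def W_def)
    have "w j \<in> W (Suc j)" by (auto simp: W_def intro: span_base)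
    then have "v \<in> W (Suc j)"
      unfolding v_def using u(1) mono[of j "Suc j"] by (intro subspace_scale subspace_diff sub) auto
    moreover have "norm v = 1" using r by (simp add: v_def r_def)
    moreover have "1 / 2 \<le> norm (v - u')" if "u' \<in> W j" for u'
    proof -
      have "w j - (u + r *\<^sub>R u') = r *\<^sub>R (v - u')" using r by (simp add: v_def scaleR_diff_right)
      then have "d \<le> r * norm (v - u')"
        using far[of "u + r *\<^sub>R u'"] u(1) that r by (simp add: subspace_add[OF sub] subspace_scale[OF sub])
      moreover have "r / 2 < d" using u(2) by (simp add: r_def)
      ultimately have "r * (1 / 2) \<le> r * norm (v - u')" by simp
      then show ?thesis using r by (simp add: mult_le_cancel_left_pos)
    qed
    moreover have "blinfun_apply I v - t *\<^sub>R v \<in> W j"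
    proof -
      have "blinfun_apply I v - t *\<^sub>R v
          = (1 / r) *\<^sub>R ((blinfun_apply I (w j) - t *\<^sub>R w j) - (blinfun_apply I u - t *\<^sub>R u))"
        by (simp add: v_def blinfun.scaleR_right blinfun.diff_right algebra_simps)
      also have "\<dots> \<in> W j"
        by (intro subspace_scale[OF sub] subspace_diff[OF sub] t inv u(1)) (use j in simp)
      finally show ?thesis .
    qed
    ultimately show ?thesis by blast
  qed
  then obtain v t where v: "\<And>j. j < k \<Longrightarrow> v j \<in> W (Suc j) \<and> norm (v j) = 1 \<and>
      (\<forall>u\<in>W j. 1 / 2 \<le> norm (v j - u)) \<and> blinfun_apply I (v j) - t j *\<^sub>R v j \<in> W j"
    by metis
  have "1 / 2 \<le> norm (blinfun_apply K (v j) - blinfun_apply K (v i))" if ij: "i < j" "j < k" for i j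
  proof -
    let ?e = "blinfun_apply I (v j) - t j *\<^sub>R v j"
    have e: "?e \<in> W j" using v[OF ij(2)] by blast
    have jk: "j \<le> k" using ij by simp
    have "v i \<in> W j" using v[of i] ij mono[of "Suc i" j] by auto
    then have Kvi: "blinfun_apply K (v i) \<in> W j"
      unfolding K using inv[OF jk] by (simp add: blinfun.add_left subspace_add[OF sub])
    \<comment> \<open>Substituting \<open>I (v j) = t v + e\<close> twice gives
      \<open>K (v j) = (1 + t^2) v + t e + I e\<close>; everything except the first term is
      collected in \<open>u\<close>.\<close>
    define a where "a = 1 + t j * t j"
    define u where "u = blinfun_apply K (v i) - t j *\<^sub>R ?e - blinfun_apply I ?e"
    have a: "a \<ge> 1" by (simp add: a_def)
    have u: "u \<in> W j"
      unfolding u_def by (intro subspace_diff[OF sub] subspace_scale[OF sub] Kvi e inv[OF jk])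
    have "blinfun_apply K (v j) - blinfun_apply K (v i) = a *\<^sub>R v j - u"
      unfolding K by (simp add: a_def u_def K blinfun.add_left blinfun.diff_right blinfun.scaleR_right algebra_simps)
    also have "\<dots> = a *\<^sub>R (v j - (1 / a) *\<^sub>R u)" using a by (simp add: scaleR_diff_right)
    finally have "norm (blinfun_apply K (v j) - blinfun_apply K (v i)) = a * norm (v j - (1 / a) *\<^sub>R u)"
      using a by simp
    moreover have "1 / 2 \<le> norm (v j - (1 / a) *\<^sub>R u)"
      using v[OF ij(2)] u subspace_scale[OF sub] by blast
    then have "1 * (1 / 2) \<le> a * norm (v j - (1 / a) *\<^sub>R u)" using a by (intro mult_mono) auto
    ultimately show ?thesis by simp
  qed
  then show thesis using that v by (metis order_refl)
qed

lemma zero_ideal_eqv: "zero_ideal.eqv A B \<longleftrightarrow> A = B"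
  by (simp add: zero_ideal.eqv_def)

text \<open>Separated images bound the length of all flags, so a longest one exists; an eigenvector
  modulo its span, chosen in the kernel of the projection, would prolong it.\<close>

lemma maximal_triangular_flag:
  fixes I :: "'a::banach \<Rightarrow>\<^sub>L 'a"
  assumes K: "(I o\<^sub>L I) + id_blinfun \<in> approximable"
  obtains k w f where "biorthogonal k w f" "triangular_flag I k w"
    "\<And>v t. blinfun_apply (biorthogonal_projection k w f) v = 0 \<Longrightarrow>
      blinfun_apply I v - t *\<^sub>R v \<in> span (w ` {..<k}) \<Longrightarrow> v = 0"
proof -
  define P where "P k \<longleftrightarrow> (\<exists>w f. biorthogonal k w f \<and> triangular_flag I k w)" for k
  obtain M :: nat where M: "\<And>k v. (\<And>i. i < k \<Longrightarrow> norm (v i) \<le> 1) \<Longrightarrow>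
      (\<And>i j. i < j \<Longrightarrow> j < k \<Longrightarrow>
        1 / 2 \<le> norm (blinfun_apply ((I o\<^sub>L I) + id_blinfun) (v j) - blinfun_apply ((I o\<^sub>L I) + id_blinfun) (v i))) \<Longrightarrow> k \<le> M"
    using approximable_separated_bound[OF K] by blast
  have bound: "k \<le> M" if "P k" for k
  proof -
    obtain w f where wf: "biorthogonal k w f" "triangular_flag I k w" using \<open>P k\<close> unfolding P_def by blast
    obtain v where "\<And>j. j < k \<Longrightarrow> norm (v j) \<le> 1"
      "\<And>i j. i < j \<Longrightarrow> j < k \<Longrightarrow>
        1 / 2 \<le> norm (blinfun_apply ((I o\<^sub>L I) + id_blinfun) (v j) - blinfun_apply ((I o\<^sub>L I) + id_blinfun) (v i))"
      using triangular_flag_separated[OF wf refl] by blast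
    then show ?thesis by (rule M)
  qed
  have "P 0" by (auto simp: P_def biorthogonal_def triangular_flag_def)
  define k where "k = (GREATEST k. P k)"
  have Pk: "P k" unfolding k_def by (rule GreatestI_nat[of P 0 M]) (use \<open>P 0\<close> bound in auto)
  have max: "k' \<le> k" if "P k'" for k' unfolding k_def by (rule Greatest_le_nat[of P _ M]) (use that bound in auto)
  obtain w f where w: "biorthogonal k w f" and I: "triangular_flag I k w"
    using Pk unfolding P_def by blast
  show thesis
  proof (rule that[OF w I])
    fix v t
    assume v: "blinfun_apply (biorthogonal_projection k w f) v = 0"
      and eig: "blinfun_apply I v - t *\<^sub>R v \<in> span (w ` {..<k})"
    show "v = 0"
    proof (rule ccontr)
      assume "v \<noteq> 0"
      then obtain g where "biorthogonal (Suc k) (w(k := v)) (f(k := g))"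
        using biorthogonal_extend[OF w _ v] by blast
      moreover have "triangular_flag I (Suc k) (w(k := v))"
      proof -
        have "\<exists>t. blinfun_apply I ((w(k := v)) j) - t *\<^sub>R (w(k := v)) j \<in> span (w(k := v) ` {..<j})"
          if "j \<le> k" for j
        proof -
          have same: "w(k := v) ` {..<j} = w ` {..<j}" using that by (intro image_cong) auto
          show ?thesis
          proof (cases "j = k")
            case True
            then show ?thesis unfolding same using eig by auto
          next
            case False
            then show ?thesis unfolding same using I that by (simp add: triangular_flag_def)
          qed
        qed
        then show ?thesis unfolding triangular_flag_def by (simp add: less_Suc_eq_le)
      qed
      ultimately have "P (Suc k)" unfolding P_def by blast
      then show False using max by fastforce
    qed
  qed
qed

lemma id_plus_approximable_invertible:
  fixes K :: "'a::banach \<Rightarrow>\<^sub>L 'a"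
  assumes K: "K \<in> approximable" and ker: "\<And>x. blinfun_apply (id_blinfun + K) x = 0 \<Longrightarrow> x = 0"
  shows "invertible_blinfun (id_blinfun + K)"
proof (rule fredholm_index_0_inj_invertible[OF fredholm_index_0_id_plus_approximable[OF K]])
  show "inj (blinfun_apply (id_blinfun + K))"
    by (rule injI) (metis blinfun.diff_right eq_iff_diff_eq_0 ker)
qed

text \<open>A complex structure on the common kernel of \<open>f 0, ..., f (k - 1)\<close>, extended
  by 0 along the vectors \<open>w i\<close>, so that it lives on the whole space; hence
  \<open>C^2\<close> is the projection minus the identity.\<close>

definition partial_complex_structure ::
  "nat \<Rightarrow> (nat \<Rightarrow> 'a::real_normed_vector) \<Rightarrow> (nat \<Rightarrow> 'a \<Rightarrow>\<^sub>L real) \<Rightarrow> ('a \<Rightarrow>\<^sub>L 'a) \<Rightarrow> bool" where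
  "partial_complex_structure k w f C \<longleftrightarrow> biorthogonal k w f \<and>
     (\<forall>i<k. blinfun_apply C (w i) = 0) \<and> (\<forall>i<k. \<forall>x. blinfun_apply (f i) (blinfun_apply C x) = 0) \<and>
     (\<forall>x. blinfun_apply C (blinfun_apply C x) = blinfun_apply (biorthogonal_projection k w f) x - x)"

text \<open>The compression \<open>J\<close> of \<open>I\<close> to the kernel of the projection has
  no real eigenvector there. So \<open>- J^2\<close>, completed by the identity on the range of the
  projection, can be joined to 1 by invertible operators, and its root normalizes
  \<open>J\<close>.\<close>

proposition partial_complex_structure_exists:
  fixes I :: "'a::banach \<Rightarrow>\<^sub>L 'a"
  assumes K: "(I o\<^sub>L I) + id_blinfun \<in> approximable"
  obtains k w f C where "partial_complex_structure k w f (C :: 'a \<Rightarrow>\<^sub>L 'a)"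
proof -
  obtain k w f where w: "biorthogonal k w f" and flag: "triangular_flag I k w"
    and max: "\<And>v t. blinfun_apply (biorthogonal_projection k w f) v = 0 \<Longrightarrow>
      blinfun_apply I v - t *\<^sub>R v \<in> span (w ` {..<k}) \<Longrightarrow> v = 0"
    using maximal_triangular_flag[OF K] by blast
  define Q where "Q = biorthogonal_projection k w f"
  have finQ: "Q \<in> approximable" unfolding Q_def
    by (rule finite_rank_approximable[OF finite_rank_biorthogonal_projection])
  have Q_span: "blinfun_apply Q x \<in> span (w ` {..<k})" for x
    unfolding Q_def by (rule biorthogonal_projection_range)
  have QQ: "blinfun_apply Q (blinfun_apply Q x) = blinfun_apply Q x" for x
    using biorthogonal_projection_span[OF w Q_span] by (simp add: Q_def)
  define P where "P = id_blinfun - Q"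
  define J where "J = P o\<^sub>L (I o\<^sub>L P)"
  have QP: "Q o\<^sub>L P = 0" and PQ: "P o\<^sub>L Q = 0"
    by (auto intro!: blinfun_eqI simp: P_def blinfun.diff_left blinfun.diff_right QQ)
  have QJ: "Q o\<^sub>L J = 0" and JQ: "J o\<^sub>L Q = 0"
    by (simp_all add: J_def blinfun_compose_assoc PQ flip: blinfun_compose_assoc[of Q P] add: QP)
  have no_eigenvector: "v = 0" if "blinfun_apply Q v = 0" "blinfun_apply J v = t *\<^sub>R v" for v t
  proof (rule max)
    show "blinfun_apply (biorthogonal_projection k w f) v = 0" using that by (simp add: Q_def)
    have "blinfun_apply I v - blinfun_apply Q (blinfun_apply I v) = t *\<^sub>R v"
      using that by (simp add: J_def P_def blinfun.diff_left)
    then have "blinfun_apply I v - t *\<^sub>R v = blinfun_apply Q (blinfun_apply I v)"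
      by (simp add: algebra_simps)
    then show "blinfun_apply I v - t *\<^sub>R v \<in> span (w ` {..<k})" using Q_span by simp
  qed
  \<comment> \<open>On the kernel of \<open>Q\<close> this is \<open>- J^2\<close>; the summand
    \<open>Q\<close> makes it the identity on the range of \<open>Q\<close>, where \<open>J\<close>
    vanishes, so that invertibility on the whole space is possible.\<close>
  define A where "A = Q - (J o\<^sub>L J)"
  have A_id: "A - id_blinfun \<in> approximable"
  proof -
    have P_id: "approximable.eqv P id_blinfun"
      using approximable.eqv_diff[of id_blinfun id_blinfun Q 0] finQ
      by (simp add: P_def approximable.eqv_def)
    have "approximable.eqv J (id_blinfun o\<^sub>L (I o\<^sub>L id_blinfun))"
      unfolding J_def by (intro approximable.eqv_compose P_id approximable.eqv_refl)
    then have "approximable.eqv (J o\<^sub>L J) (I o\<^sub>L I)" by (intro approximable.eqv_compose) simp_all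
    moreover have "approximable.eqv Q 0" using finQ by (simp add: approximable.eqv_def)
    ultimately have "approximable.eqv A (0 - (I o\<^sub>L I))"
      unfolding A_def by (intro approximable.eqv_diff)
    moreover have "approximable.eqv (0 - (I o\<^sub>L I)) id_blinfun"
      using K subspace_neg[OF approximable.subspace_N] by (fastforce simp: approximable.eqv_def)
    ultimately show ?thesis using approximable.eqv_trans unfolding approximable.eqv_def[symmetric] by blast
  qed
  have inv: "invertible_blinfun ((1 - s) *\<^sub>R id_blinfun + s *\<^sub>R A)" if s: "s \<in> {0..1}" for s
  proof -
    have eq: "(1 - s) *\<^sub>R id_blinfun + s *\<^sub>R A = id_blinfun + s *\<^sub>R (A - id_blinfun)"
      by (simp add: algebra_simps)
    show ?thesis unfolding eq
    proof (rule id_plus_approximable_invertible)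
      show "s *\<^sub>R (A - id_blinfun) \<in> approximable"
        by (rule subspace_scale[OF approximable.subspace_N A_id])
      fix x assume "blinfun_apply (id_blinfun + s *\<^sub>R (A - id_blinfun)) x = 0"
      then have x: "(1 - s) *\<^sub>R x + s *\<^sub>R (blinfun_apply Q x - blinfun_apply J (blinfun_apply J x)) = 0"
        unfolding eq[symmetric] by (simp add: A_def blinfun.add_left blinfun.diff_left blinfun.scaleR_left)
      have QJx: "blinfun_apply Q (blinfun_apply J y) = 0" for y
        using arg_cong[OF QJ, of "\<lambda>T. blinfun_apply T y"] by simp
      \<comment> \<open>Since \<open>Q J = 0\<close>, applying \<open>Q\<close> leaves
        \<open>((1 - s) + s) Q x\<close>, so \<open>x\<close> lies where \<open>J\<close> has no
        real eigenvectors.\<close>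
      have "blinfun_apply Q ((1 - s) *\<^sub>R x + s *\<^sub>R (blinfun_apply Q x - blinfun_apply J (blinfun_apply J x))) = 0"
        unfolding x by simp
      then have Qx: "blinfun_apply Q x = 0"
        by (simp add: blinfun.add_right blinfun.diff_right blinfun.scaleR_right QQ QJx flip: scaleR_left_distrib)
      show "x = 0"
      proof (cases "s = 0")
        case True
        then show ?thesis using x by simp
      next
        case False
        \<comment> \<open>The remaining equation is \<open>J^2 x = \<tau>^2 x\<close> with
          \<open>\<tau>\<close> real, because \<open>(1 - s) / s\<close> is nonnegative. It factors
          as \<open>(J - \<tau>)(J + \<tau>) x = 0\<close>, and both factors are injective
          there.\<close>
        define \<tau> where "\<tau> = sqrt ((1 - s) / s)"
        have tau: "\<tau> * \<tau> = (1 - s) / s" using s False by (simp add: \<tau>_def)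
        have "s *\<^sub>R blinfun_apply J (blinfun_apply J x) = (1 - s) *\<^sub>R x"
          using x Qx by (simp add: algebra_simps)
        then have "(1 / s) *\<^sub>R (s *\<^sub>R blinfun_apply J (blinfun_apply J x)) = (1 / s) *\<^sub>R ((1 - s) *\<^sub>R x)" by simp
        then have JJ: "blinfun_apply J (blinfun_apply J x) = (\<tau> * \<tau>) *\<^sub>R x" using False by (simp add: tau)
        define y where "y = blinfun_apply J x + \<tau> *\<^sub>R x"
        have "y = 0"
        proof (rule no_eigenvector[of _ \<tau>])
          show "blinfun_apply Q y = 0" by (simp add: y_def blinfun.add_right blinfun.scaleR_right Qx QJx)
          show "blinfun_apply J y = \<tau> *\<^sub>R y"
            by (simp add: y_def blinfun.add_right blinfun.scaleR_right JJ scaleR_add_right)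
        qed
        then have "blinfun_apply J x = (- \<tau>) *\<^sub>R x" by (simp add: y_def eq_neg_iff_add_eq_0)
        then show ?thesis by (rule no_eigenvector[OF Qx])
      qed
    qed
  qed
  define B where "B s = (1 - s) *\<^sub>R id_blinfun + s *\<^sub>R A" for s :: real
  have "zero_ideal.has_sqrt A (B 1)"
  proof (rule zero_ideal.has_sqrt_path)
    show "continuous_on {0..1} B" unfolding B_def by (intro continuous_intros)
    show "zero_ideal.commutes C (B s)" if "zero_ideal.commutes C A" for s C
      unfolding B_def by (intro zero_ideal.commutes_add zero_ideal.commutes_scaleR that) simp
    show "\<exists>G. zero_ideal.eqv (G o\<^sub>L B s) id_blinfun \<and> zero_ideal.eqv (B s o\<^sub>L G) id_blinfun"
      if "s \<in> {0..1}" for s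
      using inv[OF that] by (auto simp: B_def invertible_blinfun_def zero_ideal.eqv_def)
    show "zero_ideal.has_sqrt A (B 0)"
      unfolding zero_ideal.has_sqrt_def by (intro exI[of _ id_blinfun]) (simp add: B_def)
  qed
  moreover have B1: "B 1 = A" by (simp add: B_def)
  ultimately obtain R where R: "R o\<^sub>L R = A" "\<And>C. C o\<^sub>L A = A o\<^sub>L C \<Longrightarrow> C o\<^sub>L R = R o\<^sub>L C"
    unfolding zero_ideal.has_sqrt_def zero_ideal_commutes zero_ideal_eqv B1 by blast
  obtain G where G: "G o\<^sub>L A = id_blinfun" "A o\<^sub>L G = id_blinfun"
    using inv[of 1] by (auto simp: invertible_blinfun_def)
  have inverse_commutes: "C o\<^sub>L G = G o\<^sub>L C" if "C o\<^sub>L A = A o\<^sub>L C" for C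
    using zero_ideal.commutes_inverse[of G A C] G that by (simp add: zero_ideal_commutes)
  have QA: "Q o\<^sub>L A = Q" and AQ: "A o\<^sub>L Q = Q"
  proof -
    have "Q o\<^sub>L Q = Q" by (rule blinfun_eqI) (simp add: QQ)
    moreover have "Q o\<^sub>L (J o\<^sub>L J) = 0" by (simp add: QJ flip: blinfun_compose_assoc)
    moreover have "(J o\<^sub>L J) o\<^sub>L Q = 0" by (simp add: JQ blinfun_compose_assoc)
    ultimately show "Q o\<^sub>L A = Q" "A o\<^sub>L Q = Q"
      by (simp_all add: A_def blinfun_compose_bilinear)
  qed
  have JA: "J o\<^sub>L A = A o\<^sub>L J"
    by (simp add: A_def blinfun_compose_bilinear blinfun_compose_assoc JQ QJ)
  have QG: "Q o\<^sub>L G = Q" by (metis QA G(2) blinfun_compose_assoc blinfun_compose_id(1))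
  \<comment> \<open>This is \<open>J\<close> divided by the root \<open>R\<close> of
    \<open>A\<close>, as \<open>G R\<close> is the inverse of \<open>R\<close>. All factors commute,
    so \<open>C^2 = J^2 G = (Q - A) G = Q - 1\<close>.\<close>
  define C where "C = J o\<^sub>L (G o\<^sub>L R)"
  have JR: "J o\<^sub>L R = R o\<^sub>L J" and QR: "Q o\<^sub>L R = R o\<^sub>L Q" and GR: "G o\<^sub>L R = R o\<^sub>L G" and JG: "J o\<^sub>L G = G o\<^sub>L J"
    using R(2)[OF JA] R(2)[of Q] R(2)[of G] inverse_commutes[OF JA] by (simp_all add: QA AQ G)
  have "C o\<^sub>L C = (J o\<^sub>L J) o\<^sub>L ((G o\<^sub>L G) o\<^sub>L (R o\<^sub>L R))"
  proof -
    have comm: "J o\<^sub>L (G o\<^sub>L R) = (G o\<^sub>L R) o\<^sub>L J"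
      by (metis JG JR blinfun_compose_assoc)
    have "C o\<^sub>L C = J o\<^sub>L (((G o\<^sub>L R) o\<^sub>L J) o\<^sub>L (G o\<^sub>L R))" by (simp add: C_def blinfun_compose_assoc)
    also have "\<dots> = (J o\<^sub>L J) o\<^sub>L (G o\<^sub>L ((R o\<^sub>L G) o\<^sub>L R))"
      unfolding comm[symmetric] by (simp add: blinfun_compose_assoc)
    also have "\<dots> = (J o\<^sub>L J) o\<^sub>L ((G o\<^sub>L G) o\<^sub>L (R o\<^sub>L R))"
      unfolding GR[symmetric] by (simp add: blinfun_compose_assoc)
    finally show ?thesis .
  qed
  also have "\<dots> = (J o\<^sub>L J) o\<^sub>L G" by (simp add: R(1) G blinfun_compose_assoc)
  also have "J o\<^sub>L J = Q - A" by (simp add: A_def)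
  finally have CC: "C o\<^sub>L C = Q - id_blinfun" by (simp add: blinfun_compose_bilinear QG G)
  have QC: "Q o\<^sub>L C = 0" by (simp add: C_def QJ flip: blinfun_compose_assoc)
  have "C o\<^sub>L Q = 0"
  proof -
    have "C o\<^sub>L Q = J o\<^sub>L (G o\<^sub>L (R o\<^sub>L Q))" by (simp add: C_def blinfun_compose_assoc)
    also have "\<dots> = J o\<^sub>L ((G o\<^sub>L Q) o\<^sub>L R)" unfolding QR[symmetric] by (simp add: blinfun_compose_assoc)
    also have "G o\<^sub>L Q = Q" using inverse_commutes[of Q] QG by (simp add: QA AQ)
    finally show ?thesis by (simp add: JQ flip: blinfun_compose_assoc)
  qed
  then have CQ: "blinfun_apply C (blinfun_apply Q x) = 0" for x
    by (metis blinfun_apply_blinfun_compose zero_blinfun.rep_eq)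
  have "partial_complex_structure k w f C"
    unfolding partial_complex_structure_def
  proof (intro conjI allI impI w)
    fix i assume i: "i < k"
    have "blinfun_apply Q (w i) = w i"
      unfolding Q_def by (rule biorthogonal_projection_span[OF w]) (use i in \<open>auto intro: span_base\<close>)
    then show "blinfun_apply C (w i) = 0" using CQ[of "w i"] by simp
    fix x
    have "blinfun_apply Q (blinfun_apply C x) = 0"
      using arg_cong[OF QC, of "\<lambda>T. blinfun_apply T x"] by simp
    then show "blinfun_apply (f i) (blinfun_apply C x) = 0"
      using biorthogonal_functional_projection[OF w i, of "blinfun_apply C x"] by (simp add: Q_def)
  next
    fix x
    show "blinfun_apply C (blinfun_apply C x) = blinfun_apply (biorthogonal_projection k w f) x - x"
      using arg_cong[OF CC, of "\<lambda>T. blinfun_apply T x"] by (simp add: Q_def blinfun.diff_left)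
  qed
  then show thesis by (rule that)
qed

text \<open>Two leftover dimensions carry a complex structure of their own, the rotation of the
  plane spanned by the last two vectors; it is added to \<open>C\<close>.\<close>

lemma partial_complex_structure_reduce:
  assumes C: "partial_complex_structure (Suc (Suc k)) w f C"
  obtains D where "partial_complex_structure k w f D"
proof -
  let ?a = k and ?b = "Suc k"
  have w: "biorthogonal (Suc (Suc k)) w f" and Cw: "\<And>i. i < Suc (Suc k) \<Longrightarrow> blinfun_apply C (w i) = 0"
    and fC: "\<And>i x. i < Suc (Suc k) \<Longrightarrow> blinfun_apply (f i) (blinfun_apply C x) = 0"
    and CC: "\<And>x. blinfun_apply C (blinfun_apply C x) = blinfun_apply (biorthogonal_projection (Suc (Suc k)) w f) x - x"
    using C by (auto simp: partial_complex_structure_def)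
  define D where "D = C + rank_one (f ?a) (w ?b) - rank_one (f ?b) (w ?a)"
  have D: "blinfun_apply D x = blinfun_apply C x + blinfun_apply (f ?a) x *\<^sub>R w ?b - blinfun_apply (f ?b) x *\<^sub>R w ?a" for x
    by (simp add: D_def blinfun.add_left blinfun.diff_left)
  have fw: "blinfun_apply (f i) (w j) = (if i = j then 1 else 0)" if "i < Suc (Suc k)" "j < Suc (Suc k)" for i j
    using w that by (simp add: biorthogonal_def)
  have "partial_complex_structure k w f D"
    unfolding partial_complex_structure_def
  proof (intro conjI allI impI)
    show "biorthogonal k w f" by (rule biorthogonal_mono[OF w]) simp
    show "blinfun_apply D (w i) = 0" if "i < k" for i using that by (simp add: D Cw fw)
    show "blinfun_apply (f i) (blinfun_apply D x) = 0" if "i < k" for i x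
      using that by (simp add: D fC fw blinfun.add_right blinfun.diff_right blinfun.scaleR_right)
    fix x
    have "blinfun_apply C (blinfun_apply D x) = blinfun_apply C (blinfun_apply C x)"
      by (simp add: D Cw blinfun.add_right blinfun.diff_right blinfun.scaleR_right)
    moreover have "blinfun_apply (f ?a) (blinfun_apply D x) = - blinfun_apply (f ?b) x"
      "blinfun_apply (f ?b) (blinfun_apply D x) = blinfun_apply (f ?a) x"
      by (simp_all add: D fC fw blinfun.add_right blinfun.diff_right blinfun.scaleR_right)
    ultimately show "blinfun_apply D (blinfun_apply D x) = blinfun_apply (biorthogonal_projection k w f) x - x"
      by (simp add: D[of "blinfun_apply D x"] CC biorthogonal_projection_apply)
  qed
  then show thesis by (rule that)
qed

text \<open>Removing leftover dimensions in pairs ends with \<open>k mod 2\<close> of them: none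
  gives a structure on the space, one gives a structure on the kernel of \<open>f\<close>.\<close>

proposition complex_structure_or_hyperplane:
  fixes I :: "'a::banach \<Rightarrow>\<^sub>L 'a"
  assumes K: "(I o\<^sub>L I) + id_blinfun \<in> approximable"
  obtains C :: "'a \<Rightarrow>\<^sub>L 'a" where "\<And>x. blinfun_apply C (blinfun_apply C x) = - x"
  | C :: "'a \<Rightarrow>\<^sub>L 'a" and f w where "blinfun_apply f w = 1" "blinfun_apply C w = 0"
    "\<And>x. blinfun_apply f (blinfun_apply C x) = 0"
    "\<And>x. blinfun_apply C (blinfun_apply C x) = blinfun_apply f x *\<^sub>R w - x"
proof -
  obtain k w f and C :: "'a \<Rightarrow>\<^sub>L 'a" where C: "partial_complex_structure k w f C"
    using partial_complex_structure_exists[OF K] .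
  have "\<exists>C. partial_complex_structure (k mod 2) w f C" using C
  proof (induction k arbitrary: C rule: less_induct)
    case (less k)
    show ?case
    proof (cases "k < 2")
      case True
      then show ?thesis using less.prems by auto
    next
      case False
      then obtain m where m: "k = Suc (Suc m)" by (metis add_2_eq_Suc le_Suc_ex not_less)
      obtain D where "partial_complex_structure m w f D"
        using partial_complex_structure_reduce less.prems unfolding m by blast
      moreover have "k mod 2 = m mod 2" by (simp add: m)
      ultimately show ?thesis using less.IH[of m] by (simp add: m)
    qed
  qed
  then obtain D where D: "partial_complex_structure (k mod 2) w f D" by blast
  show thesis
  proof (cases "even k")
    case True
    then have "blinfun_apply D (blinfun_apply D x) = - x" for x
      using D by (simp add: partial_complex_structure_def biorthogonal_projection_apply)
    then show thesis by (rule that(1))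
  next
    case False
    then have "k mod 2 = Suc 0" by presburger
    then have "partial_complex_structure (Suc 0) w f D" using D by simp
    then show thesis
      by (intro that(2)[of "f 0" "w 0" D])
        (simp_all add: partial_complex_structure_def biorthogonal_def biorthogonal_projection_apply)
  qed
qed

section \<open>Parity\<close>

text \<open>The induction adds complex-linear maps of rank one to \<open>V\<close> until only \<open>w\<close> is left in its kernel. The
  cokernel, a complex vector space, would then have real dimension one.\<close>

lemma no_complex_linear_fredholm_map:
  fixes I J V :: "'a::banach \<Rightarrow>\<^sub>L 'a"
  assumes I: "\<And>x. blinfun_apply I (blinfun_apply I x) = - x"
    and fw: "blinfun_apply f w = 1" and Jw: "blinfun_apply J w = 0"
    and JJ: "\<And>x. blinfun_apply J (blinfun_apply J x) = blinfun_apply f x *\<^sub>R w - x"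
    and fin: "finite \<Phi>" and V: "fredholm_index_0 V"
    and IV: "\<And>x. blinfun_apply I (blinfun_apply V x) = blinfun_apply V (blinfun_apply J x)"
    and Vw: "blinfun_apply V w = 0"
    and ker: "\<And>x. blinfun_apply f x = 0 \<Longrightarrow> x \<in> annihilator \<Phi> \<Longrightarrow> blinfun_apply V x = 0 \<Longrightarrow> x = 0"
  shows False
  using fin V IV Vw ker
proof (induction \<Phi> arbitrary: V rule: finite_induct)
  case (empty V)
  have "\<not> inj (blinfun_apply V)" using fw empty.prems(3) by (metis blinfun.zero_right injD zero_neq_one)
  then obtain z where z: "z \<notin> range (blinfun_apply V)"
    using fredholm_index_0_inj_iff_surj[OF empty.prems(1)] by blast
  \<comment> \<open>The kernel of \<open>V\<close> is the line through \<open>w\<close>. Sending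
    \<open>w\<close> to the missing vector \<open>z\<close> makes the map injective, hence
    surjective, so the range of \<open>V\<close> and \<open>z\<close> together span
    everything.\<close>
  let ?U = "V + rank_one f z"
  have U: "blinfun_apply ?U x = blinfun_apply V x + blinfun_apply f x *\<^sub>R z" for x
    by (simp add: blinfun.add_left)
  have "x = 0" if "blinfun_apply ?U x = 0" for x
  proof (cases "blinfun_apply f x = 0")
    case True
    then show ?thesis using that empty.prems(4)[of x] by (simp add: U)
  next
    case False
    have "blinfun_apply V ((- 1 / blinfun_apply f x) *\<^sub>R x)
        = (- 1 / blinfun_apply f x) *\<^sub>R (blinfun_apply ?U x - blinfun_apply f x *\<^sub>R z)"
      by (simp only: U blinfun.scaleR_right) simp
    also have "\<dots> = z" using False that by simp
    finally show ?thesis using z by (metis rangeI)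
  qed
  then have "inj (blinfun_apply ?U)"
    by (intro injI) (metis blinfun.diff_right eq_iff_diff_eq_0)
  then have "surj (blinfun_apply ?U)"
    using fredholm_index_0_inj_iff_surj[OF fredholm_index_0_add_finite_rank[OF empty.prems(1) finite_rank_rank_one]]
    by blast
  then obtain x where "blinfun_apply I z = blinfun_apply ?U x" by (metis surjD)
  \<comment> \<open>\<open>I\<close> induces on the one-dimensional cokernel multiplication by the
    real number \<open>a\<close>, whose square would be -1: applying \<open>I\<close> again puts
    \<open>(1 + a^2) z\<close> into the range.\<close>
  define a where "a = blinfun_apply f x"
  have Iz: "blinfun_apply I z = blinfun_apply V x + a *\<^sub>R z"
    using \<open>blinfun_apply I z = blinfun_apply ?U x\<close> by (simp add: U a_def)
  define u where "u = blinfun_apply J x + a *\<^sub>R x"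
  have "- z = blinfun_apply I (blinfun_apply V x + a *\<^sub>R z)" using I[of z] Iz by simp
  also have "\<dots> = blinfun_apply V (blinfun_apply J x) + a *\<^sub>R (blinfun_apply V x + a *\<^sub>R z)"
    by (simp add: blinfun.add_right blinfun.scaleR_right empty.prems(2) Iz)
  also have "\<dots> = blinfun_apply V u + (a * a) *\<^sub>R z"
    by (simp add: u_def blinfun.add_right blinfun.scaleR_right scaleR_add_right)
  finally have mz: "- z = blinfun_apply V u + (a * a) *\<^sub>R z" .
  have "(1 + a * a) *\<^sub>R z + blinfun_apply V u = (blinfun_apply V u + (a * a) *\<^sub>R z) + z"
    by (simp add: scaleR_add_left add_ac)
  also have "\<dots> = 0" unfolding mz[symmetric] by simp
  finally have Vu: "blinfun_apply V (- u) = (1 + a * a) *\<^sub>R z"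
    by (metis add.commute add_eq_0_iff blinfun.minus_right)
  have "1 + a * a \<noteq> 0" using zero_le_square[of a] by linarith
  then have "blinfun_apply V ((1 / (1 + a * a)) *\<^sub>R - u) = z"
    unfolding blinfun.scaleR_right[of V "1 / (1 + a * a)"] Vu by simp
  then show False using z by (metis rangeI)
next
  case (insert \<phi> \<Phi> V)
  have "\<not> inj (blinfun_apply V)" using fw insert.prems(3) by (metis blinfun.zero_right injD zero_neq_one)
  then obtain z where z: "z \<notin> range (blinfun_apply V)"
    using fredholm_index_0_inj_iff_surj[OF insert.prems(1)] by blast
  \<comment> \<open>Subtracting a multiple of \<open>f\<close> makes the functional vanish at
    \<open>w\<close>, where \<open>J^2\<close> is not \<open>- 1\<close>, and changes nothing on the
    kernel of \<open>f\<close>.\<close>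
  define \<gamma> where "\<gamma> = \<phi> - blinfun_apply \<phi> w *\<^sub>R f"
  have gw: "blinfun_apply \<gamma> w = 0" by (simp add: \<gamma>_def blinfun.diff_left blinfun.scaleR_left fw)
  have gJJ: "blinfun_apply \<gamma> (blinfun_apply J (blinfun_apply J x)) = - blinfun_apply \<gamma> x" for x
    by (simp add: JJ blinfun.diff_right blinfun.scaleR_right gw)
  \<comment> \<open>The added map is the complex functional with real part \<open>\<gamma>\<close>
    and imaginary part \<open>- \<gamma> J\<close>, times \<open>z\<close>; this keeps
    \<open>V'\<close> complex linear.\<close>
  define V' where "V' = V + rank_one \<gamma> z + - rank_one (\<gamma> o\<^sub>L J) (blinfun_apply I z)"
  have V': "blinfun_apply V' x
      = blinfun_apply V x + blinfun_apply \<gamma> x *\<^sub>R z - blinfun_apply \<gamma> (blinfun_apply J x) *\<^sub>R blinfun_apply I z" for x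
    by (simp add: V'_def blinfun.add_left blinfun.diff_left)
  show False
  proof (rule insert.IH)
    show "fredholm_index_0 V'"
      unfolding V'_def
      by (intro fredholm_index_0_add_finite_rank insert.prems finite_rank_rank_one finite_rank_uminus)
    show "blinfun_apply I (blinfun_apply V' x) = blinfun_apply V' (blinfun_apply J x)" for x
      by (simp add: V' gJJ I insert.prems(2) blinfun.add_right blinfun.diff_right blinfun.scaleR_right)
    show "blinfun_apply V' w = 0" by (simp add: V' gw Jw insert.prems(3))
    fix x assume fx: "blinfun_apply f x = 0" and x: "x \<in> annihilator \<Phi>" and V'x: "blinfun_apply V' x = 0"
    define a b where "a = - blinfun_apply \<gamma> x" and "b = blinfun_apply \<gamma> (blinfun_apply J x)"
    have Vx: "blinfun_apply V x = a *\<^sub>R z + b *\<^sub>R blinfun_apply I z"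
      using V'x unfolding V' a_def b_def by (simp add: algebra_simps eq_neg_iff_add_eq_0)
    have IVx: "blinfun_apply V (blinfun_apply J x) = a *\<^sub>R blinfun_apply I z - b *\<^sub>R z"
      unfolding insert.prems(2)[symmetric] Vx by (simp add: blinfun.add_right blinfun.scaleR_right I)
    have "a * a + b * b = 0"
    proof (rule ccontr)
      define n where "n = a * a + b * b"
      assume "a * a + b * b \<noteq> 0"
      then have n: "n \<noteq> 0" by (simp add: n_def)
      \<comment> \<open>If \<open>V x = (a + b i) z\<close>, multiplying by the conjugate
        \<open>a - b i\<close> brings a real multiple of \<open>z\<close> into the range.\<close>
      have Vn: "blinfun_apply V (a *\<^sub>R x - b *\<^sub>R blinfun_apply J x) = n *\<^sub>R z"
        by (simp add: n_def blinfun.diff_right blinfun.scaleR_right Vx IVx algebra_simps)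
      have "blinfun_apply V ((1 / n) *\<^sub>R (a *\<^sub>R x - b *\<^sub>R blinfun_apply J x)) = z"
        unfolding blinfun.scaleR_right[of V "1 / n"] Vn using n by simp
      then show False using z by (metis rangeI)
    qed
    then have "a = 0" "b = 0" by (auto simp: sum_squares_eq_zero_iff)
    then have "blinfun_apply \<phi> x = 0" "blinfun_apply V x = 0"
      using fx Vx by (auto simp: a_def \<gamma>_def blinfun.diff_left blinfun.scaleR_left)
    then show "x = 0" using insert.prems(4)[of x] fx x by (simp add: annihilator_insert)
  qed
qed

text \<open>Along \<open>I + s J\<close> the index stays zero. For \<open>s < 1\<close> a
  combination of compositions with \<open>A s\<close> is a nonzero scalar up to rank one, so
  \<open>A s\<close> is semi-Fredholm on an HI space; at \<open>s = 1\<close> that scalar vanishes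
  and the assumption on \<open>I + J\<close> takes over.\<close>

lemma HI_complex_structure_parity_aux:
  fixes I J :: "'a::banach \<Rightarrow>\<^sub>L 'a"
  assumes HI: "hereditarily_indecomposable TYPE('a)"
    and I: "\<And>x. blinfun_apply I (blinfun_apply I x) = - x"
    and fw: "blinfun_apply f w = 1" and Jw: "blinfun_apply J w = 0"
    and JJ: "\<And>x. blinfun_apply J (blinfun_apply J x) = blinfun_apply f x *\<^sub>R w - x"
    and fJ: "\<And>x. blinfun_apply f (blinfun_apply J x) = 0"
    and semi: "upper_semi_fredholm (I + J)"
  shows False
proof -
  have inf: "infinite_dimensional (UNIV :: 'a set)" by (rule HI_infinite_dimensional[OF HI])
  define A where "A s = I + s *\<^sub>R J" for s :: real
  have "fredholm_index_0 (A 1)"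
  proof (rule fredholm_index_0_path)
    show "continuous_on {0..1} A" unfolding A_def by (intro continuous_intros)
    show "fredholm_index_0 (A 0)"
      by (rule invertible_fredholm_index_0)
        (auto simp: A_def invertible_blinfun_def I blinfun.minus_left blinfun.minus_right intro!: exI[of _ "- I"] blinfun_eqI)
    fix s :: real assume s: "s \<in> {0..1}"
    show "upper_semi_fredholm (A s)"
    proof (cases "s = 1")
      case True
      then show ?thesis using semi by (simp add: A_def)
    next
      case False
      then have "s < 1" using s by simp
      moreover have "s * s \<le> s" using s by (simp add: mult_left_le)
      ultimately have "s * s - 1 \<noteq> 0" by linarith
      \<comment> \<open>In \<open>I A - s A J\<close> the mixed terms \<open>s I J\<close> cancel,
        leaving \<open>I^2 - s^2 J^2\<close>, which is \<open>s^2 - 1\<close> minus a rank-one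
        term.\<close>
      then have "upper_semi_fredholm ((s * s - 1) *\<^sub>R id_blinfun + rank_one ((- s * s) *\<^sub>R f) w)"
        by (intro upper_semi_fredholm_finite_rank upper_semi_fredholm_scaleR upper_semi_fredholm_id finite_rank_rank_one)
      also have "(s * s - 1) *\<^sub>R id_blinfun + rank_one ((- s * s) *\<^sub>R f) w
          = (I o\<^sub>L A s) + (((- s) *\<^sub>R id_blinfun o\<^sub>L A s) o\<^sub>L J)"
        by (rule blinfun_eqI)
          (simp add: A_def blinfun.add_left blinfun.add_right blinfun.diff_left blinfun.minus_left
            blinfun.scaleR_left blinfun.scaleR_right I JJ algebra_simps)
      finally have "upper_semi_fredholm (I o\<^sub>L A s) \<or> upper_semi_fredholm (((- s) *\<^sub>R id_blinfun o\<^sub>L A s) o\<^sub>L J)"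
        by (rule HI_upper_semi_fredholm_add[OF HI])
      then show ?thesis
        using HI_upper_semi_fredholm_compose_left[OF HI inf] upper_semi_fredholm_compose_cancel by blast
    qed
  qed simp
  then have IJ: "fredholm_index_0 (I + J)" by (simp add: A_def)
  \<comment> \<open>The rank-one term removes the value \<open>I w\<close> at \<open>w\<close>; only
    then is \<open>I V = V J\<close> exact, since \<open>J^2 w = 0\<close> and not
    \<open>- w\<close>.\<close>
  define V where "V = I + J + rank_one f (- blinfun_apply I w)"
  have V: "blinfun_apply V x = blinfun_apply I x + blinfun_apply J x - blinfun_apply f x *\<^sub>R blinfun_apply I w" for x
    by (simp add: V_def blinfun.add_left)
  have V0: "fredholm_index_0 V"
    unfolding V_def by (rule fredholm_index_0_add_finite_rank[OF IJ finite_rank_rank_one])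
  obtain \<Phi> where \<Phi>: "finite \<Phi>" "bounded_below_on V (annihilator \<Phi>)"
    using fredholm_index_0_upper_semi_fredholm[OF V0] unfolding upper_semi_fredholm_def by blast
  have inj: "inj_on (blinfun_apply V) (annihilator \<Phi>)"
    by (rule bounded_below_on_imp_inj_on[OF \<Phi>(2)]) simp
  show False
  proof (rule no_complex_linear_fredholm_map[OF I fw Jw JJ \<Phi>(1) V0])
    show "blinfun_apply I (blinfun_apply V x) = blinfun_apply V (blinfun_apply J x)" for x
      by (simp add: V I JJ fJ blinfun.add_right blinfun.diff_right blinfun.scaleR_right)
    show "blinfun_apply V w = 0" by (simp add: V Jw fw)
    show "x = 0" if "x \<in> annihilator \<Phi>" "blinfun_apply V x = 0" for x
      by (rule inj_onD[OF inj]) (simp_all add: that subspace_0)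
  qed
qed

text \<open>Since \<open>2 I = (I + J) + (I - J)\<close>, one summand is semi-Fredholm, and
  \<open>- J\<close> satisfies the same equations as \<open>J\<close>.\<close>

proposition HI_complex_structure_parity:
  fixes I J :: "'a::banach \<Rightarrow>\<^sub>L 'a"
  assumes HI: "hereditarily_indecomposable TYPE('a)"
    and I: "\<And>x. blinfun_apply I (blinfun_apply I x) = - x"
    and fw: "blinfun_apply f w = 1" and Jw: "blinfun_apply J w = 0"
    and JJ: "\<And>x. blinfun_apply J (blinfun_apply J x) = blinfun_apply f x *\<^sub>R w - x"
    and fJ: "\<And>x. blinfun_apply f (blinfun_apply J x) = 0"
  shows False
proof -
  have "upper_semi_fredholm I"
  proof -
    have "(- I) o\<^sub>L I = id_blinfun" by (rule blinfun_eqI) (simp add: blinfun.minus_left I)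
    then show ?thesis using upper_semi_fredholm_compose_cancel upper_semi_fredholm_id by metis
  qed
  then have "upper_semi_fredholm ((2 :: real) *\<^sub>R I)" by (rule upper_semi_fredholm_scaleR) simp
  also have "(2 :: real) *\<^sub>R I = (I + J) + (I + - J)" by (simp add: scaleR_2)
  finally have "upper_semi_fredholm (I + J) \<or> upper_semi_fredholm (I + - J)"
    by (rule HI_upper_semi_fredholm_add[OF HI])
  then show False
  proof
    assume "upper_semi_fredholm (I + J)"
    then show False by (rule HI_complex_structure_parity_aux[OF HI I fw Jw JJ fJ])
  next
    assume semi: "upper_semi_fredholm (I + - J)"
    show False
      by (rule HI_complex_structure_parity_aux[OF HI I fw _ _ _ semi])
        (simp_all add: Jw JJ fJ blinfun.minus_left blinfun.minus_right)
  qed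
qed

section \<open>Hyperplanes\<close>

lemma hyperplane_kernel:
  fixes f :: "'a::banach \<Rightarrow>\<^sub>L real"
  assumes f: "blinfun_apply f v = 1"
  shows "hyperplane {x. blinfun_apply f x = 0}"
proof -
  let ?H = "{x. blinfun_apply f x = 0}"
  have H: "?H = annihilator {f}" by (simp add: annihilator_def)
  have "x \<in> span (insert v ?H)" for x
  proof -
    have "x - blinfun_apply f x *\<^sub>R v \<in> span ?H"
      by (rule span_base) (simp add: blinfun.diff_right blinfun.scaleR_right f)
    then show ?thesis by (auto simp: span_breakdown_eq)
  qed
  then show ?thesis
    unfolding hyperplane_def using f by (auto simp: H[symmetric] intro!: exI[of _ v]) (simp_all add: H)
qed

text \<open>The functional is the coefficient of a transversal vector \<open>v\<close>; it is
  bounded because the closed set \<open>H\<close> misses a ball around \<open>v\<close>.\<close>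

lemma hyperplane_functional:
  assumes "hyperplane H"
  obtains f :: "'a::banach \<Rightarrow>\<^sub>L real" and v where "H = {x. blinfun_apply f x = 0}" "blinfun_apply f v = 1"
proof -
  obtain v where sub: "subspace H" and cl: "closed H" and v: "v \<notin> H" "span (insert v H) = UNIV"
    using assms unfolding hyperplane_def by blast
  have spanH: "span H = H" using sub by (simp add: span_eq_iff)
  have ex: "\<exists>c. x - c *\<^sub>R v \<in> H" for x
    using v(2) span_breakdown_eq[of x v H] by (simp add: spanH)
  then obtain c where c: "\<And>x. x - c x *\<^sub>R v \<in> H" by metis
  have uniq: "c x = a" if "x - a *\<^sub>R v \<in> H" for x a
  proof (rule ccontr)
    assume ne: "c x \<noteq> a"
    have "(1 / (c x - a)) *\<^sub>R ((x - a *\<^sub>R v) - (x - c x *\<^sub>R v)) \<in> H"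
      by (intro subspace_scale[OF sub] subspace_diff[OF sub] that c)
    also have "(x - a *\<^sub>R v) - (x - c x *\<^sub>R v) = (c x - a) *\<^sub>R v" by (simp add: algebra_simps)
    finally show False using ne v(1) by simp
  qed
  obtain d where d: "d > 0" "ball v d \<subseteq> - H"
    using cl v(1) by (meson ComplI open_Compl open_contains_ball)
  have bound: "norm (c x) \<le> norm x * (1 / d)" for x
  proof (cases "c x = 0")
    case False
    have "v - (1 / c x) *\<^sub>R x = (- 1 / c x) *\<^sub>R (x - c x *\<^sub>R v)" using False by (simp add: algebra_simps)
    then have "v - (1 / c x) *\<^sub>R x \<in> H" using subspace_scale[OF sub c] by metis
    then have "d \<le> norm ((1 / c x) *\<^sub>R x)"
      using d(2) by (force simp: subset_iff dist_norm not_less[symmetric])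
    then show ?thesis using False d(1) by (simp add: field_simps)
  qed (use d(1) in simp)
  have lin: "bounded_linear c"
  proof (rule bounded_linear_intro[OF _ _ bound])
    show "c (x + y) = c x + c y" for x y
    proof (rule uniq)
      have "(x - c x *\<^sub>R v) + (y - c y *\<^sub>R v) \<in> H" by (intro subspace_add[OF sub] c)
      then show "x + y - (c x + c y) *\<^sub>R v \<in> H" by (simp add: algebra_simps)
    qed
    show "c (a *\<^sub>R x) = a *\<^sub>R c x" for a x
    proof (rule uniq)
      have "a *\<^sub>R (x - c x *\<^sub>R v) \<in> H" by (intro subspace_scale[OF sub] c)
      then show "a *\<^sub>R x - (a *\<^sub>R c x) *\<^sub>R v \<in> H" by (simp add: algebra_simps)
    qed
  qed
  show thesis
  proof (rule that)
    have "x \<in> H \<longleftrightarrow> c x = 0" for x using c[of x] uniq[of x 0] by auto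
    then show "H = {x. blinfun_apply (Blinfun c) x = 0}" using lin by (auto simp: bounded_linear_Blinfun_apply)
    show "blinfun_apply (Blinfun c) v = 1"
      using lin uniq[of v 1] subspace_0[OF sub] by (simp add: bounded_linear_Blinfun_apply)
  qed
qed

text \<open>Composition with the projection along \<open>w\<close> extends a structure on the kernel
  by 0 at \<open>w\<close>. This replaces functions on a subset by bounded operators on the space,
  in the form of a partial complex structure with \<open>k = 1\<close>.\<close>

lemma admits_complex_structure_kernel_iff:
  fixes f :: "'a::banach \<Rightarrow>\<^sub>L real"
  assumes fw: "blinfun_apply f w = 1"
  shows "admits_complex_structure {x. blinfun_apply f x = 0} \<longleftrightarrow>
    (\<exists>J :: 'a \<Rightarrow>\<^sub>L 'a. blinfun_apply J w = 0 \<and> (\<forall>x. blinfun_apply f (blinfun_apply J x) = 0) \<and>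
      (\<forall>x. blinfun_apply J (blinfun_apply J x) = blinfun_apply f x *\<^sub>R w - x))"
    (is "?L \<longleftrightarrow> ?R")
proof
  let ?H = "{x. blinfun_apply f x = 0}"
  assume ?L
  then obtain I K where IH: "I \<in> ?H \<rightarrow> ?H" and add: "\<And>x y. x \<in> ?H \<Longrightarrow> y \<in> ?H \<Longrightarrow> I (x + y) = I x + I y"
    and scale: "\<And>c x. x \<in> ?H \<Longrightarrow> I (c *\<^sub>R x) = c *\<^sub>R I x" and K: "\<And>x. x \<in> ?H \<Longrightarrow> norm (I x) \<le> K * norm x"
    and II: "\<And>x. x \<in> ?H \<Longrightarrow> I (I x) = - x"
    unfolding admits_complex_structure_def operator_on_def by blast
  define P where "P = id_blinfun - rank_one f w"
  have P: "blinfun_apply P x = x - blinfun_apply f x *\<^sub>R w" for x by (simp add: P_def blinfun.diff_left)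
  have PH: "blinfun_apply P x \<in> ?H" for x by (simp add: P blinfun.diff_right blinfun.scaleR_right fw)
  define j where "j x = I (blinfun_apply P x)" for x
  have lin: "bounded_linear j"
  proof (rule bounded_linear_intro)
    show "j (x + y) = j x + j y" for x y by (simp add: j_def blinfun.add_right add[OF PH PH])
    show "j (c *\<^sub>R x) = c *\<^sub>R j x" for c x by (simp add: j_def blinfun.scaleR_right scale[OF PH])
    show "norm (j x) \<le> norm x * (\<bar>K\<bar> * norm P)" for x
    proof -
      have "norm (j x) \<le> K * norm (blinfun_apply P x)" unfolding j_def by (rule K[OF PH])
      also have "\<dots> \<le> \<bar>K\<bar> * (norm P * norm x)" by (intro mult_mono norm_blinfun) auto
      finally show ?thesis by (simp add: mult_ac)
    qed
  qed
  note ap = bounded_linear_Blinfun_apply[OF lin]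
  have jH: "j x \<in> ?H" for x unfolding j_def using IH PH by blast
  have I0: "I 0 = 0" using scale[of 0 0] by simp
  show ?R
  proof (intro exI[of _ "Blinfun j"] conjI allI)
    show "blinfun_apply (Blinfun j) w = 0" by (simp add: ap j_def P fw I0)
    show "blinfun_apply f (blinfun_apply (Blinfun j) x) = 0" for x using jH[of x] by (simp add: ap)
    have "j (j x) = blinfun_apply f x *\<^sub>R w - x" for x
    proof -
      have "blinfun_apply P (j x) = j x" using jH[of x] by (simp add: P)
      then have "j (j x) = I (I (blinfun_apply P x))" by (simp add: j_def)
      then show ?thesis using II[OF PH, of x] by (simp add: P)
    qed
    then show "blinfun_apply (Blinfun j) (blinfun_apply (Blinfun j) x) = blinfun_apply f x *\<^sub>R w - x" for x
      by (simp add: ap)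
  qed
next
  assume ?R
  then obtain J :: "'a \<Rightarrow>\<^sub>L 'a" where J: "\<And>x. blinfun_apply f (blinfun_apply J x) = 0"
    "\<And>x. blinfun_apply J (blinfun_apply J x) = blinfun_apply f x *\<^sub>R w - x" by blast
  show ?L
    unfolding admits_complex_structure_def operator_on_def
    by (intro exI[of _ "blinfun_apply J"])
      (auto simp: J blinfun.add_right blinfun.scaleR_right intro!: exI[of _ "norm J"] norm_blinfun)
qed

text \<open>Projection along a vector \<open>w\<close> outside both hyperplanes identifies them and
  carries the structure over.\<close>

lemma admits_complex_structure_hyperplane_transfer:
  fixes H H' :: "'a::banach set"
  assumes H: "hyperplane H" "admits_complex_structure H" and H': "hyperplane H'"
  shows "admits_complex_structure H'"
proof -
  obtain f :: "'a \<Rightarrow>\<^sub>L real" and v where f: "H = {x. blinfun_apply f x = 0}" "blinfun_apply f v = 1"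
    by (rule hyperplane_functional[OF H(1)])
  obtain f' :: "'a \<Rightarrow>\<^sub>L real" and v' where f': "H' = {x. blinfun_apply f' x = 0}" "blinfun_apply f' v' = 1"
    by (rule hyperplane_functional[OF H'])
  \<comment> \<open>If neither \<open>v\<close> nor \<open>v'\<close> lies outside both kernels,
    their sum does.\<close>
  have "\<exists>u. blinfun_apply f u \<noteq> 0 \<and> blinfun_apply f' u \<noteq> 0"
  proof (cases "blinfun_apply f' v = 0 \<and> blinfun_apply f v' = 0")
    case True
    then show ?thesis using f(2) f'(2) by (intro exI[of _ "v + v'"]) (simp add: blinfun.add_right)
  next
    case False
    then show ?thesis using f(2) f'(2) by (metis zero_neq_one)
  qed
  then obtain u where u: "blinfun_apply f u \<noteq> 0" "blinfun_apply f' u \<noteq> 0" by blast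
  define w where "w = (1 / blinfun_apply f' u) *\<^sub>R u"
  define g where "g = (1 / blinfun_apply f w) *\<^sub>R f"
  have fw: "blinfun_apply f w \<noteq> 0" using u by (simp add: w_def blinfun.scaleR_right)
  have f'w: "blinfun_apply f' w = 1" using u by (simp add: w_def blinfun.scaleR_right)
  have gw: "blinfun_apply g w = 1" using fw by (simp add: g_def blinfun.scaleR_left)
  have "H = {x. blinfun_apply g x = 0}" using fw by (simp add: f(1) g_def blinfun.scaleR_left)
  then obtain J where J: "blinfun_apply J w = 0" "\<And>x. blinfun_apply J (blinfun_apply J x) = blinfun_apply g x *\<^sub>R w - x"
    using admits_complex_structure_kernel_iff[OF gw] H(2) by auto
  have J': "blinfun_apply (J - rank_one (f' o\<^sub>L J) w) x = blinfun_apply J x - blinfun_apply f' (blinfun_apply J x) *\<^sub>R w" for x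
    by (simp add: blinfun.diff_left)
  show ?thesis
    unfolding f'(1) admits_complex_structure_kernel_iff[OF f'w]
    by (intro exI[of _ "J - rank_one (f' o\<^sub>L J) w"])
      (simp add: J' J f'w blinfun.diff_right blinfun.scaleR_right scaleR_diff_left)
qed

section \<open>Type and the trichotomy\<close>

lemma ss_class_iff: "S \<in> ss_class T \<longleftrightarrow> strictly_singular (T - S)"
  by (simp add: ss_class_def ss_rel_def)

lemma quotient_ss_rel: "UNIV // ss_rel = range ss_class"
  by (auto simp: quotient_def ss_class_def)

text \<open>The scalar \<open>l T\<close> with \<open>T - l T\<close> strictly singular is unique
  and defines a character of the operator algebra whose fibres are the classes modulo strictly
  singular operators.\<close>

proposition HI_type_real:
  assumes HI: "hereditarily_indecomposable TYPE('a::banach)"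
    and scalar: "\<And>T :: 'a \<Rightarrow>\<^sub>L 'a. \<exists>c. \<not> upper_semi_fredholm (T - c *\<^sub>R id_blinfun)"
  shows "has_type TYPE('a) TYPE(real)"
proof -
  have inf: "infinite_dimensional (UNIV :: 'a set)" by (rule HI_infinite_dimensional[OF HI])
  note ss = HI_strictly_singular_iff[OF HI]
  obtain l :: "('a \<Rightarrow>\<^sub>L 'a) \<Rightarrow> real" where l: "\<And>T. \<not> upper_semi_fredholm (T - l T *\<^sub>R id_blinfun)"
    using scalar by metis
  have add: "\<not> upper_semi_fredholm (S + T)" if "\<not> upper_semi_fredholm S" "\<not> upper_semi_fredholm T"
    for S T :: "'a \<Rightarrow>\<^sub>L 'a"
    using HI_upper_semi_fredholm_add[OF HI] that by blast
  have scale: "\<not> upper_semi_fredholm (c *\<^sub>R T)" if "\<not> upper_semi_fredholm T" for c and T :: "'a \<Rightarrow>\<^sub>L 'a"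
    using that upper_semi_fredholm_scaleR_iff[of c T] not_upper_semi_fredholm_zero[OF inf]
    by (cases "c = 0") auto
  \<comment> \<open>Two such scalars would make their nonzero difference times the identity a sum of
    operators that are not semi-Fredholm.\<close>
  have l_eq: "l T = c" if "\<not> upper_semi_fredholm (T - c *\<^sub>R id_blinfun)" for T c
  proof (rule ccontr)
    assume "l T \<noteq> c"
    then have "upper_semi_fredholm ((l T - c) *\<^sub>R (id_blinfun :: 'a \<Rightarrow>\<^sub>L 'a))"
      by (intro upper_semi_fredholm_scaleR upper_semi_fredholm_id) simp
    also have "(l T - c) *\<^sub>R id_blinfun = (T - c *\<^sub>R id_blinfun) + (- 1) *\<^sub>R (T - l T *\<^sub>R id_blinfun)"
      by (simp add: algebra_simps)
    finally show False using add[OF that scale[OF l]] by blast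
  qed
  have l_add: "l (S + T) = l S + l T" for S T
    using add[OF l[of S] l[of T]] by (intro l_eq) (simp add: algebra_simps)
  have l_scale: "l (c *\<^sub>R T) = c * l T" for c T
    using scale[OF l[of T], of c] by (intro l_eq) (simp add: algebra_simps)
  have l_compose: "l (S o\<^sub>L T) = l S * l T" for S T
  proof (rule l_eq)
    \<comment> \<open>Uses \<open>S T - l S l T = (S - l S) T + l S (T - l T)\<close>.\<close>
    have "\<not> upper_semi_fredholm ((S - l S *\<^sub>R id_blinfun) o\<^sub>L T)"
      using HI_upper_semi_fredholm_compose_left[OF HI inf] l by blast
    from add[OF this scale[OF l[of T], of "l S"]]
    show "\<not> upper_semi_fredholm ((S o\<^sub>L T) - (l S * l T) *\<^sub>R id_blinfun)"
      by (simp add: blinfun_compose_bilinear algebra_simps)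
  qed
  have l_id: "l (c *\<^sub>R id_blinfun) = c" for c
    by (rule l_eq) (simp add: not_upper_semi_fredholm_zero[OF inf])
  have class_iff: "S \<in> ss_class T \<longleftrightarrow> l S = l T" for S T
  proof -
    have "S \<in> ss_class T \<longleftrightarrow> \<not> upper_semi_fredholm ((T - S) - 0 *\<^sub>R id_blinfun)"
      by (simp add: ss_class_iff ss)
    also have "\<dots> \<longleftrightarrow> l (T - S) = 0" using l_eq l by metis
    also have "l (T - S) = l T - l S" using l_add[of T "- S"] l_scale[of "- 1" S] by simp
    finally show ?thesis by auto
  qed
  define \<phi> where "\<phi> A = l (SOME T. T \<in> A)" for A
  have \<phi>: "\<phi> (ss_class T) = l T" for T
  proof -
    have "T \<in> ss_class T" by (simp add: class_iff)
    then have "(SOME S. S \<in> ss_class T) \<in> ss_class T" by (rule someI)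
    then show ?thesis by (simp add: \<phi>_def class_iff)
  qed
  \<comment> \<open>A scalar larger in modulus than \<open>norm T\<close> would make
    \<open>T - l T\<close> invertible.\<close>
  have l_norm: "\<bar>l T\<bar> \<le> norm T" for T
  proof (rule ccontr)
    assume *: "\<not> \<bar>l T\<bar> \<le> norm T"
    then have l0: "l T \<noteq> 0" by auto
    have "norm ((- 1 / l T) *\<^sub>R T) < 1" using * l0 by (simp add: field_simps)
    then have "invertible_blinfun (id_blinfun + (- 1 / l T) *\<^sub>R T)" by (rule invertible_id_plus)
    then have "upper_semi_fredholm (id_blinfun + (- 1 / l T) *\<^sub>R T)"
      by (intro fredholm_index_0_upper_semi_fredholm invertible_fredholm_index_0)
    then have "upper_semi_fredholm ((- l T) *\<^sub>R (id_blinfun + (- 1 / l T) *\<^sub>R T))"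
      by (rule upper_semi_fredholm_scaleR) (use l0 in simp)
    also have "(- l T) *\<^sub>R (id_blinfun + (- 1 / l T) *\<^sub>R T) = T - l T *\<^sub>R id_blinfun"
      using l0 by (simp add: algebra_simps)
    finally show False using l by blast
  qed
  have lower: "norm (l T) \<le> 1 * quotient_norm (ss_class T)" for T
  proof -
    have "\<bar>l T\<bar> \<le> quotient_norm (ss_class T)"
      unfolding quotient_norm_def
    proof (rule cINF_greatest)
      show "ss_class T \<noteq> {}" using class_iff by blast
      show "\<bar>l T\<bar> \<le> norm S" if "S \<in> ss_class T" for S using that l_norm[of S] by (simp add: class_iff)
    qed
    then show ?thesis by simp
  qed
  \<comment> \<open>The class of \<open>T\<close> contains the scalar operator \<open>l T\<close>,
    whose norm is at most \<open>\<bar>l T\<bar>\<close>.\<close>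
  have upper: "quotient_norm (ss_class T) \<le> 1 * norm (l T)" for T
  proof -
    have "quotient_norm (ss_class T) \<le> norm (l T *\<^sub>R (id_blinfun :: 'a \<Rightarrow>\<^sub>L 'a))"
      unfolding quotient_norm_def
      by (rule cINF_lower) (auto simp: class_iff l_id intro: bdd_belowI2[of _ 0])
    also have "\<dots> \<le> \<bar>l T\<bar> * 1"
      unfolding norm_scaleR by (intro mult_left_mono norm_blinfun_id_le) auto
    finally show ?thesis by simp
  qed
  have "quotient_algebra_iso \<phi>"
    unfolding quotient_algebra_iso_def quotient_ss_rel
  proof (intro conjI allI)
    show "bij_betw \<phi> (range ss_class) UNIV"
      unfolding bij_betw_def
    proof
      show "inj_on \<phi> (range ss_class)"
      proof (rule inj_onI, clarify)
        fix S T assume "\<phi> (ss_class S) = \<phi> (ss_class T)"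
        then show "ss_class S = ss_class T" by (auto simp: \<phi> class_iff)
      qed
      show "\<phi> ` range ss_class = UNIV"
        by (auto simp: image_image \<phi> surj_def intro!: exI[of _ "_ *\<^sub>R id_blinfun"] l_id[symmetric])
    qed
    show "\<phi> (ss_class id_blinfun) = 1" using l_id[of 1] by (simp add: \<phi>)
    show "\<exists>K. \<forall>A\<in>range ss_class. norm (\<phi> A) \<le> K * quotient_norm A"
      by (rule exI[of _ 1]) (use lower in \<open>auto simp: \<phi>\<close>)
    show "\<exists>K. \<forall>A\<in>range ss_class. quotient_norm A \<le> K * norm (\<phi> A)"
      by (rule exI[of _ 1]) (use upper in \<open>auto simp: \<phi>\<close>)
  qed (simp_all add: \<phi> l_add l_scale l_compose)
  then show ?thesis unfolding has_type_def by blast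
qed

text \<open>A character into the reals would take \<open>C\<close> to a square root of -1, as the
  finite-rank \<open>K\<close> is mapped to 0. Taking \<open>K = 0\<close> excludes even spaces, a
  rank-one \<open>K\<close> odd ones.\<close>

lemma HI_type_real_no_almost_complex_structure:
  fixes C :: "'a::banach \<Rightarrow>\<^sub>L 'a"
  assumes HI: "hereditarily_indecomposable TYPE('a)" and R: "has_type TYPE('a) TYPE(real)"
    and K: "finite_rank K" and C: "C o\<^sub>L C = K - id_blinfun"
  shows False
proof -
  obtain \<phi> :: "('a \<Rightarrow>\<^sub>L 'a) set \<Rightarrow> real" where
    add: "\<And>S T. \<phi> (ss_class (S + T)) = \<phi> (ss_class S) + \<phi> (ss_class T)" and
    scale: "\<And>c T. \<phi> (ss_class (c *\<^sub>R T)) = c *\<^sub>R \<phi> (ss_class T)" and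
    compose: "\<And>S T. \<phi> (ss_class (S o\<^sub>L T)) = \<phi> (ss_class S) * \<phi> (ss_class T)" and
    one: "\<phi> (ss_class id_blinfun) = 1"
    using R unfolding has_type_def quotient_algebra_iso_def by blast
  have "ss_class K = ss_class (0 :: 'a \<Rightarrow>\<^sub>L 'a)"
  proof (rule set_eqI)
    fix S :: "'a \<Rightarrow>\<^sub>L 'a"
    have "upper_semi_fredholm (K - S) \<longleftrightarrow> upper_semi_fredholm (0 - S)"
      using upper_semi_fredholm_finite_rank[of "K - S" "- K"] upper_semi_fredholm_finite_rank[of "0 - S" K]
        finite_rank_uminus[OF K] K by (auto simp: algebra_simps)
    then show "S \<in> ss_class K \<longleftrightarrow> S \<in> ss_class 0" by (simp add: ss_class_iff HI_strictly_singular_iff[OF HI])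
  qed
  then have "\<phi> (ss_class K) = 0" using scale[of 0 0] by simp
  moreover have "\<phi> (ss_class (C o\<^sub>L C)) = \<phi> (ss_class K) + (- 1) *\<^sub>R \<phi> (ss_class id_blinfun)"
    unfolding add[symmetric] scale[symmetric] C by simp
  ultimately have "\<phi> (ss_class C) * \<phi> (ss_class C) = - 1" by (simp add: one flip: compose)
  then show False using zero_le_square[of "\<phi> (ss_class C)"] by simp
qed

theorem theorem4p2:
  assumes "hereditarily_indecomposable TYPE('a::banach)"
  shows "(has_type TYPE('a) TYPE(real) \<or> even_space TYPE('a) \<or> odd_space TYPE('a)) \<and>
         \<not> (has_type TYPE('a) TYPE(real) \<and> even_space TYPE('a)) \<and>
         \<not> (has_type TYPE('a) TYPE(real) \<and> odd_space TYPE('a)) \<and>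
         \<not> (even_space TYPE('a) \<and> odd_space TYPE('a))"
proof (intro conjI notI)
  note HI = assms
  have UNIV_iff: "admits_complex_structure (UNIV :: 'a set) \<longleftrightarrow>
      (\<exists>I :: 'a \<Rightarrow>\<^sub>L 'a. \<forall>x. blinfun_apply I (blinfun_apply I x) = - x)"
    unfolding admits_complex_structure_UNIV
    by (metis blinfun_apply_blinfun_compose blinfun_apply_id_blinfun blinfun_eqI uminus_blinfun.rep_eq)
  have parity: "\<not> admits_complex_structure H"
    if univ: "admits_complex_structure (UNIV :: 'a set)" and H: "hyperplane H" for H :: "'a set"
  proof
    assume cs: "admits_complex_structure H"
    obtain f :: "'a \<Rightarrow>\<^sub>L real" and v where f: "H = {x. blinfun_apply f x = 0}" "blinfun_apply f v = 1"
      by (rule hyperplane_functional[OF H])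
    obtain I :: "'a \<Rightarrow>\<^sub>L 'a" where I: "\<And>x. blinfun_apply I (blinfun_apply I x) = - x"
      using univ unfolding UNIV_iff by blast
    obtain J where "blinfun_apply J v = 0" "\<And>x. blinfun_apply f (blinfun_apply J x) = 0"
      "\<And>x. blinfun_apply J (blinfun_apply J x) = blinfun_apply f x *\<^sub>R v - x"
      using cs unfolding f(1) admits_complex_structure_kernel_iff[OF f(2)] by blast
    then show False using HI_complex_structure_parity[OF HI I f(2), of J] by blast
  qed
  show "has_type TYPE('a) TYPE(real) \<or> even_space TYPE('a) \<or> odd_space TYPE('a)"
  proof (cases "\<forall>T :: 'a \<Rightarrow>\<^sub>L 'a. \<exists>c. \<not> upper_semi_fredholm (T - c *\<^sub>R id_blinfun)")
    case True
    then show ?thesis using HI_type_real[OF HI] by blast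
  next
    case False
    then obtain T :: "'a \<Rightarrow>\<^sub>L 'a" where "\<And>c. upper_semi_fredholm (T - c *\<^sub>R id_blinfun)" by blast
    then obtain I :: "'a \<Rightarrow>\<^sub>L 'a" where "(I o\<^sub>L I) + id_blinfun \<in> approximable"
      using almost_complex_structure by blast
    then show ?thesis
    proof (cases rule: complex_structure_or_hyperplane)
      case (1 C)
      then have "admits_complex_structure (UNIV :: 'a set)" unfolding UNIV_iff by blast
      then show ?thesis using parity unfolding even_space_def by blast
    next
      case (2 C f w)
      have H: "hyperplane {x. blinfun_apply f x = 0}" by (rule hyperplane_kernel[OF 2(1)])
      have cs: "admits_complex_structure {x. blinfun_apply f x = 0}"
        unfolding admits_complex_structure_kernel_iff[OF 2(1)] using 2 by blast
      have "\<not> admits_complex_structure (UNIV :: 'a set)" using parity H cs by blast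
      then show ?thesis
        unfolding odd_space_def using admits_complex_structure_hyperplane_transfer[OF H cs] by blast
    qed
  qed
  show False if both: "has_type TYPE('a) TYPE(real) \<and> even_space TYPE('a)"
  proof -
    obtain C :: "'a \<Rightarrow>\<^sub>L 'a" where "C o\<^sub>L C = - id_blinfun"
      using both unfolding even_space_def admits_complex_structure_UNIV by blast
    then show False
      using HI_type_real_no_almost_complex_structure[OF HI _ finite_rank.zero, of C] both by simp
  qed
  show False if both: "has_type TYPE('a) TYPE(real) \<and> odd_space TYPE('a)"
  proof -
    \<comment> \<open>The odd case asserts something about all hyperplanes, so one has to be
      exhibited: the kernel of a norming functional.\<close>
    have "\<exists>v :: 'a. v \<noteq> 0"
      using HI_infinite_dimensional[OF HI] infinite_dimensional_not_subset_span[of "UNIV :: 'a set" "{}"] by auto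
    then obtain v :: 'a where v: "v \<noteq> 0" by blast
    obtain h :: "'a \<Rightarrow>\<^sub>L real" where h: "blinfun_apply h v = norm v" using norming_functional by blast
    define f where "f = (1 / norm v) *\<^sub>R h"
    have f: "blinfun_apply f v = 1" using v h by (simp add: f_def blinfun.scaleR_left)
    then have "admits_complex_structure {x. blinfun_apply f x = 0}"
      using both hyperplane_kernel unfolding odd_space_def by blast
    then obtain J where "\<And>x. blinfun_apply J (blinfun_apply J x) = blinfun_apply f x *\<^sub>R v - x"
      unfolding admits_complex_structure_kernel_iff[OF f] by blast
    then have "J o\<^sub>L J = rank_one f v - id_blinfun"
      by (intro blinfun_eqI) (simp add: blinfun.diff_left)
    then show False
      using HI_type_real_no_almost_complex_structure[OF HI _ finite_rank_rank_one] both by blast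
  qed
  show False if both: "even_space TYPE('a) \<and> odd_space TYPE('a)"
    using both unfolding even_space_def odd_space_def by blast
qed

end
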